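(* Let $\{f^n_l:n\ge 0,\ 1\le l\le L\}$ be the basic multiwavelet packets associated with an MRA $\{V_j\}_{j\in\mathbb{Z}}$ of $L^2(\mathbb{R}^d)$ of multiplicity $L$ with dilation matrix $A$, and let $S\subset\mathbb{N}_0\times\mathbb{Z}$. For $(n,j)\in\mathbb N_0\times\mathbb Z$ let $I_{n,j}=\{r\in\mathbb{N}_0: a^jn\le r\le a^j(n+1)-1\}$. Then the collection of functions $$\{a^{j/2}f^n_l(A^j\cdot-k): 1\le l\le L,\ k\in\mathbb{Z}^d,\ (n,j)\in S\}$$ is an orthonormal basis of $L^2(\mathbb{R}^d)$ if and only if $\{I_{n,j}:(n,j)\in S\}$ is a partition of $\mathbb{N}_0$.
   Context: $\mathbb{N}_0=\{0,1,2,\dots\}$. A family $\{A_i:i\in I\}$ is a partition of $\mathbb{N}_0$ if $A_i\subset\mathbb{N}_0$, the $A_i$ are pairwise disjoint, and $\bigcup_{i}A_i=\mathbb{N}_0$. A dilation matrix for $\mathbb{R}^d$ is a $d\times d$ matrix $A$ with $A(\mathbb{Z}^d)\subset\mathbb{Z}^d$ all of whose eigenvalues $\lambda$ satisfy $|\lambda|>1$. Put $B=A^t$ and $a=|\det A|=|\det B|$ (an integer $\geq 2$). A set of digits $K_B$ for $B$ is a subset of $\mathbb{Z}^d$ containing exactly one element of each of the $a$ cosets of $B\mathbb{Z}^d$ in $\mathbb{Z}^d$. An MRA of $L^2(\mathbb{R}^d)$ of multiplicity $L$ associated with $A$ is a sequence $\{V_j\}_{j\in\mathbb{Z}}$ of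 closed subspaces of $L^2(\mathbb{R}^d)$ such that: (M1) $V_j\subset V_{j+1}$ for all $j$; (M2) $\bigcup_j V_j$ is dense in $L^2(\mathbb{R}^d)$ and $\bigcap_j V_j=\{0\}$; (M3) $f\in V_j$ if and only if $f(A\,\cdot)\in V_{j+1}$; (M4) there are $\varphi_1,\dots,\varphi_L\in V_0$ (the scaling functions) such that $\{\varphi_l(\cdot-k):1\le l\le L,\ k\in\mathbb{Z}^d\}$ is an orthonormal basis of $V_0$. Basic multiwavelet packets. Let $\{h^0_{ljk}\}_{k}\in l^2(\mathbb{Z}^d)$, $1\le l,j\le L$, be the sequences with $\varphi_l(x)=\sum_{j=1}^L\sum_{k\in\mathbb{Z}^d}h^0_{ljk}a^{1/2}\varphi_j(Ax-k)$. Fix a set of digits $K_B$ for $B$, and fix sequences $\{h^r_{ljk}\}_k\in l^2(\mathbb{Z}^d)$, $1\le r\le a-1$, $1\le l,j\le L$, such that, with $h^r_{lj}(\xi)=\sum_{k\in\mathbb{Z}^d}a^{-1/2}h^r_{ljk}e^{-i\langle \xi,k\rangle}$ and $H_r(\xi)=(h^r_{lj}(\xi))_{1\le l,j\le L}$ for $0\le r\le a-1$, one has $$\sum_{\mu\in K_B}H_r(\xi+2\pi B^{-1}\mu)H_s^*(\xi+2\pi B^{-1}\mu)=\delta_{rs}I_L\quad\text{for a.e. }\xi,\ 0\le r,s\le a-1,$$ where $M^*$ is the conjugate transpose and $I_L$ the identity matrix of order $L$ (such sequences exist). Set $f^0_l=\varphi_l$, and define $f^n_l$ for all integers $n\ge0$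 recursively by $$f^{s+ar}_l(x)=\sum_{j=1}^L\sum_{k\in\mathbb{Z}^d}h^s_{ljk}a^{1/2}f^r_j(Ax-k),\qquad 0\le s\le a-1,\ r\ge 0,\ 1\le l\le L$$ (series converging in $L^2$). The functions $f^n_l$, $n\ge0$, $1\le l\le L$, are the basic multiwavelet packets.
   Formalization: The scales are restricted to j ≥ 0 for all (n,j) in S: for j < 0 every I_{n,j} is empty, so the claim fails as printed, e.g. S = {(n,-1): n ≥ 0} gives an orthonormal basis but not a partition. *)

theory Defs
  imports "HOL-Analysis.Analysis"
begin

section \<open>Square integrable functions\<close>

text \<open>
  Elements of \<open>L\<^sup>2(M)\<close> are represented by functions.  No quotient is taken: a closed subspace
  is a set of functions that, being closed under limits in the \<open>L\<^sup>2\<close> seminorm, is saturated under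
  equality almost everywhere, and equality of elements of \<open>L\<^sup>2(M)\<close> means equality almost everywhere.
\<close>

definition L2_space :: "'a measure \<Rightarrow> ('a \<Rightarrow> complex) set" where
  "L2_space M = {f \<in> borel_measurable M. integrable M (\<lambda>x. (norm (f x))\<^sup>2)}"

definition L2_inner :: "'a measure \<Rightarrow> ('a \<Rightarrow> complex) \<Rightarrow> ('a \<Rightarrow> complex) \<Rightarrow> complex" where
  "L2_inner M f g = (LINT x|M. f x * cnj (g x))"

definition L2_norm :: "'a measure \<Rightarrow> ('a \<Rightarrow> complex) \<Rightarrow> real" where
  "L2_norm M f = sqrt (LINT x|M. (norm (f x))\<^sup>2)"

definition L2_has_sum ::
    "'a measure \<Rightarrow> ('i \<Rightarrow> 'a \<Rightarrow> complex) \<Rightarrow> 'i set \<Rightarrow> ('a \<Rightarrow> complex) \<Rightarrow> bool" where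
  "L2_has_sum M e I F \<longleftrightarrow>
     F \<in> L2_space M \<and> (\<forall>i\<in>I. e i \<in> L2_space M) \<and>
     ((\<lambda>X. L2_norm M (\<lambda>x. F x - (\<Sum>i\<in>X. e i x))) \<longlongrightarrow> 0) (finite_subsets_at_top I)"

definition closed_L2_subspace :: "'a measure \<Rightarrow> ('a \<Rightarrow> complex) set \<Rightarrow> bool" where
  "closed_L2_subspace M V \<longleftrightarrow>
     V \<subseteq> L2_space M \<and> (\<lambda>x. 0) \<in> V \<and>
     (\<forall>f\<in>V. \<forall>g\<in>V. (\<lambda>x. f x + g x) \<in> V) \<and>
     (\<forall>c. \<forall>f\<in>V. (\<lambda>x. c * f x) \<in> V) \<and>
     (\<forall>g f. (\<forall>n::nat. g n \<in> V) \<and> f \<in> L2_space M \<and>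
        (\<lambda>n. L2_norm M (\<lambda>x. g n x - f x)) \<longlonglongrightarrow> 0 \<longrightarrow> f \<in> V)"

text \<open>
  An orthonormal basis is an indexed family: distinct indices give orthogonal, hence distinct,
  elements.
\<close>

definition orthonormal_basis ::
    "'a measure \<Rightarrow> ('i \<Rightarrow> 'a \<Rightarrow> complex) \<Rightarrow> 'i set \<Rightarrow> ('a \<Rightarrow> complex) set \<Rightarrow> bool" where
  "orthonormal_basis M e I V \<longleftrightarrow>
     (\<forall>i\<in>I. e i \<in> V) \<and>
     (\<forall>i\<in>I. \<forall>i'\<in>I. L2_inner M (e i) (e i') = (if i = i' then 1 else 0)) \<and>
     (\<forall>f\<in>V. \<forall>\<epsilon>>0. \<exists>X c. finite X \<and> X \<subseteq> I \<and>
        L2_norm M (\<lambda>x. f x - (\<Sum>i\<in>X. c i * e i x)) < \<epsilon>)"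


section \<open>Dilation matrices\<close>

definition int_lattice :: "(real ^ 'd) set" where
  "int_lattice = {x. \<forall>i. x $ i \<in> \<int>}"

definition complex_matrix :: "real ^ 'd ^ 'd \<Rightarrow> complex ^ 'd ^ 'd" where
  "complex_matrix A = (\<chi> i j. complex_of_real (A $ i $ j))"

definition dilation_matrix :: "real ^ 'd ^ 'd \<Rightarrow> bool" where
  "dilation_matrix A \<longleftrightarrow>
     (\<forall>k\<in>int_lattice. A *v k \<in> int_lattice) \<and>
     (\<forall>ev v. v \<noteq> 0 \<and> complex_matrix A *v v = ev *s v \<longrightarrow> 1 < norm ev)"

definition digit_set :: "real ^ 'd ^ 'd \<Rightarrow> (real ^ 'd) set \<Rightarrow> bool" where
  "digit_set B K \<longleftrightarrow>
     K \<subseteq> int_lattice \<and> (\<forall>x\<in>int_lattice. \<exists>!\<mu>. \<mu> \<in> K \<and> x - \<mu> \<in> (*v) B ` int_lattice)"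

definition matrix_powi :: "real ^ 'd ^ 'd \<Rightarrow> int \<Rightarrow> real ^ 'd ^ 'd" where
  "matrix_powi A j =
     (if 0 \<le> j then (((**) A) ^^ nat j) (mat 1) else (((**) (matrix_inv A)) ^^ nat (- j)) (mat 1))"


section \<open>Multiresolution analyses\<close>

text \<open>The multiplicity \<open>L\<close> is the cardinality of the finite index type of the scaling functions.\<close>

definition mra ::
    "real ^ 'd ^ 'd \<Rightarrow> (int \<Rightarrow> (real ^ 'd \<Rightarrow> complex) set) \<Rightarrow>
     ('l::finite \<Rightarrow> real ^ 'd \<Rightarrow> complex) \<Rightarrow> bool" where
  "mra A V \<phi> \<longleftrightarrow>
     (\<forall>j. closed_L2_subspace lborel (V j)) \<and>
     (\<forall>j. V j \<subseteq> V (j + 1)) \<and>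
     (\<forall>f\<in>L2_space lborel. \<forall>\<epsilon>>0. \<exists>g\<in>(\<Union>j. V j). L2_norm lborel (\<lambda>x. f x - g x) < \<epsilon>) \<and>
     (\<Inter>j. V j) = {f \<in> L2_space lborel. AE x in lborel. f x = 0} \<and>
     (\<forall>j f. f \<in> V j \<longleftrightarrow> (\<lambda>x. f (A *v x)) \<in> V (j + 1)) \<and>
     (\<forall>l. \<phi> l \<in> V 0) \<and>
     orthonormal_basis lborel (\<lambda>(l, k) x. \<phi> l (x - k)) (UNIV \<times> int_lattice) (V 0)"


section \<open>Multiwavelet packets\<close>

definition torus_measure :: "(real ^ 'd) measure" where
  "torus_measure = restrict_space lborel (cbox 0 (\<chi> i. 2 * pi))"

text \<open>
  For \<open>c \<in> l\<^sup>2(\<int>\<^sup>d)\<close> the trigonometric series \<open>\<Sum>\<^sub>k c\<^sub>k e\<^bsup>-i\<langle>\<xi>,k\<rangle>\<^esup>\<close> converges in \<open>L\<^sup>2\<close> of the torus only,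
  so its sum is a periodic function determined up to a null set.
\<close>

definition trig_series_sum :: "(real ^ 'd \<Rightarrow> complex) \<Rightarrow> (real ^ 'd \<Rightarrow> complex) \<Rightarrow> bool" where
  "trig_series_sum c F \<longleftrightarrow>
     (\<forall>\<xi>. \<forall>k\<in>int_lattice. F (\<xi> + (2 * pi) *\<^sub>R k) = F \<xi>) \<and>
     L2_has_sum torus_measure (\<lambda>k \<xi>. c k * exp (- (\<i> * complex_of_real (\<xi> \<bullet> k)))) int_lattice F"

definition conj_transpose :: "complex ^ 'm ^ 'n \<Rightarrow> complex ^ 'n ^ 'm" where
  "conj_transpose M = (\<chi> i j. cnj (M $ j $ i))"

definition refines ::
    "real ^ 'd ^ 'd \<Rightarrow> nat \<Rightarrow> ('l::finite \<Rightarrow> 'l \<Rightarrow> real ^ 'd \<Rightarrow> complex) \<Rightarrow>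
     ('l \<Rightarrow> real ^ 'd \<Rightarrow> complex) \<Rightarrow> ('l \<Rightarrow> real ^ 'd \<Rightarrow> complex) \<Rightarrow> bool" where
  "refines A a h g f \<longleftrightarrow>
     (\<forall>l. L2_has_sum lborel
        (\<lambda>(j, k) x. h l j k * complex_of_real (sqrt (real a)) * g j (A *v x - k))
        (UNIV \<times> int_lattice) (f l))"

text \<open>
  \<open>h r l j k\<close> is the coefficient \<open>h\<^sup>r\<^sub>l\<^sub>j\<^sub>k\<close>, relevant for \<open>r < a\<close> and \<open>k\<close> in the lattice only;
  the entry of the matrix \<open>H r \<xi>\<close> in row \<open>l\<close> and column \<open>j\<close> is \<open>H r \<xi> $ l $ j\<close>.
\<close>

definition multiwavelet_filters ::
    "real ^ 'd ^ 'd \<Rightarrow> nat \<Rightarrow> (real ^ 'd) set \<Rightarrow> ('l::finite \<Rightarrow> real ^ 'd \<Rightarrow> complex) \<Rightarrow>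
     (nat \<Rightarrow> 'l \<Rightarrow> 'l \<Rightarrow> real ^ 'd \<Rightarrow> complex) \<Rightarrow> bool" where
  "multiwavelet_filters A a K \<phi> h \<longleftrightarrow>
     (\<forall>r<a. \<forall>l j. (\<lambda>k. (norm (h r l j k))\<^sup>2) summable_on int_lattice) \<and>
     refines A a (h 0) \<phi> \<phi> \<and>
     (\<exists>H :: nat \<Rightarrow> real ^ 'd \<Rightarrow> complex ^ 'l ^ 'l.
        (\<forall>r<a. \<forall>l j. trig_series_sum
           (\<lambda>k. complex_of_real (1 / sqrt (real a)) * h r l j k) (\<lambda>\<xi>. H r \<xi> $ l $ j)) \<and>
        (\<forall>r<a. \<forall>s<a. AE \<xi> in lborel.
           (\<Sum>\<mu>\<in>K. H r (\<xi> + (2 * pi) *\<^sub>R (matrix_inv (transpose A) *v \<mu>)) **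
              conj_transpose (H s (\<xi> + (2 * pi) *\<^sub>R (matrix_inv (transpose A) *v \<mu>))))
           = (if r = s then mat 1 else 0)))"

definition basic_multiwavelet_packets ::
    "real ^ 'd ^ 'd \<Rightarrow> nat \<Rightarrow> ('l::finite \<Rightarrow> real ^ 'd \<Rightarrow> complex) \<Rightarrow>
     (nat \<Rightarrow> 'l \<Rightarrow> 'l \<Rightarrow> real ^ 'd \<Rightarrow> complex) \<Rightarrow>
     (nat \<Rightarrow> 'l \<Rightarrow> real ^ 'd \<Rightarrow> complex) \<Rightarrow> bool" where
  "basic_multiwavelet_packets A a \<phi> h f \<longleftrightarrow>
     f 0 = \<phi> \<and> (\<forall>r. \<forall>s<a. refines A a (h s) (f r) (f (s + a * r)))"

definition scaled_packet ::
    "real ^ 'd ^ 'd \<Rightarrow> nat \<Rightarrow> (nat \<Rightarrow> 'l \<Rightarrow> real ^ 'd \<Rightarrow> complex) \<Rightarrow>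
     'l \<times> (real ^ 'd) \<times> nat \<times> int \<Rightarrow> real ^ 'd \<Rightarrow> complex" where
  "scaled_packet A a f = (\<lambda>(l, k, n, j) x.
     complex_of_real (real a powr (real_of_int j / 2)) * f n l (matrix_powi A j *v x - k))"

definition packet_cell :: "nat \<Rightarrow> nat \<times> int \<Rightarrow> nat set" where
  "packet_cell a = (\<lambda>(n, j).
     {r. real a powi j * real n \<le> real r \<and> real r \<le> real a powi j * (real n + 1) - 1})"

definition partition_of_nat :: "('i \<Rightarrow> nat set) \<Rightarrow> 'i set \<Rightarrow> bool" where
  "partition_of_nat P I \<longleftrightarrow> disjoint_family_on P I \<and> (\<Union>i\<in>I. P i) = UNIV"

text \<open>
  For a negative scale the cell is empty although the functions of that scale are not zero, so an
  equivalence between bases and partitions of the natural numbers into cells can only hold for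
  index sets whose scales are nonnegative.  For instance the index set of all \<open>(n, -1)\<close> gives
  a basis, being the image of the basis of all \<open>(n, 0)\<close> under a unitary dilation, but its cells
  are empty; adjoining \<open>(0, -1)\<close> to all \<open>(n, 0)\<close> destroys orthogonality but adds only an
  empty cell.
\<close>

lemma packet_cell_negative:
  assumes "2 \<le> a" "j < 0"
  shows "packet_cell a (n, j) = {}"
proof -
  have "real a powi j < 1"
    using assms by (simp add: power_int_def power_inverse one_less_power inverse_less_1_iff)
  then have "real a powi j * (real n + 1) - 1 < real a powi j * real n"
    by (simp add: algebra_simps)
  then show ?thesis
    by (auto simp: packet_cell_def)
qed

end

theory Submission
  imports Defs
begin

text \<open>
  Let \<open>W\<^sub>n\<close> be the closed span of the translates of \<open>f n\<close>, and let \<open>D\<close> be the unitary dilation by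
  \<open>A\<close>.  The filter condition says that the coefficient vectors of the functions \<open>f (s + a * r) l (x - m)\<close>
  in the orthonormal system \<open>D (f r j (x - k))\<close> are orthonormal, by the Parseval identity on the
  torus.  Completeness needs no second Fourier argument: the Bessel sum of each vector of that system
  is at most 1, while the Bessel sums over all \<open>j\<close> and over \<open>k\<close> in one digit set of \<open>A\<close> add up to the
  number of such pairs, so all of them equal 1.  Hence \<open>D W\<^sub>r\<close> is the orthogonal sum of
  the \<open>W\<^bsub>s + a r\<^esub>\<close>, \<open>s < a\<close>, so that \<open>D\<^sup>j W\<^sub>n\<close> is the orthogonal sum of the \<open>W\<^sub>r\<close> with \<open>r\<close> in the cell of
  \<open>(n, j)\<close>, while density of the \<open>V j\<close> shows that \<open>L\<^sup>2\<close> is the orthogonal sum of all \<open>W\<^sub>r\<close>.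
\<close>

section \<open>Square integrable functions\<close>

text \<open>The filter condition lives on the Fourier side and involves digits of
  \<open>transpose A\<close>, whereas the counting takes place among translation indices and needs
  digits of \<open>A\<close> itself. Both kinds of digit set have \<open>a\<close> elements because
  two fundamental domains of one lattice have equal measure; the same fact makes torus integrals
  invariant under shifts.

  The customary argument would turn row relations of a unitary block matrix into column relations.
  The count needs only that every row has norm 1, together with Bessel's inequality.

  Orthogonality of packets with different numbers is an induction along the map from
  \<open>n\<close> to \<open>n div a\<close>, which decreases only if \<open>a\<close> is at least
  2. This bound is drawn from the multiresolution analysis instead of from the eigenvalues: for
  \<open>a = 1\<close> the space \<open>V 0\<close> would lie in every \<open>V j\<close> and hence
  be null.

  After that, the equivalence concerns sets of natural numbers only: a packet with number
  \<open>t\<close> is the test vector that detects whether \<open>t\<close> lies in no cell or in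
  several.\<close>

lemma L2_spaceD:
  assumes "f \<in> L2_space M"
  shows "f \<in> borel_measurable M" "integrable M (\<lambda>x. (norm (f x))\<^sup>2)"
  using assms by (auto simp: L2_space_def)

lemma L2_inner_integrable:
  assumes f: "f \<in> L2_space M" and g: "g \<in> L2_space M"
  shows "integrable M (\<lambda>x. f x * cnj (g x))"
proof (rule Bochner_Integration.integrable_bound)
  show "integrable M (\<lambda>x. (norm (f x))\<^sup>2 + (norm (g x))\<^sup>2)"
    using L2_spaceD[OF f] L2_spaceD[OF g] by simp
  have "(\<lambda>x. cnj (g x)) \<in> borel_measurable M"
    by (rule measurable_compose[OF L2_spaceD(1)[OF g]])
      (intro borel_measurable_continuous_onI continuous_on_cnj continuous_on_id)
  then show "(\<lambda>x. f x * cnj (g x)) \<in> borel_measurable M"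
    by (rule borel_measurable_times[OF L2_spaceD(1)[OF f]])
  have "norm (f x * cnj (g x)) \<le> (norm (f x))\<^sup>2 + (norm (g x))\<^sup>2" for x
  proof -
    have "0 \<le> norm (f x) * norm (g x)"
      by simp
    then show ?thesis
      using sum_squares_bound[of "norm (f x)" "norm (g x)"] unfolding norm_mult complex_mod_cnj
      by linarith
  qed
  then show "AE x in M. norm (f x * cnj (g x)) \<le> norm ((norm (f x))\<^sup>2 + (norm (g x))\<^sup>2)"
    by simp
qed

lemma L2_space_zero [simp]: "(\<lambda>x. 0) \<in> L2_space M"
  by (simp add: L2_space_def)

lemma L2_space_add:
  assumes f: "f \<in> L2_space M" and g: "g \<in> L2_space M"
  shows "(\<lambda>x. f x + g x) \<in> L2_space M"
  unfolding L2_space_def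
proof (intro CollectI conjI)
  show "(\<lambda>x. f x + g x) \<in> borel_measurable M"
    using L2_spaceD(1)[OF f] L2_spaceD(1)[OF g] by simp
  show "integrable M (\<lambda>x. (norm (f x + g x))\<^sup>2)"
  proof (rule Bochner_Integration.integrable_bound)
    show "integrable M (\<lambda>x. 2 * (norm (f x))\<^sup>2 + 2 * (norm (g x))\<^sup>2)"
      using L2_spaceD[OF f] L2_spaceD[OF g] by simp
    show "(\<lambda>x. (norm (f x + g x))\<^sup>2) \<in> borel_measurable M"
      using L2_spaceD(1)[OF f] L2_spaceD(1)[OF g] by simp
    have "(norm (f x + g x))\<^sup>2 \<le> 2 * (norm (f x))\<^sup>2 + 2 * (norm (g x))\<^sup>2" for x
    proof -
      have "(norm (f x + g x))\<^sup>2 \<le> (norm (f x) + norm (g x))\<^sup>2"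
        by (simp add: norm_triangle_ineq power_mono)
      also have "\<dots> \<le> 2 * (norm (f x))\<^sup>2 + 2 * (norm (g x))\<^sup>2"
        using sum_squares_bound[of "norm (f x)" "norm (g x)"] by (simp add: power2_sum)
      finally show ?thesis .
    qed
    then show "AE x in M. norm ((norm (f x + g x))\<^sup>2)
        \<le> norm (2 * (norm (f x))\<^sup>2 + 2 * (norm (g x))\<^sup>2)"
      by simp
  qed
qed

lemma L2_space_scale:
  assumes f: "f \<in> L2_space M"
  shows "(\<lambda>x. c * f x) \<in> L2_space M"
  using L2_spaceD[OF f] by (auto simp: L2_space_def norm_mult power_mult_distrib)

lemma L2_space_diff:
  assumes f: "f \<in> L2_space M" and g: "g \<in> L2_space M"
  shows "(\<lambda>x. f x - g x) \<in> L2_space M"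
  using L2_space_add[OF f L2_space_scale[OF g, of "-1"]] by simp

lemma L2_space_sum:
  assumes "\<And>i. i \<in> X \<Longrightarrow> e i \<in> L2_space M"
  shows "(\<lambda>x. \<Sum>i\<in>X. e i x) \<in> L2_space M"
  using assms by (induction X rule: infinite_finite_induct) (auto intro: L2_space_add)

lemma L2_space_lincomb:
  assumes "\<And>i. i \<in> X \<Longrightarrow> e i \<in> L2_space M"
  shows "(\<lambda>x. \<Sum>i\<in>X. c i * e i x) \<in> L2_space M"
  using assms by (intro L2_space_sum L2_space_scale)

lemma L2_inner_commute:
  "L2_inner M g f = cnj (L2_inner M f g)"
proof -
  have "cnj (L2_inner M f g) = (LINT x|M. cnj (f x * cnj (g x)))"
    unfolding L2_inner_def by (rule Bochner_Integration.integral_cnj[symmetric])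
  then show ?thesis
    unfolding L2_inner_def by (simp only: complex_cnj_mult complex_cnj_cnj mult.commute)
qed

lemma L2_inner_add_left:
  assumes "f \<in> L2_space M" "g \<in> L2_space M" "u \<in> L2_space M"
  shows "L2_inner M (\<lambda>x. f x + g x) u = L2_inner M f u + L2_inner M g u"
  unfolding L2_inner_def
  using L2_inner_integrable[OF assms(1,3)] L2_inner_integrable[OF assms(2,3)]
  by (simp add: distrib_right)

lemma L2_inner_diff_left:
  assumes "f \<in> L2_space M" "g \<in> L2_space M" "u \<in> L2_space M"
  shows "L2_inner M (\<lambda>x. f x - g x) u = L2_inner M f u - L2_inner M g u"
  unfolding L2_inner_def
  using L2_inner_integrable[OF assms(1,3)] L2_inner_integrable[OF assms(2,3)]
  by (simp add: left_diff_distrib)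

lemma L2_inner_scale_left: "L2_inner M (\<lambda>x. c * f x) u = c * L2_inner M f u"
  unfolding L2_inner_def by (simp add: mult.assoc)

lemma L2_inner_scale_right: "L2_inner M f (\<lambda>x. c * u x) = cnj c * L2_inner M f u"
  by (metis L2_inner_commute L2_inner_scale_left complex_cnj_mult)

lemma L2_inner_zero_left [simp]: "L2_inner M (\<lambda>x. 0) u = 0"
  unfolding L2_inner_def by simp

lemma L2_inner_lincomb_left:
  assumes "\<And>i. i \<in> X \<Longrightarrow> e i \<in> L2_space M" "u \<in> L2_space M"
  shows "L2_inner M (\<lambda>x. \<Sum>i\<in>X. c i * e i x) u = (\<Sum>i\<in>X. c i * L2_inner M (e i) u)"
  using assms(1)
proof (induction X rule: infinite_finite_induct)
  case (insert i X)
  then show ?case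
    using assms(2)
    by (simp add: L2_inner_add_left L2_inner_scale_left L2_space_scale L2_space_lincomb)
qed simp_all

lemma L2_inner_lincomb_right:
  assumes "\<And>i. i \<in> X \<Longrightarrow> e i \<in> L2_space M" "u \<in> L2_space M"
  shows "L2_inner M u (\<lambda>x. \<Sum>i\<in>X. c i * e i x) = (\<Sum>i\<in>X. cnj (c i) * L2_inner M u (e i))"
  by (subst L2_inner_commute) (simp add: L2_inner_lincomb_left[OF assms] flip: L2_inner_commute)

lemma L2_norm_nonneg [simp]: "0 \<le> L2_norm M f"
  by (simp add: L2_norm_def)

lemma L2_norm_zero [simp]: "L2_norm M (\<lambda>x. 0) = 0"
  by (simp add: L2_norm_def)

lemma L2_norm_power2: "complex_of_real ((L2_norm M f)\<^sup>2) = L2_inner M f f"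
proof -
  have "L2_inner M f f = (LINT x|M. complex_of_real ((norm (f x))\<^sup>2))"
    unfolding L2_inner_def by (simp add: complex_norm_square del: of_real_power)
  also have "\<dots> = complex_of_real (LINT x|M. (norm (f x))\<^sup>2)"
    by (rule integral_complex_of_real)
  finally show ?thesis
    by (simp add: L2_norm_def)
qed

lemma L2_norm_power2_Re: "(L2_norm M f)\<^sup>2 = Re (L2_inner M f f)"
  by (metis L2_norm_power2 Re_complex_of_real)

lemma L2_norm_scale: "L2_norm M (\<lambda>x. c * f x) = norm c * L2_norm M f"
  unfolding L2_norm_def by (simp add: norm_mult power_mult_distrib real_sqrt_mult)

lemma L2_norm_minus_commute: "L2_norm M (\<lambda>x. f x - g x) = L2_norm M (\<lambda>x. g x - f x)"
  unfolding L2_norm_def by (simp add: norm_minus_commute)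

lemma L2_norm_diff_power2:
  assumes f: "f \<in> L2_space M" and g: "g \<in> L2_space M"
  shows "(L2_norm M (\<lambda>x. f x - g x))\<^sup>2
    = (L2_norm M f)\<^sup>2 - 2 * Re (L2_inner M f g) + (L2_norm M g)\<^sup>2"
proof -
  have "L2_inner M (\<lambda>x. f x - g x) (\<lambda>x. f x - g x)
      = L2_inner M f (\<lambda>x. f x - g x) - L2_inner M g (\<lambda>x. f x - g x)"
    using f g by (simp add: L2_inner_diff_left L2_space_diff)
  also have "L2_inner M f (\<lambda>x. f x - g x) = cnj (L2_inner M f f - L2_inner M g f)"
    using f g by (subst L2_inner_commute) (simp add: L2_inner_diff_left)
  also have "L2_inner M g (\<lambda>x. f x - g x) = cnj (L2_inner M f g - L2_inner M g g)"
    using f g by (subst L2_inner_commute) (simp add: L2_inner_diff_left)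
  finally show ?thesis
    by (simp add: L2_norm_power2_Re L2_inner_commute[of M g f])
qed

lemma L2_Cauchy_Schwarz:
  assumes f: "f \<in> L2_space M" and g: "g \<in> L2_space M"
  shows "norm (L2_inner M f g) \<le> L2_norm M f * L2_norm M g"
proof -
  define z where "z = L2_inner M f g"
  \<comment> \<open>The multiplier \<open>t * z\<close> with \<open>z\<close> the inner product
    itself makes the cross term real, so that a real quadratic in \<open>t\<close> remains.\<close>
  have key: "0 \<le> (L2_norm M f)\<^sup>2 - 2 * t * (norm z)\<^sup>2 + t\<^sup>2 * (norm z)\<^sup>2 * (L2_norm M g)\<^sup>2" for t :: real
  proof -
    have "0 \<le> (L2_norm M (\<lambda>x. f x - (of_real t * z) * g x))\<^sup>2"
      by simp
    also have "\<dots> = (L2_norm M f)\<^sup>2 - 2 * Re (L2_inner M f (\<lambda>x. (of_real t * z) * g x))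
        + (L2_norm M (\<lambda>x. (of_real t * z) * g x))\<^sup>2"
      by (rule L2_norm_diff_power2[OF f L2_space_scale[OF g]])
    also have "L2_inner M f (\<lambda>x. (of_real t * z) * g x) = of_real (t * (norm z)\<^sup>2)"
      by (simp only: L2_inner_scale_right) (simp add: z_def[symmetric] complex_norm_square mult.commute del: of_real_power)
    also have "(L2_norm M (\<lambda>x. (of_real t * z) * g x))\<^sup>2 = t\<^sup>2 * (norm z)\<^sup>2 * (L2_norm M g)\<^sup>2"
      by (simp only: L2_norm_scale) (simp add: norm_mult power_mult_distrib)
    finally show ?thesis by simp
  qed
  have "(norm z)\<^sup>2 \<le> (L2_norm M f)\<^sup>2 * (L2_norm M g)\<^sup>2"
  proof (cases "L2_norm M g = 0")
    case True
    have "norm z = 0"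
    proof (rule ccontr)
      \<comment> \<open>When the norm of \<open>g\<close> is 0 the bound \<open>key\<close> is
        affine in \<open>t\<close>; the value of \<open>t\<close> used here makes its right-hand
        side equal to -1.\<close>
      assume "norm z \<noteq> 0"
      then have "0 \<le> (L2_norm M f)\<^sup>2 - ((L2_norm M f)\<^sup>2 + 1)"
        using key[of "((L2_norm M f)\<^sup>2 + 1) / (2 * (norm z)\<^sup>2)"] True by simp
      then show False by simp
    qed
    with True show ?thesis by simp
  next
    case False
    \<comment> \<open>The value of \<open>t\<close> inserted is the minimiser of the
      quadratic.\<close>
    have "2 * (1 / (L2_norm M g)\<^sup>2) * (norm z)\<^sup>2 - (1 / (L2_norm M g)\<^sup>2)\<^sup>2 * (norm z)\<^sup>2 * (L2_norm M g)\<^sup>2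
        = (norm z)\<^sup>2 / (L2_norm M g)\<^sup>2"
      using False by (simp add: field_simps power2_eq_square)
    then have "(norm z)\<^sup>2 / (L2_norm M g)\<^sup>2 \<le> (L2_norm M f)\<^sup>2"
      using key[of "1 / (L2_norm M g)\<^sup>2"] by linarith
    then show ?thesis
      using False by (simp add: divide_le_eq)
  qed
  then show ?thesis
    unfolding z_def power_mult_distrib[symmetric]
    by (rule power2_le_imp_le) simp
qed

lemma L2_norm_triangle:
  assumes f: "f \<in> L2_space M" and g: "g \<in> L2_space M"
  shows "L2_norm M (\<lambda>x. f x + g x) \<le> L2_norm M f + L2_norm M g"
proof (rule power2_le_imp_le)
  \<comment> \<open>The sum is read as a difference with \<open>(-1) * g\<close>, so that the
    expansion already proved for differences applies.\<close>
  have "(L2_norm M (\<lambda>x. f x - (-1) * g x))\<^sup>2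
      = (L2_norm M f)\<^sup>2 - 2 * Re (L2_inner M f (\<lambda>x. (-1) * g x)) + (L2_norm M (\<lambda>x. (-1) * g x))\<^sup>2"
    by (rule L2_norm_diff_power2[OF f L2_space_scale[OF g]])
  then have "(L2_norm M (\<lambda>x. f x + g x))\<^sup>2
      = (L2_norm M f)\<^sup>2 + 2 * Re (L2_inner M f g) + (L2_norm M g)\<^sup>2"
    by (simp only: L2_inner_scale_right L2_norm_scale) simp
  also have "\<dots> \<le> (L2_norm M f + L2_norm M g)\<^sup>2"
    using L2_Cauchy_Schwarz[OF f g] complex_Re_le_cmod[of "L2_inner M f g"]
    by (simp add: power2_sum)
  finally show "(L2_norm M (\<lambda>x. f x + g x))\<^sup>2 \<le> (L2_norm M f + L2_norm M g)\<^sup>2" .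
qed simp

lemma L2_norm_diff_triangle:
  assumes "f \<in> L2_space M" "g \<in> L2_space M" "u \<in> L2_space M"
  shows "L2_norm M (\<lambda>x. f x - u x) \<le> L2_norm M (\<lambda>x. f x - g x) + L2_norm M (\<lambda>x. g x - u x)"
  using L2_norm_triangle[OF L2_space_diff[OF assms(1,2)] L2_space_diff[OF assms(2,3)]] by simp

text \<open>Cauchy-Schwarz bounds the error of a partial sum by its L2 distance to \<open>F\<close>
  times the norm of \<open>G\<close>. This is the passage from series of functions to numerical
  series; coefficients, Parseval identities and the orthonormality of the packets all go through
  it.\<close>

lemma L2_has_sum_inner:
  assumes F: "L2_has_sum M e I F" and G: "G \<in> L2_space M"
  shows "((\<lambda>i. L2_inner M (e i) G) has_sum L2_inner M F G) I"
proof -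
  have F2: "F \<in> L2_space M" and e: "\<And>i. i \<in> I \<Longrightarrow> e i \<in> L2_space M"
    and lim: "((\<lambda>X. L2_norm M (\<lambda>x. F x - (\<Sum>i\<in>X. e i x))) \<longlongrightarrow> 0) (finite_subsets_at_top I)"
    using F by (auto simp: L2_has_sum_def)
  have "((\<lambda>X. L2_norm M (\<lambda>x. F x - (\<Sum>i\<in>X. e i x)) * L2_norm M G) \<longlongrightarrow> 0)
      (finite_subsets_at_top I)"
    using tendsto_mult_right[OF lim, of "L2_norm M G"] by simp
  then have "((\<lambda>X. (\<Sum>i\<in>X. L2_inner M (e i) G) - L2_inner M F G) \<longlongrightarrow> 0) (finite_subsets_at_top I)"
  proof (rule Lim_null_comparison[rotated])
    show "\<forall>\<^sub>F X in finite_subsets_at_top I. norm ((\<Sum>i\<in>X. L2_inner M (e i) G) - L2_inner M F G)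
        \<le> L2_norm M (\<lambda>x. F x - (\<Sum>i\<in>X. e i x)) * L2_norm M G"
      unfolding eventually_finite_subsets_at_top
    proof (intro exI[of _ "{}"] conjI allI impI)
      fix X assume "finite X \<and> {} \<subseteq> X \<and> X \<subseteq> I"
      then have eX: "\<And>i. i \<in> X \<Longrightarrow> e i \<in> L2_space M"
        using e by auto
      have "L2_inner M F G - (\<Sum>i\<in>X. L2_inner M (e i) G)
          = L2_inner M (\<lambda>x. F x - (\<Sum>i\<in>X. e i x)) G"
        using L2_inner_lincomb_left[of X e M G "\<lambda>_. 1"] eX G
        by (simp add: L2_inner_diff_left F2 L2_space_sum)
      then show "norm ((\<Sum>i\<in>X. L2_inner M (e i) G) - L2_inner M F G)
          \<le> L2_norm M (\<lambda>x. F x - (\<Sum>i\<in>X. e i x)) * L2_norm M G"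
        using L2_Cauchy_Schwarz[OF L2_space_diff[OF F2 L2_space_sum[OF eX]] G]
        by (simp add: norm_minus_commute)
    qed auto
  qed
  then show ?thesis
    unfolding has_sum_def using LIM_zero_iff by blast
qed

section \<open>Closed linear spans and orthonormal families\<close>

text \<open>The closed linear span. The approximation clause copies the completeness clause of
  \<open>orthonormal_basis\<close>, so that completeness becomes an inclusion of sets; being defined
  through the seminorm, the set is saturated under equality almost everywhere.\<close>

definition L2_span :: "'a measure \<Rightarrow> ('i \<Rightarrow> 'a \<Rightarrow> complex) \<Rightarrow> 'i set \<Rightarrow> ('a \<Rightarrow> complex) set" where
  "L2_span M e I = {F \<in> L2_space M. \<forall>\<epsilon>>0. \<exists>X c. finite X \<and> X \<subseteq> I \<and>
     L2_norm M (\<lambda>x. F x - (\<Sum>i\<in>X. c i * e i x)) < \<epsilon>}"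

lemma L2_spanD: "F \<in> L2_span M e I \<Longrightarrow> F \<in> L2_space M"
  by (simp add: L2_span_def)

lemma L2_spanE:
  assumes "F \<in> L2_span M e I" "0 < \<epsilon>"
  obtains X c where "finite X" "X \<subseteq> I" "L2_norm M (\<lambda>x. F x - (\<Sum>i\<in>X. c i * e i x)) < \<epsilon>"
  using assms unfolding L2_span_def by blast

lemma L2_spanI:
  assumes "F \<in> L2_space M"
    and "\<And>\<epsilon>. 0 < \<epsilon> \<Longrightarrow> \<exists>X c. finite X \<and> X \<subseteq> I \<and> L2_norm M (\<lambda>x. F x - (\<Sum>i\<in>X. c i * e i x)) < \<epsilon>"
  shows "F \<in> L2_span M e I"
  using assms by (simp add: L2_span_def)

lemma L2_span_mono: "I \<subseteq> J \<Longrightarrow> L2_span M e I \<subseteq> L2_span M e J"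
  by (fastforce simp: L2_span_def)

lemma L2_span_base:
  assumes "i \<in> I" "e i \<in> L2_space M"
  shows "e i \<in> L2_span M e I"
proof (rule L2_spanI[OF assms(2)])
  fix \<epsilon> :: real assume "0 < \<epsilon>"
  with assms(1) show "\<exists>X c. finite X \<and> X \<subseteq> I \<and> L2_norm M (\<lambda>x. e i x - (\<Sum>i\<in>X. c i * e i x)) < \<epsilon>"
    by (intro exI[of _ "{i}"] exI[of _ "\<lambda>_. 1"]) simp
qed

lemma L2_span_zero: "(\<lambda>x. 0) \<in> L2_span M e I"
  by (rule L2_spanI) (auto intro!: exI[of _ "{}"])

lemma L2_span_add:
  assumes e: "\<And>i. i \<in> I \<Longrightarrow> e i \<in> L2_space M"
    and F: "F \<in> L2_span M e I" and G: "G \<in> L2_span M e I"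
  shows "(\<lambda>x. F x + G x) \<in> L2_span M e I"
proof (rule L2_spanI)
  show "(\<lambda>x. F x + G x) \<in> L2_space M"
    using F G by (intro L2_space_add L2_spanD)
  fix \<epsilon> :: real assume "0 < \<epsilon>"
  then have "0 < \<epsilon> / 2" by simp
  obtain X c where X: "finite X" "X \<subseteq> I" "L2_norm M (\<lambda>x. F x - (\<Sum>i\<in>X. c i * e i x)) < \<epsilon> / 2"
    by (rule L2_spanE[OF F \<open>0 < \<epsilon> / 2\<close>])
  obtain Y d where Y: "finite Y" "Y \<subseteq> I" "L2_norm M (\<lambda>x. G x - (\<Sum>i\<in>Y. d i * e i x)) < \<epsilon> / 2"
    by (rule L2_spanE[OF G \<open>0 < \<epsilon> / 2\<close>])
  \<comment> \<open>\<open>X\<close> and \<open>Y\<close> may overlap, so the coefficients are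
    extended by 0 and added on the union.\<close>
  define b where "b i = (if i \<in> X then c i else 0) + (if i \<in> Y then d i else 0)" for i
  have "(\<Sum>i\<in>X \<union> Y. b i * e i x) = (\<Sum>i\<in>X. c i * e i x) + (\<Sum>i\<in>Y. d i * e i x)" for x
  proof -
    have "(\<Sum>i\<in>X \<union> Y. b i * e i x) = (\<Sum>i\<in>X \<union> Y. if i \<in> X then c i * e i x else 0)
        + (\<Sum>i\<in>X \<union> Y. if i \<in> Y then d i * e i x else 0)"
      unfolding sum.distrib[symmetric] b_def by (rule sum.cong) (auto simp: distrib_right)
    also have "(\<Sum>i\<in>X \<union> Y. if i \<in> X then c i * e i x else 0) = (\<Sum>i\<in>X. c i * e i x)"
      using X(1) Y(1) by (intro sum.mono_neutral_cong_right) auto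
    also have "(\<Sum>i\<in>X \<union> Y. if i \<in> Y then d i * e i x else 0) = (\<Sum>i\<in>Y. d i * e i x)"
      using X(1) Y(1) by (intro sum.mono_neutral_cong_right) auto
    finally show ?thesis .
  qed
  then have "L2_norm M (\<lambda>x. F x + G x - (\<Sum>i\<in>X \<union> Y. b i * e i x))
      = L2_norm M (\<lambda>x. (F x - (\<Sum>i\<in>X. c i * e i x)) + (G x - (\<Sum>i\<in>Y. d i * e i x)))"
    by (simp add: algebra_simps)
  also have "\<dots> \<le> L2_norm M (\<lambda>x. F x - (\<Sum>i\<in>X. c i * e i x)) + L2_norm M (\<lambda>x. G x - (\<Sum>i\<in>Y. d i * e i x))"
    using X(2) Y(2) e
    by (intro L2_norm_triangle L2_space_diff L2_spanD[OF F] L2_spanD[OF G] L2_space_lincomb) auto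
  also have "\<dots> < \<epsilon>"
    using X(3) Y(3) by simp
  finally show "\<exists>Z b. finite Z \<and> Z \<subseteq> I \<and> L2_norm M (\<lambda>x. F x + G x - (\<Sum>i\<in>Z. b i * e i x)) < \<epsilon>"
    using X(1,2) Y(1,2) by (intro exI[of _ "X \<union> Y"] exI[of _ b]) auto
qed

lemma L2_span_scale:
  assumes F: "F \<in> L2_span M e I"
  shows "(\<lambda>x. c * F x) \<in> L2_span M e I"
proof (cases "c = 0")
  case True
  then show ?thesis by (simp add: L2_span_zero)
next
  case False
  show ?thesis
  proof (rule L2_spanI)
    show "(\<lambda>x. c * F x) \<in> L2_space M"
      using F by (intro L2_space_scale L2_spanD)
    fix \<epsilon> :: real assume "0 < \<epsilon>"
    with False have pos: "0 < \<epsilon> / norm c" by simp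
    obtain X d where X: "finite X" "X \<subseteq> I" "L2_norm M (\<lambda>x. F x - (\<Sum>i\<in>X. d i * e i x)) < \<epsilon> / norm c"
      by (rule L2_spanE[OF F pos])
    have "L2_norm M (\<lambda>x. c * F x - (\<Sum>i\<in>X. (c * d i) * e i x))
        = norm c * L2_norm M (\<lambda>x. F x - (\<Sum>i\<in>X. d i * e i x))"
      unfolding L2_norm_scale[symmetric]
      by (simp add: right_diff_distrib sum_distrib_left mult.assoc)
    also have "\<dots> < \<epsilon>"
      using X(3) False by (simp add: field_simps)
    finally show "\<exists>X d. finite X \<and> X \<subseteq> I \<and> L2_norm M (\<lambda>x. c * F x - (\<Sum>i\<in>X. d i * e i x)) < \<epsilon>"
      using X(1,2) by (intro exI[of _ X] exI[of _ "\<lambda>i. c * d i"]) simp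
  qed
qed

lemma L2_span_lincomb:
  assumes e: "\<And>i. i \<in> I \<Longrightarrow> e i \<in> L2_space M"
    and u: "\<And>i. i \<in> X \<Longrightarrow> u i \<in> L2_span M e I"
  shows "(\<lambda>x. \<Sum>i\<in>X. c i * u i x) \<in> L2_span M e I"
  using u
  by (induction X rule: infinite_finite_induct)
     (simp_all add: L2_span_zero L2_span_add[OF e] L2_span_scale)

lemma L2_span_closed:
  assumes e: "\<And>i. i \<in> I \<Longrightarrow> e i \<in> L2_space M" and F: "F \<in> L2_space M"
    and appr: "\<And>\<epsilon>. 0 < \<epsilon> \<Longrightarrow> \<exists>G\<in>L2_span M e I. L2_norm M (\<lambda>x. F x - G x) < \<epsilon>"
  shows "F \<in> L2_span M e I"
proof (rule L2_spanI[OF F])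
  fix \<epsilon> :: real assume "0 < \<epsilon>"
  then have "0 < \<epsilon> / 2" by simp
  obtain G where G: "G \<in> L2_span M e I" "L2_norm M (\<lambda>x. F x - G x) < \<epsilon> / 2"
    using appr[OF \<open>0 < \<epsilon> / 2\<close>] by blast
  obtain X c where X: "finite X" "X \<subseteq> I" "L2_norm M (\<lambda>x. G x - (\<Sum>i\<in>X. c i * e i x)) < \<epsilon> / 2"
    by (rule L2_spanE[OF G(1) \<open>0 < \<epsilon> / 2\<close>])
  have "L2_norm M (\<lambda>x. F x - (\<Sum>i\<in>X. c i * e i x))
      \<le> L2_norm M (\<lambda>x. F x - G x) + L2_norm M (\<lambda>x. G x - (\<Sum>i\<in>X. c i * e i x))"
    using X(2) e by (intro L2_norm_diff_triangle F L2_spanD[OF G(1)] L2_space_lincomb) auto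
  also have "\<dots> < \<epsilon>"
    using G(2) X(3) by simp
  finally show "\<exists>X c. finite X \<and> X \<subseteq> I \<and> L2_norm M (\<lambda>x. F x - (\<Sum>i\<in>X. c i * e i x)) < \<epsilon>"
    using X(1,2) by (intro exI[of _ X] exI[of _ c]) simp
qed

lemma L2_span_subset:
  assumes b: "\<And>j. j \<in> J \<Longrightarrow> b j \<in> L2_space M"
    and e: "\<And>i. i \<in> I \<Longrightarrow> e i \<in> L2_span M b J"
  shows "L2_span M e I \<subseteq> L2_span M b J"
proof
  fix F assume F: "F \<in> L2_span M e I"
  show "F \<in> L2_span M b J"
  proof (rule L2_span_closed[OF b L2_spanD[OF F]])
    fix \<epsilon> :: real assume pos: "0 < \<epsilon>"
    obtain X c where X: "finite X" "X \<subseteq> I" "L2_norm M (\<lambda>x. F x - (\<Sum>i\<in>X. c i * e i x)) < \<epsilon>"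
      by (rule L2_spanE[OF F pos])
    have "(\<lambda>x. \<Sum>i\<in>X. c i * e i x) \<in> L2_span M b J"
      using X(2) e by (intro L2_span_lincomb[OF b]) auto
    with X(3) show "\<exists>G\<in>L2_span M b J. L2_norm M (\<lambda>x. F x - G x) < \<epsilon>"
      by (rule bexI)
  qed
qed

lemma L2_span_orthogonal:
  assumes e: "\<And>i. i \<in> I \<Longrightarrow> e i \<in> L2_space M" and u: "u \<in> L2_space M"
    and orth: "\<And>i. i \<in> I \<Longrightarrow> L2_inner M (e i) u = 0" and F: "F \<in> L2_span M e I"
  shows "L2_inner M F u = 0"
proof (rule ccontr)
  assume ne: "L2_inner M F u \<noteq> 0"
  \<comment> \<open>The \<open>+ 1\<close> keeps the quotient meaningful when \<open>u\<close> has
    norm 0 and makes the final estimate strict.\<close>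
  define \<epsilon> where "\<epsilon> = norm (L2_inner M F u) / (L2_norm M u + 1)"
  have pos: "0 < L2_norm M u + 1"
    by (simp add: add_nonneg_pos)
  then have "0 < \<epsilon>"
    using ne by (simp add: \<epsilon>_def)
  then obtain X c where X: "finite X" "X \<subseteq> I" "L2_norm M (\<lambda>x. F x - (\<Sum>i\<in>X. c i * e i x)) < \<epsilon>"
    by (rule L2_spanE[OF F])
  have eX: "\<And>i. i \<in> X \<Longrightarrow> e i \<in> L2_space M"
    using X(2) e by auto
  have "(\<Sum>i\<in>X. c i * L2_inner M (e i) u) = 0"
    using X(2) orth by (intro sum.neutral) auto
  then have "L2_inner M F u = L2_inner M (\<lambda>x. F x - (\<Sum>i\<in>X. c i * e i x)) u"
    using eX by (simp add: L2_inner_diff_left L2_spanD[OF F] L2_space_lincomb u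
        L2_inner_lincomb_left)
  then have "norm (L2_inner M F u) \<le> L2_norm M (\<lambda>x. F x - (\<Sum>i\<in>X. c i * e i x)) * L2_norm M u"
    using L2_Cauchy_Schwarz[OF L2_space_diff[OF L2_spanD[OF F] L2_space_lincomb[OF eX]] u]
    by simp
  also have "\<dots> \<le> \<epsilon> * L2_norm M u"
    using X(3) by (intro mult_right_mono) auto
  also have "\<dots> < \<epsilon> * (L2_norm M u + 1)"
    using \<open>0 < \<epsilon>\<close> by simp
  also have "\<dots> = norm (L2_inner M F u)"
    using pos by (simp add: \<epsilon>_def)
  finally show False by simp
qed

lemma L2_span_orthogonal_span:
  assumes e: "\<And>i. i \<in> I \<Longrightarrow> e i \<in> L2_space M" and b: "\<And>j. j \<in> J \<Longrightarrow> b j \<in> L2_space M"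
    and orth: "\<And>i j. i \<in> I \<Longrightarrow> j \<in> J \<Longrightarrow> L2_inner M (e i) (b j) = 0"
    and F: "F \<in> L2_span M e I" and G: "G \<in> L2_span M b J"
  shows "L2_inner M F G = 0"
proof -
  have "L2_inner M (b j) F = 0" if "j \<in> J" for j
  proof -
    have "L2_inner M F (b j) = 0"
      using that by (intro L2_span_orthogonal[OF e _ _ F] b orth)
    then show ?thesis
      by (simp add: L2_inner_commute[of M "b j" F])
  qed
  then have "L2_inner M G F = 0"
    by (intro L2_span_orthogonal[OF b L2_spanD[OF F] _ G])
  then show ?thesis
    by (simp add: L2_inner_commute[of M F G])
qed

lemma L2_has_sum_in_span:
  assumes F: "L2_has_sum M (\<lambda>i x. c i * e i x) I F"
  shows "F \<in> L2_span M e I"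
proof (rule L2_spanI)
  show "F \<in> L2_space M"
    using F by (simp add: L2_has_sum_def)
  fix \<epsilon> :: real assume "0 < \<epsilon>"
  with F have "\<forall>\<^sub>F X in finite_subsets_at_top I. L2_norm M (\<lambda>x. F x - (\<Sum>i\<in>X. c i * e i x)) < \<epsilon>"
    by (auto simp: L2_has_sum_def intro: order_tendstoD)
  then obtain X where "finite X" "X \<subseteq> I" "L2_norm M (\<lambda>x. F x - (\<Sum>i\<in>X. c i * e i x)) < \<epsilon>"
    unfolding eventually_finite_subsets_at_top by blast
  then show "\<exists>X c. finite X \<and> X \<subseteq> I \<and> L2_norm M (\<lambda>x. F x - (\<Sum>i\<in>X. c i * e i x)) < \<epsilon>"
    by (intro exI[of _ X] exI[of _ c]) simp
qed

section \<open>Orthonormal families, Bessel's inequality and its case of equality\<close>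

definition orthonormal_family :: "'a measure \<Rightarrow> ('i \<Rightarrow> 'a \<Rightarrow> complex) \<Rightarrow> 'i set \<Rightarrow> bool" where
  "orthonormal_family M e I \<longleftrightarrow> (\<forall>i\<in>I. e i \<in> L2_space M) \<and>
     (\<forall>i\<in>I. \<forall>i'\<in>I. L2_inner M (e i) (e i') = (if i = i' then 1 else 0))"

lemma orthonormal_family_L2: "orthonormal_family M e I \<Longrightarrow> i \<in> I \<Longrightarrow> e i \<in> L2_space M"
  by (simp add: orthonormal_family_def)

lemma orthonormal_family_inner:
  "orthonormal_family M e I \<Longrightarrow> i \<in> I \<Longrightarrow> i' \<in> I \<Longrightarrow> L2_inner M (e i) (e i') = (if i = i' then 1 else 0)"
  by (simp add: orthonormal_family_def)

lemma orthonormal_family_norm: "orthonormal_family M e I \<Longrightarrow> i \<in> I \<Longrightarrow> (L2_norm M (e i))\<^sup>2 = 1"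
  by (simp add: L2_norm_power2_Re orthonormal_family_inner)

text \<open>Pythagoras for the projection \<open>P\<close> onto finitely many vectors: the inner
  product of \<open>F\<close> with \<open>P\<close> and that of \<open>P\<close> with itself are the
  same sum of squares. Bessel's inequality and the case of equality are both read off from this
  identity.\<close>

lemma L2_norm_residual_power2:
  assumes on: "orthonormal_family M e I" and X: "finite X" "X \<subseteq> I" and F: "F \<in> L2_space M"
  shows "(L2_norm M (\<lambda>x. F x - (\<Sum>i\<in>X. L2_inner M F (e i) * e i x)))\<^sup>2
    = (L2_norm M F)\<^sup>2 - (\<Sum>i\<in>X. (norm (L2_inner M F (e i)))\<^sup>2)"
proof -
  have e: "\<And>i. i \<in> X \<Longrightarrow> e i \<in> L2_space M"
    using on X(2) by (auto simp: orthonormal_family_def)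
  define P where "P = (\<lambda>x. \<Sum>i\<in>X. L2_inner M F (e i) * e i x)"
  have P: "P \<in> L2_space M"
    unfolding P_def by (rule L2_space_lincomb[OF e])
  have sq: "(\<Sum>i\<in>X. cnj (L2_inner M F (e i)) * L2_inner M F (e i))
      = of_real (\<Sum>i\<in>X. (norm (L2_inner M F (e i)))\<^sup>2)"
    by (simp add: complex_norm_square mult.commute del: of_real_power)
  have FP: "L2_inner M F P = of_real (\<Sum>i\<in>X. (norm (L2_inner M F (e i)))\<^sup>2)"
    unfolding P_def sq[symmetric] by (rule L2_inner_lincomb_right[OF e F])
  have eP: "L2_inner M (e i) P = cnj (L2_inner M F (e i))" if "i \<in> X" for i
  proof -
    have "L2_inner M (e i) P = (\<Sum>i'\<in>X. cnj (L2_inner M F (e i')) * L2_inner M (e i) (e i'))"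
      unfolding P_def by (rule L2_inner_lincomb_right[OF e e[OF that]])
    also have "\<dots> = (\<Sum>i'\<in>X. if i' = i then cnj (L2_inner M F (e i)) else 0)"
      using on X(2) that by (intro sum.cong) (auto simp: orthonormal_family_def subset_iff)
    finally show ?thesis
      using that X(1) by simp
  qed
  have "L2_inner M P P = (\<Sum>i\<in>X. L2_inner M F (e i) * L2_inner M (e i) P)"
    by (subst (1) P_def, rule L2_inner_lincomb_left[OF e P])
  also have "\<dots> = (\<Sum>i\<in>X. cnj (L2_inner M F (e i)) * L2_inner M F (e i))"
    by (rule sum.cong) (simp_all add: eP mult.commute)
  finally have PP: "(L2_norm M P)\<^sup>2 = (\<Sum>i\<in>X. (norm (L2_inner M F (e i)))\<^sup>2)"
    unfolding sq L2_norm_power2_Re by simp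
  have "(L2_norm M (\<lambda>x. F x - P x))\<^sup>2 = (L2_norm M F)\<^sup>2 - (\<Sum>i\<in>X. (norm (L2_inner M F (e i)))\<^sup>2)"
    by (simp add: L2_norm_diff_power2[OF F P] FP PP)
  then show ?thesis
    by (simp add: P_def)
qed

lemma Bessel_finite:
  assumes "orthonormal_family M e I" "finite X" "X \<subseteq> I" "F \<in> L2_space M"
  shows "(\<Sum>i\<in>X. (norm (L2_inner M F (e i)))\<^sup>2) \<le> (L2_norm M F)\<^sup>2"
  using L2_norm_residual_power2[OF assms]
    zero_le_power2[of "L2_norm M (\<lambda>x. F x - (\<Sum>i\<in>X. L2_inner M F (e i) * e i x))"]
  by linarith

lemma Bessel_summable:
  assumes "orthonormal_family M e I" "F \<in> L2_space M"
  shows "(\<lambda>i. (norm (L2_inner M F (e i)))\<^sup>2) summable_on I"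
proof (rule nonneg_bdd_above_summable_on)
  show "bdd_above (sum (\<lambda>i. (norm (L2_inner M F (e i)))\<^sup>2) ` {X. X \<subseteq> I \<and> finite X})"
    using Bessel_finite[OF assms(1) _ _ assms(2)] by (intro bdd_aboveI[of _ "(L2_norm M F)\<^sup>2"]) auto
qed simp

lemma Bessel:
  assumes "orthonormal_family M e I" "F \<in> L2_space M"
  shows "(\<Sum>\<^sub>\<infinity>i\<in>I. (norm (L2_inner M F (e i)))\<^sup>2) \<le> (L2_norm M F)\<^sup>2"
  using Bessel_finite[OF assms(1) _ _ assms(2)] Bessel_summable[OF assms]
  by (intro infsum_le_finite_sums) auto

text \<open>Under equality the squared distance from \<open>F\<close> to its partial expansion is
  the tail of a convergent series. This converts the counting argument into membership in a
  span.\<close>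

lemma Bessel_eq_imp_span:
  assumes on: "orthonormal_family M e I" and F: "F \<in> L2_space M"
    and eq: "(\<Sum>\<^sub>\<infinity>i\<in>I. (norm (L2_inner M F (e i)))\<^sup>2) = (L2_norm M F)\<^sup>2"
  shows "F \<in> L2_span M e I"
proof (rule L2_spanI[OF F])
  fix \<epsilon> :: real assume pos: "0 < \<epsilon>"
  have "((\<lambda>i. (norm (L2_inner M F (e i)))\<^sup>2) has_sum (L2_norm M F)\<^sup>2) I"
    using Bessel_summable[OF on F] eq by (metis has_sum_infsum)
  \<comment> \<open>The approximation comes with a weak inequality; the factor 1/2 makes the
    resulting bound strict.\<close>
  from has_sum_finite_approximation[OF this, of "\<epsilon>\<^sup>2 / 2"] pos
  obtain X where X: "finite X" "X \<subseteq> I"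
    and d: "dist (\<Sum>i\<in>X. (norm (L2_inner M F (e i)))\<^sup>2) ((L2_norm M F)\<^sup>2) \<le> \<epsilon>\<^sup>2 / 2"
    by auto
  have "(L2_norm M (\<lambda>x. F x - (\<Sum>i\<in>X. L2_inner M F (e i) * e i x)))\<^sup>2 \<le> \<epsilon>\<^sup>2 / 2"
    using d unfolding L2_norm_residual_power2[OF on X F] dist_real_def by linarith
  also have "\<dots> < \<epsilon>\<^sup>2"
    using pos by simp
  finally have "L2_norm M (\<lambda>x. F x - (\<Sum>i\<in>X. L2_inner M F (e i) * e i x)) < \<epsilon>"
    using pos by (simp add: power2_less_imp_less)
  with X show "\<exists>X c. finite X \<and> X \<subseteq> I \<and> L2_norm M (\<lambda>x. F x - (\<Sum>i\<in>X. c i * e i x)) < \<epsilon>"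
    by (intro exI[of _ X] exI[of _ "\<lambda>i. L2_inner M F (e i)"]) simp
qed

lemma orthonormal_basis_L2_space_iff:
  "orthonormal_basis M e I (L2_space M) \<longleftrightarrow> orthonormal_family M e I \<and> L2_space M \<subseteq> L2_span M e I"
  unfolding orthonormal_basis_def orthonormal_family_def L2_span_def by blast

lemma closed_L2_subspace_lincomb:
  assumes V: "closed_L2_subspace M V" and e: "\<And>i. i \<in> X \<Longrightarrow> e i \<in> V"
  shows "(\<lambda>x. \<Sum>i\<in>X. c i * e i x) \<in> V"
  using e
proof (induction X rule: infinite_finite_induct)
  case (insert i X)
  then have "(\<lambda>x. c i * e i x) \<in> V" "(\<lambda>x. \<Sum>i\<in>X. c i * e i x) \<in> V"
    using V unfolding closed_L2_subspace_def by auto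
  with V insert.hyps show ?case
    unfolding closed_L2_subspace_def by auto
qed (use V in \<open>simp_all add: closed_L2_subspace_def\<close>)

text \<open>Closedness in \<open>closed_L2_subspace\<close> is sequential, so the approximations of
  arbitrary precision are turned into a sequence with errors
  \<open>1 / real (Suc n)\<close>.\<close>

lemma L2_span_subset_closed_subspace:
  assumes V: "closed_L2_subspace M V" and e: "\<And>i. i \<in> I \<Longrightarrow> e i \<in> V"
  shows "L2_span M e I \<subseteq> V"
proof
  fix F assume F: "F \<in> L2_span M e I"
  have "\<exists>G\<in>V. L2_norm M (\<lambda>x. G x - F x) < 1 / real (Suc n)" for n
  proof -
    have pos: "0 < 1 / real (Suc n)" by simp
    obtain X c where X: "finite X" "X \<subseteq> I"
      "L2_norm M (\<lambda>x. F x - (\<Sum>i\<in>X. c i * e i x)) < 1 / real (Suc n)"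
      by (rule L2_spanE[OF F pos])
    have "(\<lambda>x. \<Sum>i\<in>X. c i * e i x) \<in> V"
      using X(2) e by (intro closed_L2_subspace_lincomb[OF V]) auto
    with X(3) show ?thesis
      by (intro bexI[of _ "\<lambda>x. \<Sum>i\<in>X. c i * e i x"]) (simp_all add: L2_norm_minus_commute[of M F])
  qed
  then obtain G where G: "\<And>n. G n \<in> V" "\<And>n. L2_norm M (\<lambda>x. G n x - F x) < 1 / real (Suc n)"
    by metis
  have "(\<lambda>n. L2_norm M (\<lambda>x. G n x - F x)) \<longlonglongrightarrow> 0"
  proof (rule tendsto_sandwich[of "\<lambda>_. 0"])
    show "(\<lambda>n. 1 / real (Suc n)) \<longlonglongrightarrow> 0"
      using LIMSEQ_inverse_real_of_nat by (simp add: inverse_eq_divide)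
    show "\<forall>\<^sub>F n in sequentially. L2_norm M (\<lambda>x. G n x - F x) \<le> 1 / real (Suc n)"
      using G(2) by (simp add: less_imp_le)
  qed auto
  then show "F \<in> V"
    using V G(1) L2_spanD[OF F] unfolding closed_L2_subspace_def by blast
qed

section \<open>Linear changes of variables\<close>

lemma matrix_inv_cancel:
  fixes A :: "real ^ 'd ^ 'd"
  assumes "det A \<noteq> 0"
  shows "A ** matrix_inv A = mat 1" "matrix_inv A ** A = mat 1"
    "A *v (matrix_inv A *v x) = x" "matrix_inv A *v (A *v x) = x"
proof -
  have "\<exists>A'. A ** A' = mat 1 \<and> A' ** A = mat 1"
    using assms by (simp add: invertible_det_nz[symmetric] invertible_def)
  then have *: "A ** matrix_inv A = mat 1 \<and> matrix_inv A ** A = mat 1"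
    unfolding matrix_inv_def by (rule someI_ex)
  then show "A ** matrix_inv A = mat 1" "matrix_inv A ** A = mat 1" by simp_all
  with * show "A *v (matrix_inv A *v x) = x" "matrix_inv A *v (A *v x) = x"
    by (simp_all add: matrix_vector_mul_assoc)
qed

text \<open>The library has the next lemma for well-ordered index types only.\<close>

lemma measure_matrix_image:
  fixes A :: "real ^ 'd ^ 'd"
  assumes "S \<in> lmeasurable"
  shows "(*v) A ` S \<in> lmeasurable" "measure lebesgue ((*v) A ` S) = \<bar>det A\<bar> * measure lebesgue S"
proof -
  \<comment> \<open>The property is closed under matrix products, hence it is enough to verify it
    for the elementary matrices.\<close>
  define Q where "Q A \<longleftrightarrow> (\<forall>S\<in>lmeasurable. (*v) A ` S \<in> lmeasurable \<and>
    measure lebesgue ((*v) A ` S) = \<bar>det A\<bar> * measure lebesgue S)" for A :: "real ^ 'd ^ 'd"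
  \<comment> \<open>A linear map that scales the measure of boxes correctly does so for all
    measurable sets. This serves the swap and the shear, whose effect on a box is explicit.\<close>
  have suff: "Q A" if "\<And>a b. measure lebesgue ((*v) A ` cbox a b) = \<bar>det A\<bar> * measure lebesgue (cbox a b)"
    for A :: "real ^ 'd ^ 'd"
    unfolding Q_def
  proof
    fix S :: "(real ^ 'd) set" assume S: "S \<in> lmeasurable"
    show "(*v) A ` S \<in> lmeasurable \<and> measure lebesgue ((*v) A ` S) = \<bar>det A\<bar> * measure lebesgue S"
      using measure_linear_sufficient[of "(*v) A" S "\<bar>det A\<bar>", OF matrix_vector_mul_linear S that]
      by simp
  qed
  have "Q A"
  proof (rule induct_matrix_elementary_alt)
    fix A B :: "real ^ 'd ^ 'd" assume AB: "Q A" "Q B"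
    have "(*v) (A ** B) ` S = (*v) A ` ((*v) B ` S)" for S
      by (simp add: image_image matrix_vector_mul_assoc)
    with AB show "Q (A ** B)"
      by (simp add: Q_def det_mul abs_mult)
  next
    fix A :: "real ^ 'd ^ 'd" and i assume row: "row i A = 0"
    have sub: "(*v) A ` S \<subseteq> {x. x $ i = 0}" for S
      using row by (auto simp: matrix_vector_mul_component row_def vec_eq_iff inner_vec_def)
    have "negligible ((*v) A ` S)" for S
      by (rule negligible_subset[OF negligible_standard_hyperplane_cart sub])
    moreover have "det A = 0"
      by (rule det_zero_row[OF row])
    ultimately show "Q A"
      by (simp add: Q_def negligible_iff_measure)
  next
    fix A :: "real ^ 'd ^ 'd" assume diag: "\<And>i j. i \<noteq> j \<Longrightarrow> A $ i $ j = 0"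
    have "(*v) A = (\<lambda>x. \<chi> k. A $ k $ k * x $ k)"
    proof
      fix x :: "real ^ 'd"
      have "(\<Sum>j\<in>UNIV. A $ k $ j * x $ j) = (\<Sum>j\<in>UNIV. if j = k then A $ k $ k * x $ k else 0)" for k
        using diag by (intro sum.cong) auto
      then show "A *v x = (\<chi> k. A $ k $ k * x $ k)"
        by (simp add: matrix_vector_mult_def)
    qed
    then show "Q A"
      using measurable_stretch[of _ "\<lambda>k. A $ k $ k"] measure_stretch[of _ "\<lambda>k. A $ k $ k"]
      by (simp add: Q_def det_diagonal[OF diag])
  next
    fix m n :: 'd assume "m \<noteq> n"
    define A :: "real ^ 'd ^ 'd" where "A = (\<chi> i j. mat 1 $ i $ Transposition.transpose m n j)"
    have Av: "A *v x = (\<chi> i. x $ Transposition.transpose m n i)" for x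
    proof -
      have "(\<Sum>j\<in>UNIV. A $ i $ j * x $ j)
          = (\<Sum>j\<in>UNIV. if j = Transposition.transpose m n i then x $ j else 0)" for i
        by (rule sum.cong) (auto simp: A_def mat_def transpose_involutory)
      then show ?thesis
        by (simp add: matrix_vector_mult_def)
    qed
    have "det A = of_int (sign (Transposition.transpose m n)) * det (mat 1 :: real ^ 'd ^ 'd)"
      unfolding A_def by (rule det_permute_columns) (simp add: permutes_swap_id)
    then have det: "\<bar>det A\<bar> = 1"
      by (simp add: sign_swap_id)
    show "Q (\<chi> i j. mat 1 $ i $ Transposition.transpose m n j)"
      unfolding A_def[symmetric]
    proof (rule suff)
      fix a b :: "real ^ 'd"
      have eq: "(*v) A ` cbox a b = cbox (A *v a) (A *v b)"
      proof (intro set_eqI iffI)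
        fix x assume "x \<in> (*v) A ` cbox a b"
        then show "x \<in> cbox (A *v a) (A *v b)"
          by (auto simp: Av mem_box_cart)
      next
        fix x assume x: "x \<in> cbox (A *v a) (A *v b)"
        have "a $ i \<le> (A *v x) $ i \<and> (A *v x) $ i \<le> b $ i" for i
          using x[unfolded mem_box_cart, rule_format, of "Transposition.transpose m n i"]
          by (simp add: Av)
        then show "x \<in> (*v) A ` cbox a b"
          by (intro image_eqI[of _ _ "A *v x"]) (simp_all add: mem_box_cart Av vec_eq_iff)
      qed
      show "measure lebesgue ((*v) A ` cbox a b) = \<bar>det A\<bar> * measure lebesgue (cbox a b)"
      proof (cases "cbox a b = {}")
        case False
        then have "cbox (A *v a) (A *v b) \<noteq> {}"
          using eq by auto
        moreover have "(\<Prod>i\<in>UNIV. b $ i - a $ i)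
            = (\<Prod>i\<in>UNIV. b $ Transposition.transpose m n i - a $ Transposition.transpose m n i)"
          using prod.permute[OF permutes_swap_id[of m UNIV n], of "\<lambda>i. b $ i - a $ i"] by simp
        ultimately show ?thesis
          using False by (simp add: eq det content_cbox_cart) (simp add: Av)
      qed (simp add: eq)
    qed
  next
    fix m n :: 'd assume mn: "m \<noteq> n"
    define A :: "real ^ 'd ^ 'd" where "A = (\<chi> i j. of_bool (i = m \<and> j = n \<or> i = j))"
    have Av: "A *v x = (\<chi> i. if i = m then x $ m + x $ n else x $ i)" for x
    proof -
      have "(\<Sum>j\<in>UNIV. A $ i $ j * x $ j)
          = (\<Sum>j\<in>UNIV. (if j = i then x $ i else 0) + (if j = n then if i = m then x $ n else 0 else 0))" for i
        using mn by (intro sum.cong) (auto simp: A_def)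
      then show ?thesis
        by (simp add: matrix_vector_mult_def sum.distrib vec_eq_iff)
    qed
    have "A = (\<chi> k. if k = m then row m (mat 1) + 1 *s row n (mat 1) else row k (mat 1))"
      using mn by (auto simp: A_def vec_eq_iff row_def mat_def)
    then have det: "det A = 1"
      using det_row_operation[OF mn, of "mat 1 :: real ^ 'd ^ 'd" 1] by simp
    show "Q (\<chi> i j. of_bool (i = m \<and> j = n \<or> i = j))"
      unfolding A_def[symmetric]
    proof (rule suff)
      fix a b :: "real ^ 'd"
      \<comment> \<open>The translation by \<open>v\<close> moves the lower end of coordinate
        \<open>n\<close> to 0, because \<open>measure_shear_interval\<close> wants that end to be
        nonnegative; translations do not change the measure.\<close>
      define v :: "real ^ 'd" where "v = axis n (- (a $ n))"
      show "measure lebesgue ((*v) A ` cbox a b) = \<bar>det A\<bar> * measure lebesgue (cbox a b)"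
      proof (cases "cbox a b = {}")
        case False
        then have ne: "cbox (v + a) (v + b) \<noteq> {}"
          by (simp add: cbox_translation)
        have "(*v) A ` cbox a b = (+) (- (A *v v)) ` (*v) A ` (+) v ` cbox a b"
          by (simp add: image_image matrix_vector_right_distrib)
        then have "measure lebesgue ((*v) A ` cbox a b) = measure lebesgue ((*v) A ` (+) v ` cbox a b)"
          by (simp only: measure_translation)
        also have "\<dots> = measure lebesgue ((*v) A ` cbox (v + a) (v + b))"
          by (simp only: cbox_translation)
        also have "\<dots> = measure lebesgue (cbox (v + a) (v + b))"
          using measure_shear_interval[OF mn ne] by (simp add: Av v_def axis_def)
        also have "\<dots> = measure lebesgue (cbox a b)"
          by (simp only: cbox_translation measure_translation)
        finally show ?thesis
          by (simp add: det)
      qed simp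
    qed
  qed
  with assms show "(*v) A ` S \<in> lmeasurable"
    "measure lebesgue ((*v) A ` S) = \<bar>det A\<bar> * measure lebesgue S"
    by (auto simp: Q_def)
qed

text \<open>The preimage of a box under \<open>A\<close> is its image under the inverse matrix,
  whose measure is known from \<open>measure_matrix_image\<close>.\<close>

lemma distr_lborel_matrix:
  fixes A :: "real ^ 'd ^ 'd"
  assumes "det A \<noteq> 0"
  shows "distr lborel borel ((*v) A) = density lborel (\<lambda>_. ennreal (1 / \<bar>det A\<bar>))"
proof -
  define B where "B = matrix_inv A"
  have AB: "A *v (B *v x) = x" and BA: "B *v (A *v x) = x" for x
    using assms by (simp_all add: B_def matrix_inv_cancel)
  have "A ** B = mat 1"
    using assms by (simp add: B_def matrix_inv_cancel)
  then have "det A * det B = 1"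
    by (metis det_I det_mul)
  then have detB: "\<bar>det A\<bar> * \<bar>det B\<bar> = 1"
    by (simp flip: abs_mult)
  have [measurable]: "(*v) A \<in> borel_measurable borel"
    by (intro borel_measurable_continuous_onI linear_continuous_on) (simp add: linear_conv_bounded_linear[symmetric])
  \<comment> \<open>Lebesgue measure is characterised by its values on boxes, so the identity is
    first proved with \<open>lborel\<close> alone on one side and the constant is divided out
    afterwards.\<close>
  have "lborel = density (distr lborel borel ((*v) A)) (\<lambda>_. ennreal \<bar>det A\<bar>)"
  proof (rule lborel_eqI)
    fix l u :: "real ^ 'd" assume le: "\<And>b. b \<in> Basis \<Longrightarrow> l \<bullet> b \<le> u \<bullet> b"
    have pre: "(*v) A -` box l u = (*v) B ` box l u"
    proof (intro set_eqI iffI)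
      show "x \<in> (*v) B ` box l u" if "x \<in> (*v) A -` box l u" for x
        using that BA by (intro image_eqI[of _ _ "A *v x"]) simp_all
      show "x \<in> (*v) A -` box l u" if "x \<in> (*v) B ` box l u" for x
        using that AB by auto
    qed
    have lm: "(*v) B ` box l u \<in> lmeasurable"
      and eq: "measure lebesgue ((*v) B ` box l u) = \<bar>det B\<bar> * measure lebesgue (box l u)"
      using measure_matrix_image[of "box l u" B]
      by (simp_all add: lmeasurable_box)
    have bor: "(*v) A -` box l u \<in> sets borel"
      using measurable_sets[of "(*v) A" borel borel "box l u"] by simp
    have "emeasure (density (distr lborel borel ((*v) A)) (\<lambda>_. ennreal \<bar>det A\<bar>)) (box l u)
        = ennreal \<bar>det A\<bar> * emeasure lborel ((*v) A -` box l u)"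
      by (simp add: emeasure_density_const emeasure_distr)
    also have "emeasure lborel ((*v) A -` box l u) = emeasure lebesgue ((*v) B ` box l u)"
      using bor by (simp add: pre)
    also have "\<dots> = ennreal (\<bar>det B\<bar> * measure lebesgue (box l u))"
      using lm by (simp add: emeasure_eq_measure2 eq)
    also have "ennreal \<bar>det A\<bar> * \<dots> = ennreal ((\<bar>det A\<bar> * \<bar>det B\<bar>) * measure lebesgue (box l u))"
      by (simp add: ennreal_mult' mult.assoc)
    also have "\<dots> = ennreal (\<Prod>b\<in>Basis. (u - l) \<bullet> b)"
      using le by (simp add: detB)
    finally show "emeasure (density (distr lborel borel ((*v) A)) (\<lambda>_. ennreal \<bar>det A\<bar>)) (box l u)
        = (\<Prod>b\<in>Basis. (u - l) \<bullet> b)" .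
  qed simp
  then have "density lborel (\<lambda>_. ennreal (1 / \<bar>det A\<bar>))
      = density (density (distr lborel borel ((*v) A)) (\<lambda>_. ennreal \<bar>det A\<bar>)) (\<lambda>_. ennreal (1 / \<bar>det A\<bar>))"
    by simp
  also have "\<dots> = density (distr lborel borel ((*v) A)) (\<lambda>_. ennreal \<bar>det A\<bar> * ennreal (1 / \<bar>det A\<bar>))"
    by (rule density_density_eq) simp_all
  also have "\<dots> = distr lborel borel ((*v) A)"
    using assms by (simp add: ennreal_mult[symmetric] density_1)
  finally show ?thesis ..
qed

lemma measurable_matrix_vector_mult [measurable]:
  fixes A :: "real ^ 'd ^ 'd"
  shows "(*v) A \<in> borel_measurable borel"
  by (intro borel_measurable_continuous_onI linear_continuous_on) (simp add: linear_conv_bounded_linear[symmetric])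

lemma emeasure_lborel_vimage_matrix:
  fixes A :: "real ^ 'd ^ 'd"
  assumes "det A \<noteq> 0" and X: "X \<in> sets borel"
  shows "emeasure lborel ((*v) A -` X) = ennreal (1 / \<bar>det A\<bar>) * emeasure lborel X"
proof -
  have "emeasure lborel ((*v) A -` X) = emeasure (distr lborel borel ((*v) A)) X"
    using X by (simp add: emeasure_distr)
  also have "\<dots> = ennreal (1 / \<bar>det A\<bar>) * emeasure lborel X"
    unfolding distr_lborel_matrix[OF assms(1)] using X by (simp add: emeasure_density_const)
  finally show ?thesis .
qed

lemma lborel_integral_matrix:
  fixes A :: "real ^ 'd ^ 'd" and f :: "real ^ 'd \<Rightarrow> 'b::{banach,second_countable_topology}"
  assumes det: "det A \<noteq> 0" and f: "f \<in> borel_measurable borel"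
  shows "(LINT x|lborel. f (A *v x)) = (1 / \<bar>det A\<bar>) *\<^sub>R (LINT x|lborel. f x)"
    and "integrable lborel (\<lambda>x. f (A *v x)) \<longleftrightarrow> integrable lborel f"
proof -
  have "(LINT x|lborel. f (A *v x)) = (LINT x|distr lborel borel ((*v) A). f x)"
    using f by (simp add: integral_distr)
  also have "\<dots> = (1 / \<bar>det A\<bar>) *\<^sub>R (LINT x|lborel. f x)"
    unfolding distr_lborel_matrix[OF det] using f by (simp add: integral_density)
  finally show "(LINT x|lborel. f (A *v x)) = (1 / \<bar>det A\<bar>) *\<^sub>R (LINT x|lborel. f x)" .
  have "integrable lborel (\<lambda>x. f (A *v x)) \<longleftrightarrow> integrable (distr lborel borel ((*v) A)) f"
    using f by (simp add: integrable_distr_eq)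
  also have "\<dots> \<longleftrightarrow> integrable lborel f"
  proof -
    have "integrable lborel f" if "integrable lborel (\<lambda>x. (1 / \<bar>det A\<bar>) *\<^sub>R f x)"
      using integrable_scaleR_right[of "\<bar>det A\<bar>", OF that] det by simp
    then show ?thesis
      unfolding distr_lborel_matrix[OF det] using f by (auto simp: integrable_density)
  qed
  finally show "integrable lborel (\<lambda>x. f (A *v x)) \<longleftrightarrow> integrable lborel f" .
qed

lemma lborel_integral_translate:
  fixes f :: "real ^ 'd \<Rightarrow> 'b::{banach,second_countable_topology}"
  assumes f: "f \<in> borel_measurable borel"
  shows "(LINT x|lborel. f (x - k)) = (LINT x|lborel. f x)"
    and "integrable lborel (\<lambda>x. f (x - k)) \<longleftrightarrow> integrable lborel f"
proof -
  have eq: "distr lborel borel (\<lambda>x. x - k) = (lborel :: (real ^ 'd) measure)"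
  proof -
    have "(\<lambda>x. x - k) = (+) (- k)"
      by (rule ext) simp
    then show ?thesis
      by (simp only: lborel_distr_plus)
  qed
  have "(LINT x|lborel. f (x - k)) = (LINT x|distr lborel borel (\<lambda>x. x - k). f x)"
    using f by (intro integral_distr[symmetric]) auto
  then show "(LINT x|lborel. f (x - k)) = (LINT x|lborel. f x)"
    by (simp add: eq)
  have "integrable (distr lborel borel (\<lambda>x. x - k)) f \<longleftrightarrow> integrable lborel (\<lambda>x. f (x - k))"
    using f by (intro integrable_distr_eq) auto
  then show "integrable lborel (\<lambda>x. f (x - k)) \<longleftrightarrow> integrable lborel f"
    by (simp add: eq)
qed

section \<open>Fundamental domains of lattices\<close>

lemma int_lattice_add: "k \<in> int_lattice \<Longrightarrow> m \<in> int_lattice \<Longrightarrow> k + m \<in> int_lattice"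
  and int_lattice_diff: "k \<in> int_lattice \<Longrightarrow> m \<in> int_lattice \<Longrightarrow> k - m \<in> int_lattice"
  and int_lattice_minus: "k \<in> int_lattice \<Longrightarrow> - k \<in> int_lattice"
  and int_lattice_zero [simp]: "0 \<in> int_lattice"
  by (simp_all add: int_lattice_def)

lemma int_lattice_inner: "k \<in> int_lattice \<Longrightarrow> m \<in> int_lattice \<Longrightarrow> k \<bullet> m \<in> \<int>"
  by (auto simp: int_lattice_def inner_vec_def)

lemma int_lattice_axis: "axis i 1 \<in> int_lattice"
  by (simp add: int_lattice_def axis_def)

lemma countable_int_lattice [simp]: "countable (int_lattice :: (real ^ 'd) set)"
proof (rule countable_subset)
  show "int_lattice \<subseteq> (\<lambda>f. \<chi> i. f i) ` (PiE (UNIV :: 'd set) (\<lambda>_. (\<int> :: real set)))"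
  proof
    fix x :: "real ^ 'd" assume "x \<in> int_lattice"
    then show "x \<in> (\<lambda>f. \<chi> i. f i) ` (PiE (UNIV :: 'd set) (\<lambda>_. (\<int> :: real set)))"
      by (intro image_eqI[of _ _ "\<lambda>i. x $ i"]) (auto simp: int_lattice_def)
  qed
  show "countable ((\<lambda>f. (\<chi> i. f i) :: real ^ 'd) ` (PiE (UNIV :: 'd set) (\<lambda>_. (\<int> :: real set))))"
    by (intro countable_image countable_PiE) (auto simp: Ints_def)
qed

text \<open>Representatives are unique for every point, with no exceptional null set. Hence
  half-open cubes qualify while closed boxes do not.\<close>

definition fundamental_domain :: "(real ^ 'd) set \<Rightarrow> (real ^ 'd) set \<Rightarrow> bool" where
  "fundamental_domain G E \<longleftrightarrow> E \<in> sets borel \<and> (\<forall>x. \<exists>!g. g \<in> G \<and> x - g \<in> E)"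

lemma emeasure_lborel_translate:
  fixes X :: "(real ^ 'd) set"
  assumes "X \<in> sets borel"
  shows "emeasure lborel {x. c + x \<in> X} = emeasure lborel X"
proof -
  have "emeasure lborel X = emeasure (distr lborel borel ((+) c)) X"
    by (simp add: lborel_distr_plus)
  also have "\<dots> = emeasure lborel {x. c + x \<in> X}"
    using assms by (simp add: emeasure_distr vimage_def)
  finally show ?thesis ..
qed

text \<open>Cut \<open>E\<close> along the translates of \<open>Q\<close> and \<open>Q\<close> along
  the translates of \<open>E\<close>: the piece of \<open>E\<close> with label \<open>g\<close>,
  moved by \<open>- g\<close>, is the piece of \<open>Q\<close> with label \<open>- g\<close>. With
  \<open>Y = UNIV\<close> this compares volumes of cells, with a periodic \<open>Y\<close> it yields
  shift invariance on the torus.\<close>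

lemma fundamental_domain_emeasure_eq:
  fixes G :: "(real ^ 'd) set"
  assumes G: "countable G" "\<And>g. g \<in> G \<Longrightarrow> - g \<in> G"
    and E: "fundamental_domain G E" and Q: "fundamental_domain G Q"
    and Y: "Y \<in> sets borel" and per: "\<And>x g. g \<in> G \<Longrightarrow> x + g \<in> Y \<longleftrightarrow> x \<in> Y"
  shows "emeasure lborel (E \<inter> Y) = emeasure lborel (Q \<inter> Y)"
proof -
  define p where "p U W g = {x. x \<in> U \<and> x \<in> Y \<and> x - g \<in> W}" for U W :: "(real ^ 'd) set" and g
  have pm: "p U W g \<in> sets borel" if "U \<in> sets borel" "W \<in> sets borel" for U W g
  proof -
    have "{x. x - g \<in> W} = (\<lambda>x. x - g) -` W \<inter> space borel"
      by auto
    also have "\<dots> \<in> sets borel"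
      by (rule measurable_sets[OF _ that(2)]) simp
    finally have "U \<inter> Y \<inter> {x. x - g \<in> W} \<in> sets borel"
      using that(1) Y by blast
    also have "U \<inter> Y \<inter> {x. x - g \<in> W} = p U W g"
      by (auto simp: p_def)
    finally show ?thesis .
  qed
  have split: "emeasure lborel (U \<inter> Y) = (\<integral>\<^sup>+g. emeasure lborel (p U W g) \<partial>count_space G)"
    if U: "fundamental_domain G U" and W: "fundamental_domain G W" for U W
  proof -
    have "U \<inter> Y = (\<Union>g\<in>G. p U W g)"
      using W unfolding fundamental_domain_def p_def by blast
    moreover have "disjoint_family_on (p U W) G"
      using W unfolding fundamental_domain_def p_def disjoint_family_on_def by blast
    ultimately show ?thesis
      using emeasure_UN_countable[of G "p U W" lborel] pm U W G(1)
      by (simp add: fundamental_domain_def)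
  qed
  have eq: "emeasure lborel (p E Q g) = emeasure lborel (p Q E (- g))" if g: "g \<in> G" for g
  proof -
    have "emeasure lborel (p E Q g) = emeasure lborel {x. g + x \<in> p E Q g}"
      using pm E Q by (intro emeasure_lborel_translate[symmetric]) (auto simp: fundamental_domain_def)
    also have "{x. g + x \<in> p E Q g} = p Q E (- g)"
      using per[OF g] by (auto simp: p_def add.commute)
    finally show ?thesis .
  qed
  have "emeasure lborel (E \<inter> Y) = (\<integral>\<^sup>+g. emeasure lborel (p E Q g) \<partial>count_space G)"
    by (rule split[OF E Q])
  also have "\<dots> = (\<integral>\<^sup>+g. emeasure lborel (p Q E (- g)) \<partial>count_space G)"
    by (rule nn_integral_cong) (simp add: eq)
  also have "\<dots> = (\<integral>\<^sup>+g. emeasure lborel (p Q E g) \<partial>count_space G)"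
  proof (rule nn_integral_bij_count_space)
    show "bij_betw uminus G G"
      using G(2) by (intro bij_betwI[of _ _ _ uminus]) auto
  qed
  also have "\<dots> = emeasure lborel (Q \<inter> Y)"
    by (rule split[OF Q E, symmetric])
  finally show ?thesis .
qed

text \<open>Half-open, so that it is an exact fundamental domain of the lattice scaled by a positive
  \<open>c\<close>.\<close>

definition cube :: "real \<Rightarrow> (real ^ 'd) set" where
  "cube c = {x. \<forall>i. 0 \<le> x $ i \<and> x $ i < c}"

lemma cube_borel: "cube c \<in> sets borel"
proof -
  have "cube c = (\<Inter>i. {x. 0 \<le> x $ i} \<inter> {x. x $ i < c})"
    by (auto simp: cube_def)
  also have "\<dots> \<in> sets borel"
    by (intro sets.finite_INT sets.Int borel_closed borel_open closed_halfspace_component_ge_cart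
        open_halfspace_component_lt_cart) auto
  finally show ?thesis .
qed

lemma fundamental_domain_cube:
  assumes "0 < c"
  shows "fundamental_domain ((*\<^sub>R) c ` int_lattice) (cube c :: (real ^ 'd) set)"
  unfolding fundamental_domain_def
proof (intro conjI allI cube_borel ex_ex1I)
  fix x :: "real ^ 'd"
  define k :: "real ^ 'd" where "k = (\<chi> i. of_int \<lfloor>x $ i / c\<rfloor>)"
  have "k \<in> int_lattice"
    by (simp add: k_def int_lattice_def)
  moreover have "x - c *\<^sub>R k \<in> cube c"
  proof -
    have "0 \<le> x $ i - c * of_int \<lfloor>x $ i / c\<rfloor>" "x $ i - c * of_int \<lfloor>x $ i / c\<rfloor> < c" for i
    proof -
      have "of_int \<lfloor>x $ i / c\<rfloor> * c \<le> x $ i" "x $ i < (of_int \<lfloor>x $ i / c\<rfloor> + 1) * c"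
        unfolding pos_le_divide_eq[OF assms, symmetric] pos_divide_less_eq[OF assms, symmetric]
        by linarith+
      then show "0 \<le> x $ i - c * of_int \<lfloor>x $ i / c\<rfloor>" "x $ i - c * of_int \<lfloor>x $ i / c\<rfloor> < c"
        by (simp_all add: algebra_simps)
    qed
    then show ?thesis
      by (simp add: cube_def k_def)
  qed
  ultimately show "\<exists>g. g \<in> (*\<^sub>R) c ` int_lattice \<and> x - g \<in> cube c"
    by blast
next
  fix x g g' :: "real ^ 'd"
  assume g: "g \<in> (*\<^sub>R) c ` int_lattice \<and> x - g \<in> cube c"
    and g': "g' \<in> (*\<^sub>R) c ` int_lattice \<and> x - g' \<in> cube c"
  obtain k k' where k: "g = c *\<^sub>R k" "k \<in> int_lattice" and k': "g' = c *\<^sub>R k'" "k' \<in> int_lattice"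
    using g g' by blast
  have "k $ i = k' $ i" for i
  proof -
    have "\<bar>c * k $ i - c * k' $ i\<bar> < c"
      using g g' unfolding k k' cube_def by (simp add: abs_less_iff) (smt (verit))
    then have "\<bar>k $ i - k' $ i\<bar> < 1"
      using assms by (simp add: right_diff_distrib[symmetric] abs_mult)
    moreover have "k $ i - k' $ i \<in> \<int>"
      using k(2) k'(2) by (simp add: int_lattice_def)
    ultimately show ?thesis
      using Ints_nonzero_abs_less1 by fastforce
  qed
  then show "g = g'"
    by (simp add: k(1) k'(1) vec_eq_iff)
qed

lemma fundamental_domain_translate:
  assumes "fundamental_domain G E"
  shows "fundamental_domain G {x. x - y \<in> E}"
  unfolding fundamental_domain_def
proof (intro conjI allI)
  have "{x. x - y \<in> E} = (\<lambda>x. x - y) -` E \<inter> space borel"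
    by auto
  also have "\<dots> \<in> sets borel"
    using assms by (intro measurable_sets[of _ borel borel]) (auto simp: fundamental_domain_def)
  finally show "{x. x - y \<in> E} \<in> sets borel" .
  fix x
  have "\<exists>!g. g \<in> G \<and> x - y - g \<in> E"
    using assms by (simp add: fundamental_domain_def)
  then show "\<exists>!g. g \<in> G \<and> x - g \<in> {x. x - y \<in> E}"
    by (simp add: algebra_simps)
qed

text \<open>Links the exact fundamental domain with the closed box carrying
  \<open>torus_measure\<close>: the closed and the open box have the same finite volume, and the
  cube lies between them.\<close>

lemma AE_cube_iff_cbox:
  "AE x in lborel. x \<in> cube c \<longleftrightarrow> x \<in> cbox 0 ((\<chi> i. c) :: real ^ 'd)"
proof -
  have "cbox 0 ((\<chi> i. c) :: real ^ 'd) - box 0 (\<chi> i. c) \<in> null_sets lborel"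
    using emeasure_lborel_cbox_finite[of 0 "(\<chi> i. c) :: real ^ 'd"]
    by (simp add: null_sets_def emeasure_Diff box_subset_cbox emeasure_lborel_box_eq emeasure_lborel_cbox_eq)
  then have "AE x in lborel. x \<notin> cbox 0 ((\<chi> i. c) :: real ^ 'd) - box 0 (\<chi> i. c)"
    by (rule AE_not_in)
  then show ?thesis
    by (rule AE_mp) (auto simp: cube_def mem_box_cart less_imp_le intro!: AE_I2)
qed

lemma emeasure_cube:
  assumes "0 \<le> c"
  shows "emeasure lborel (cube c :: (real ^ 'd) set) = ennreal (c ^ CARD('d))"
proof -
  have "emeasure lborel (cube c :: (real ^ 'd) set) = emeasure lborel (cbox 0 ((\<chi> i. c) :: real ^ 'd))"
    using AE_cube_iff_cbox by (intro emeasure_eq_AE) (auto simp: cube_borel)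
  also have "\<dots> = ennreal (c ^ CARD('d))"
  proof -
    have comp: "((\<chi> i. c) :: real ^ 'd) \<bullet> b = c" if "b \<in> Basis" for b
      using that by (auto simp: Basis_vec_def inner_axis)
    then have "(\<Prod>b\<in>(Basis :: (real ^ 'd) set). ((\<chi> i. c) - 0) \<bullet> b) = (\<Prod>b\<in>(Basis :: (real ^ 'd) set). c)"
      by (intro prod.cong) auto
    then show ?thesis
      using assms comp by (simp add: emeasure_lborel_cbox_eq)
  qed
  finally show ?thesis .
qed

section \<open>Digit sets\<close>

lemma int_lattice_cube_ex1:
  fixes x :: "real ^ 'd"
  shows "\<exists>!k. k \<in> int_lattice \<and> x - k \<in> cube 1"
  using fundamental_domain_cube[of 1, where 'd = 'd] by (simp add: fundamental_domain_def)

text \<open>The lattice \<open>G\<close>, the image of the integer lattice under \<open>B\<close>,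
  has two fundamental domains: the image \<open>E\<close> of the unit cube under \<open>B\<close>,
  of volume \<open>\<bar>det B\<bar>\<close>, and the union \<open>W\<close> of the unit cubes
  attached to the digits, of volume the number of digits.\<close>

lemma digit_set_card:
  fixes B :: "real ^ 'd ^ 'd"
  assumes det: "det B \<noteq> 0" and lat: "\<And>k. k \<in> int_lattice \<Longrightarrow> B *v k \<in> int_lattice"
    and K: "digit_set B K"
  shows "finite K" "real (card K) = \<bar>det B\<bar>"
proof -
  define G where "G = (*v) B ` int_lattice"
  have K_lat: "K \<subseteq> int_lattice"
    and K_ex1: "\<And>x. x \<in> int_lattice \<Longrightarrow> \<exists>!\<mu>. \<mu> \<in> K \<and> x - \<mu> \<in> G"
    using K by (auto simp: digit_set_def G_def)
  have fd1: "\<exists>!k. k \<in> int_lattice \<and> x - k \<in> cube 1" for x :: "real ^ 'd"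
    by (rule int_lattice_cube_ex1)
  have neg: "- (B *v k) = B *v (- k)" for k
    by (simp add: vec_eq_iff matrix_vector_mult_def sum_negf)
  have G: "countable G" "\<And>g. g \<in> G \<Longrightarrow> - g \<in> G"
    by (auto simp: G_def int_lattice_minus neg intro!: countable_image imageI)
  have G_lat: "g \<in> int_lattice" if "g \<in> G" for g
    using that lat by (auto simp: G_def)
  define E where "E = (*v) (matrix_inv B) -` cube 1"
  have E_borel: "E \<in> sets borel"
    using measurable_sets[OF measurable_matrix_vector_mult cube_borel, of "matrix_inv B" 1]
    by (simp add: E_def)
  have E: "fundamental_domain G E"
    unfolding fundamental_domain_def
  proof (intro conjI allI E_borel)
    fix x
    obtain k where k: "k \<in> int_lattice" "matrix_inv B *v x - k \<in> cube 1"
      and uniq: "\<And>k'. k' \<in> int_lattice \<Longrightarrow> matrix_inv B *v x - k' \<in> cube 1 \<Longrightarrow> k' = k"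
      using fd1[of "matrix_inv B *v x"] by auto
    show "\<exists>!g. g \<in> G \<and> x - g \<in> E"
    proof (rule ex1I[of _ "B *v k"])
      show "B *v k \<in> G \<and> x - B *v k \<in> E"
        using k by (simp add: G_def E_def matrix_vector_mult_diff_distrib matrix_inv_cancel[OF det])
      fix g assume g: "g \<in> G \<and> x - g \<in> E"
      then obtain k' where "k' \<in> int_lattice" "g = B *v k'"
        by (auto simp: G_def)
      with g show "g = B *v k"
        using uniq[of k'] by (simp add: E_def matrix_vector_mult_diff_distrib matrix_inv_cancel[OF det])
    qed
  qed
  define W where "W = (\<Union>\<mu>\<in>K. {x. x - \<mu> \<in> cube 1})"
  have piece: "{x. x - \<mu> \<in> cube 1} \<in> sets borel" for \<mu> :: "real ^ 'd"
  proof -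
    have "(\<lambda>x. x - \<mu>) -` cube 1 \<inter> space borel \<in> sets borel"
      by (rule measurable_sets[OF _ cube_borel]) simp
    then show ?thesis by (simp add: vimage_def)
  qed
  have countK: "countable K"
    using K_lat countable_int_lattice by (rule countable_subset)
  have W: "fundamental_domain G W"
    unfolding fundamental_domain_def
  proof (intro conjI allI)
    show "W \<in> sets borel"
      unfolding W_def using piece countK by (intro sets.countable_UN') auto
    fix x :: "real ^ 'd"
    obtain k where k: "k \<in> int_lattice" "x - k \<in> cube 1"
      and uniq: "\<And>k'. k' \<in> int_lattice \<Longrightarrow> x - k' \<in> cube 1 \<Longrightarrow> k' = k"
      using fd1[of x] by auto
    obtain \<mu> where \<mu>: "\<mu> \<in> K" "k - \<mu> \<in> G"
      and \<mu>_uniq: "\<And>\<mu>'. \<mu>' \<in> K \<Longrightarrow> k - \<mu>' \<in> G \<Longrightarrow> \<mu>' = \<mu>"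
      using K_ex1[OF k(1)] by auto
    show "\<exists>!g. g \<in> G \<and> x - g \<in> W"
    proof (rule ex1I[of _ "k - \<mu>"])
      show "k - \<mu> \<in> G \<and> x - (k - \<mu>) \<in> W"
        using \<mu> k by (auto simp: W_def intro!: bexI[of _ \<mu>])
      fix g assume g: "g \<in> G \<and> x - g \<in> W"
      then obtain \<mu>' where \<mu>': "\<mu>' \<in> K" "x - g - \<mu>' \<in> cube 1"
        by (auto simp: W_def)
      then have "g + \<mu>' = k"
        using uniq[of "g + \<mu>'"] g G_lat K_lat by (auto simp: int_lattice_add algebra_simps)
      then have "g = k - \<mu>'"
        by (simp add: algebra_simps)
      then show "g = k - \<mu>"
        using \<mu>_uniq[OF \<mu>'(1)] g by simp
    qed
  qed
  have disj: "disjoint_family_on (\<lambda>\<mu>. {x. x - \<mu> \<in> cube 1}) K"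
    using fd1 K_lat unfolding disjoint_family_on_def by blast
  have one: "emeasure lborel {x. x - \<mu> \<in> cube 1} = 1" for \<mu> :: "real ^ 'd"
    using emeasure_lborel_translate[OF cube_borel, of "- \<mu>" 1] emeasure_cube[of 1, where 'd = 'd]
    by simp
  \<comment> \<open>The digits are counted by an extended value, so that finiteness of
    \<open>K\<close> comes out of the comparison of volumes.\<close>
  have "emeasure lborel W = (\<integral>\<^sup>+\<mu>. emeasure lborel {x. x - \<mu> \<in> cube 1} \<partial>count_space K)"
    unfolding W_def using piece countK disj by (intro emeasure_UN_countable) auto
  also have "\<dots> = emeasure (count_space K) K"
    by (simp add: one)
  finally have EK: "emeasure lborel W = emeasure (count_space K) K" .
  have "emeasure lborel W = emeasure lborel E"
    using fundamental_domain_emeasure_eq[OF G W E, of UNIV] by simp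
  also have "\<dots> = ennreal (1 / \<bar>det (matrix_inv B)\<bar>) * emeasure lborel (cube 1 :: (real ^ 'd) set)"
  proof -
    have "det B * det (matrix_inv B) = 1"
      using matrix_inv_cancel(1)[OF det] by (metis det_I det_mul)
    then have "det (matrix_inv B) \<noteq> 0" by auto
    then show ?thesis
      unfolding E_def by (rule emeasure_lborel_vimage_matrix[OF _ cube_borel])
  qed
  also have "\<dots> = ennreal \<bar>det B\<bar>"
  proof -
    have "det B * det (matrix_inv B) = 1"
      using matrix_inv_cancel(1)[OF det] by (metis det_I det_mul)
    then have "\<bar>det B\<bar> * \<bar>det (matrix_inv B)\<bar> = 1"
      by (simp flip: abs_mult)
    then have "1 / \<bar>det (matrix_inv B)\<bar> = \<bar>det B\<bar>"
      by (metis nonzero_eq_divide_eq mult_zero_right zero_neq_one)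
    then show ?thesis
      by (simp add: emeasure_cube)
  qed
  finally have EKd: "emeasure (count_space K) K = ennreal \<bar>det B\<bar>"
    unfolding EK .
  show "finite K"
  proof (rule ccontr)
    assume "infinite K"
    then show False using EKd by simp
  qed
  then show "real (card K) = \<bar>det B\<bar>"
    using EKd by (simp add: ennreal_of_nat_eq_real_of_nat)
qed

text \<open>The lattice points in the image of the unit cube under \<open>B\<close>, moved to start
  at \<open>k\<close>, represent every coset once. A prescribed member \<open>k\<close> is asked for
  because the counting argument must reach every translation index.\<close>

lemma exists_digit_set:
  fixes B :: "real ^ 'd ^ 'd"
  assumes det: "det B \<noteq> 0" and lat: "\<And>k. k \<in> int_lattice \<Longrightarrow> B *v k \<in> int_lattice"
    and k: "k \<in> int_lattice"
  obtains K where "digit_set B K" "k \<in> K"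
proof
  define K where "K = {x \<in> int_lattice. matrix_inv B *v (x - k) \<in> cube 1}"
  show "k \<in> K"
    using k by (simp add: K_def cube_def)
  show "digit_set B K"
    unfolding digit_set_def
  proof (intro conjI ballI)
    show "K \<subseteq> int_lattice"
      by (auto simp: K_def)
    fix x :: "real ^ 'd" assume x: "x \<in> int_lattice"
    have "\<exists>!m. m \<in> int_lattice \<and> matrix_inv B *v (x - k) - m \<in> cube 1"
      by (rule int_lattice_cube_ex1)
    then obtain m where m: "m \<in> int_lattice" "matrix_inv B *v (x - k) - m \<in> cube 1"
      and uniq: "\<And>m'. m' \<in> int_lattice \<Longrightarrow> matrix_inv B *v (x - k) - m' \<in> cube 1 \<Longrightarrow> m' = m"
      by auto
    have eq: "matrix_inv B *v (x - B *v m' - k) = matrix_inv B *v (x - k) - m'" for m'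
      by (simp add: matrix_vector_mult_diff_distrib matrix_inv_cancel[OF det])
    show "\<exists>!\<mu>. \<mu> \<in> K \<and> x - \<mu> \<in> (*v) B ` int_lattice"
    proof (rule ex1I[of _ "x - B *v m"])
      show "x - B *v m \<in> K \<and> x - (x - B *v m) \<in> (*v) B ` int_lattice"
        using m x lat by (simp add: K_def eq int_lattice_diff)
      fix \<mu> assume \<mu>: "\<mu> \<in> K \<and> x - \<mu> \<in> (*v) B ` int_lattice"
      then obtain m' where m': "m' \<in> int_lattice" "x - \<mu> = B *v m'"
        by auto
      then have \<mu>_eq: "\<mu> = x - B *v m'"
        by (simp add: algebra_simps)
      then have "m' = m"
        using \<mu> m'(1) uniq eq by (simp add: K_def)
      then show "\<mu> = x - B *v m"
        by (simp add: \<mu>_eq)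
    qed
  qed
qed

lemma dilation_matrix_det_nz:
  fixes A :: "real ^ 'd ^ 'd"
  assumes "dilation_matrix A"
  shows "det A \<noteq> 0"
proof
  assume "det A = 0"
  then obtain v where v: "v \<noteq> 0" "A *v v = 0"
    using invertible_det_nz[of A] matrix_left_invertible_ker[of A] invertible_left_inverse[of A] by auto
  define w :: "complex ^ 'd" where "w = (\<chi> i. complex_of_real (v $ i))"
  have "w \<noteq> 0"
    using v(1) by (auto simp: w_def vec_eq_iff)
  moreover have "complex_matrix A *v w = 0 *s w"
  proof -
    have "(\<Sum>j\<in>UNIV. complex_of_real (A $ i $ j) * complex_of_real (v $ j)) = 0" for i
    proof -
      have "(\<Sum>j\<in>UNIV. complex_of_real (A $ i $ j) * complex_of_real (v $ j)) = complex_of_real ((A *v v) $ i)"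
        by (simp add: matrix_vector_mult_def)
      then show ?thesis
        by (simp add: v(2))
    qed
    then show ?thesis
      by (simp add: matrix_vector_mult_def complex_matrix_def w_def vec_eq_iff)
  qed
  ultimately have "1 < norm (0 :: complex)"
    using assms unfolding dilation_matrix_def by blast
  then show False by simp
qed

text \<open>Preserving the integer lattice means having integer entries, since the columns are the
  images of the unit vectors; this condition is symmetric under transposition.\<close>

lemma int_lattice_transpose:
  fixes A :: "real ^ 'd ^ 'd"
  assumes lat: "\<And>k. k \<in> int_lattice \<Longrightarrow> A *v k \<in> int_lattice" and k: "k \<in> int_lattice"
  shows "transpose A *v k \<in> int_lattice"
proof -
  have "A $ i $ j \<in> \<int>" for i j
  proof -
    have "(A *v axis j 1) $ i = A $ i $ j"
      by (simp add: matrix_vector_mult_basis column_def)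
    moreover have "(A *v axis j 1) $ i \<in> \<int>"
      using lat[OF int_lattice_axis] by (simp add: int_lattice_def)
    ultimately show ?thesis by simp
  qed
  then show ?thesis
    using k by (auto simp: int_lattice_def matrix_vector_mult_def transpose_def)
qed

section \<open>Trigonometric series\<close>

text \<open>An L2 sum on the torus is known to be measurable on one period box only, while shifts of
  the argument leave that box. Periodicity carries measurability to the countably many translates of
  the box, which cover the space.\<close>

lemma borel_measurable_periodic:
  fixes F :: "real ^ 'd \<Rightarrow> complex"
  assumes per: "\<And>\<xi> k. k \<in> int_lattice \<Longrightarrow> F (\<xi> + (2 * pi) *\<^sub>R k) = F \<xi>"
    and F: "F \<in> borel_measurable torus_measure"
  shows "F \<in> borel_measurable borel"
proof -
  define T :: "(real ^ 'd) set" where "T = cbox 0 (\<chi> i. 2 * pi)"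
  define p where "p k = {x. x - (2 * pi) *\<^sub>R k \<in> T}" for k :: "real ^ 'd"
  have "sets torus_measure = sets (restrict_space borel T)"
    unfolding torus_measure_def T_def by (rule sets_restrict_space_cong) simp
  then have "borel_measurable torus_measure = (borel_measurable (restrict_space borel T) :: (real ^ 'd \<Rightarrow> complex) set)"
    by (rule measurable_cong_sets) (rule refl)
  with F have FT: "F \<in> borel_measurable (restrict_space borel T)"
    by simp
  show ?thesis
  proof (rule measurable_piecewise_restrict[of "p ` int_lattice"])
    show "countable (p ` int_lattice)"
      by simp
    fix \<Omega> assume "\<Omega> \<in> p ` int_lattice"
    then obtain k where k: "k \<in> int_lattice" "\<Omega> = p k"
      by auto
    have "(\<lambda>x. x - (2 * pi) *\<^sub>R k) -` T \<inter> space borel \<in> sets borel"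
      by (rule measurable_sets[of _ borel borel]) (simp_all add: T_def)
    then show "\<Omega> \<inter> space borel \<in> sets borel"
      by (simp add: k(2) p_def vimage_def)
    have "(\<lambda>x. x - (2 * pi) *\<^sub>R k) \<in> measurable (restrict_space borel \<Omega>) (restrict_space borel T)"
      by (rule measurable_restrict_space3) (auto simp: k(2) p_def)
    then have "(\<lambda>x. F (x - (2 * pi) *\<^sub>R k)) \<in> borel_measurable (restrict_space borel \<Omega>)"
      using FT by (rule measurable_compose)
    moreover have "F (x - (2 * pi) *\<^sub>R k) = F x" for x
      using per[OF k(1), of "x - (2 * pi) *\<^sub>R k"] by simp
    ultimately show "F \<in> borel_measurable (restrict_space borel \<Omega>)"
      by simp
  next
    show "space borel \<subseteq> \<Union>(p ` int_lattice)"
    proof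
      fix x :: "real ^ 'd"
      have "fundamental_domain ((*\<^sub>R) (2 * pi) ` int_lattice) (cube (2 * pi) :: (real ^ 'd) set)"
        by (rule fundamental_domain_cube) simp
      then obtain k where "k \<in> int_lattice" "x - (2 * pi) *\<^sub>R k \<in> cube (2 * pi)"
        unfolding fundamental_domain_def by blast
      then show "x \<in> \<Union>(p ` int_lattice)"
        by (intro UnionI[of "p k"] imageI) (simp_all add: p_def T_def cube_def mem_box_cart less_imp_le)
    qed
  qed
qed

text \<open>The preimage of \<open>X\<close> under \<open>P\<close> is periodic, and a translated
  cube is again a fundamental domain, so both cubes meet it in the same measure. Stated for image
  measures, the fact gives integrals and integrability at once.\<close>

lemma distr_torus_shift:
  fixes P :: "real ^ 'd \<Rightarrow> 'b::topological_space"
  assumes per: "\<And>\<xi> k. k \<in> int_lattice \<Longrightarrow> P (\<xi> + (2 * pi) *\<^sub>R k) = P \<xi>"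
    and P: "P \<in> borel_measurable borel"
  shows "distr torus_measure borel (\<lambda>\<xi>. P (\<xi> + \<eta>)) = distr torus_measure borel P"
proof (rule measure_eqI)
  define T :: "(real ^ 'd) set" where "T = cbox 0 (\<chi> i. 2 * pi)"
  define Q :: "(real ^ 'd) set" where "Q = cube (2 * pi)"
  define G :: "(real ^ 'd) set" where "G = (*\<^sub>R) (2 * pi) ` int_lattice"
  have fdQ: "fundamental_domain G Q"
    unfolding G_def Q_def by (rule fundamental_domain_cube) simp
  have Q_borel: "Q \<in> sets borel"
    by (simp add: Q_def cube_borel)
  have G: "countable G" "\<And>g. g \<in> G \<Longrightarrow> - g \<in> G"
    unfolding G_def by (auto simp: int_lattice_minus simp flip: scaleR_minus_right intro!: imageI)
  fix X assume "X \<in> sets (distr torus_measure borel (\<lambda>\<xi>. P (\<xi> + \<eta>)))"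
  then have X: "X \<in> sets borel" by simp
  have Psh: "(\<lambda>\<xi>. P (\<xi> + \<eta>)) \<in> borel_measurable borel"
    by (rule measurable_compose[OF _ P]) simp
  have emeas: "emeasure (distr torus_measure borel R) X = emeasure lborel (Q \<inter> R -` X)"
    if R: "R \<in> borel_measurable borel" for R :: "real ^ 'd \<Rightarrow> 'b"
  proof -
    have RX: "R -` X \<in> sets borel"
      using measurable_sets[OF R X] by simp
    have "emeasure (distr torus_measure borel R) X = emeasure lborel (T \<inter> R -` X)"
      using R X RX unfolding torus_measure_def T_def[symmetric]
      by (subst emeasure_distr)
        (auto simp: measurable_restrict_space1 space_restrict_space emeasure_restrict_space T_def Int_commute)
    also have "\<dots> = emeasure lborel (Q \<inter> R -` X)"
      using AE_cube_iff_cbox[of "2 * pi"] RX Q_borel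
      by (intro emeasure_eq_AE) (auto simp: T_def Q_def)
    finally show ?thesis .
  qed
  define Y where "Y = P -` X"
  have Y: "Y \<in> sets borel"
    using measurable_sets[OF P X] by (simp add: Y_def)
  have "emeasure lborel (Q \<inter> (\<lambda>\<xi>. P (\<xi> + \<eta>)) -` X)
      = emeasure lborel {\<xi>. \<eta> + \<xi> \<in> {x. x - \<eta> \<in> Q} \<inter> Y}"
    by (rule arg_cong[of _ _ "emeasure lborel"]) (auto simp: Y_def add.commute)
  also have "\<dots> = emeasure lborel ({x. x - \<eta> \<in> Q} \<inter> Y)"
    using fundamental_domain_translate[OF fdQ, of \<eta>] Y
    by (intro emeasure_lborel_translate) (auto simp: fundamental_domain_def)
  also have "\<dots> = emeasure lborel (Q \<inter> Y)"
    using per by (intro fundamental_domain_emeasure_eq[OF G fundamental_domain_translate[OF fdQ] fdQ Y])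
      (auto simp: Y_def G_def)
  finally show "emeasure (distr torus_measure borel (\<lambda>\<xi>. P (\<xi> + \<eta>))) X = emeasure (distr torus_measure borel P) X"
    by (simp add: emeas P Psh Y_def)
qed simp

lemma measurable_torus: "R \<in> borel_measurable borel \<Longrightarrow> R \<in> borel_measurable torus_measure"
  unfolding torus_measure_def by (intro measurable_restrict_space1) simp

lemma torus_integral_shift:
  fixes P :: "real ^ 'd \<Rightarrow> 'b::{banach,second_countable_topology}"
  assumes per: "\<And>\<xi> k. k \<in> int_lattice \<Longrightarrow> P (\<xi> + (2 * pi) *\<^sub>R k) = P \<xi>"
    and P: "P \<in> borel_measurable borel"
  shows "(LINT \<xi>|torus_measure. P (\<xi> + \<eta>)) = (LINT \<xi>|torus_measure. P \<xi>)"
    and "integrable torus_measure (\<lambda>\<xi>. P (\<xi> + \<eta>)) \<longleftrightarrow> integrable torus_measure P"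
proof -
  have Psh: "(\<lambda>\<xi>. P (\<xi> + \<eta>)) \<in> borel_measurable borel"
    by (rule measurable_compose[OF _ P]) simp
  have eq: "distr torus_measure borel (\<lambda>\<xi>. P (\<xi> + \<eta>)) = distr torus_measure borel P"
    by (rule distr_torus_shift[OF per P])
  have "(LINT \<xi>|torus_measure. P (\<xi> + \<eta>)) = (LINT y|distr torus_measure borel (\<lambda>\<xi>. P (\<xi> + \<eta>)). y)"
    using Psh by (intro integral_distr[symmetric]) (auto intro: measurable_torus)
  also have "\<dots> = (LINT \<xi>|torus_measure. P \<xi>)"
    unfolding eq using P by (intro integral_distr) (auto intro: measurable_torus)
  finally show "(LINT \<xi>|torus_measure. P (\<xi> + \<eta>)) = (LINT \<xi>|torus_measure. P \<xi>)" .
  have "integrable torus_measure (\<lambda>\<xi>. P (\<xi> + \<eta>)) \<longleftrightarrow> integrable (distr torus_measure borel (\<lambda>\<xi>. P (\<xi> + \<eta>))) (\<lambda>y. y)"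
    using Psh by (intro integrable_distr_eq[symmetric]) (auto intro: measurable_torus)
  also have "\<dots> \<longleftrightarrow> integrable torus_measure P"
    unfolding eq using P by (intro integrable_distr_eq) (auto intro: measurable_torus)
  finally show "integrable torus_measure (\<lambda>\<xi>. P (\<xi> + \<eta>)) \<longleftrightarrow> integrable torus_measure P" .
qed

lemma finite_measure_torus: "finite_measure (torus_measure :: (real ^ 'd) measure)"
  using emeasure_lborel_cbox_finite[of 0 "(\<chi> i. 2 * pi) :: real ^ 'd"] unfolding torus_measure_def
  by (intro finite_measureI) (simp add: emeasure_restrict_space space_restrict_space less_top)

lemma measure_torus: "measure (torus_measure :: (real ^ 'd) measure) (space torus_measure) = (2 * pi) ^ CARD('d)"
proof -
  have "emeasure (torus_measure :: (real ^ 'd) measure) (space torus_measure)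
      = emeasure lborel (cbox 0 ((\<chi> i. 2 * pi) :: real ^ 'd))"
    by (simp add: torus_measure_def emeasure_restrict_space space_restrict_space)
  also have "\<dots> = emeasure lborel (cube (2 * pi) :: (real ^ 'd) set)"
    using AE_cube_iff_cbox[of "2 * pi"] by (intro emeasure_eq_AE) (auto simp: cube_borel)
  also have "\<dots> = ennreal ((2 * pi) ^ CARD('d))"
    by (rule emeasure_cube) simp
  finally show ?thesis
    by (simp add: measure_def)
qed

definition torus_char :: "real ^ 'd \<Rightarrow> real ^ 'd \<Rightarrow> complex" where
  "torus_char k \<xi> = exp (- (\<i> * complex_of_real (\<xi> \<bullet> k)))"

lemma torus_char_measurable: "torus_char k \<in> borel_measurable borel"
  unfolding torus_char_def by (intro borel_measurable_continuous_onI continuous_intros)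

lemma norm_torus_char [simp]: "norm (torus_char k \<xi>) = 1"
  by (simp add: torus_char_def)

lemma torus_char_0 [simp]: "torus_char 0 \<xi> = 1"
  by (simp add: torus_char_def)

lemma torus_char_cnj: "cnj (torus_char k \<xi>) = torus_char (- k) \<xi>"
  by (simp add: torus_char_def exp_cnj)

lemma torus_char_mult: "torus_char k \<xi> * torus_char m \<xi> = torus_char (k + m) \<xi>"
  by (simp add: torus_char_def inner_add_right distrib_left flip: exp_add)

lemma torus_char_shift: "torus_char k (\<xi> + \<eta>) = torus_char k \<xi> * torus_char k \<eta>"
  by (simp add: torus_char_def inner_add_left distrib_left flip: exp_add)

lemma torus_char_2pi_Ints:
  assumes "\<eta> \<bullet> k = 2 * pi * of_int n"
  shows "torus_char k \<eta> = 1"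
  unfolding torus_char_def exp_eq_1 by (simp add: assms) (rule exI[of _ "- n"], simp)

lemma torus_char_periodic:
  assumes "k \<in> int_lattice" "m \<in> int_lattice"
  shows "torus_char k (\<xi> + (2 * pi) *\<^sub>R m) = torus_char k \<xi>"
proof -
  obtain n where "m \<bullet> k = of_int n"
    using int_lattice_inner[OF assms(2,1)] by (auto elim: Ints_cases)
  then have "torus_char k ((2 * pi) *\<^sub>R m) = 1"
    by (intro torus_char_2pi_Ints[of _ _ n]) simp
  then show ?thesis
    by (simp add: torus_char_shift)
qed

lemma torus_char_L2: "torus_char k \<in> L2_space torus_measure"
  using finite_measure.integrable_const[OF finite_measure_torus, of "1 :: real"]
  by (simp add: L2_space_def measurable_torus torus_char_measurable)

text \<open>For nonzero \<open>k\<close> there is a shift \<open>\<eta>\<close> with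
  \<open>\<eta> \<bullet> k = pi\<close>. It turns the character into its negative but preserves the
  integral, which is therefore 0; no iterated integration is involved.\<close>

lemma integral_torus_char:
  assumes k: "k \<in> int_lattice"
  shows "(LINT \<xi>|torus_measure. torus_char (k :: real ^ 'd) \<xi>)
    = (if k = 0 then complex_of_real ((2 * pi) ^ CARD('d)) else 0)"
proof (cases "k = 0")
  case True
  then show ?thesis
    by (simp add: measure_torus scaleR_conv_of_real)
next
  case False
  then obtain i where i: "k $ i \<noteq> 0"
    by (auto simp: vec_eq_iff)
  define \<eta> :: "real ^ 'd" where "\<eta> = axis i (pi / k $ i)"
  have "\<eta> \<bullet> k = pi"
    using i by (simp add: \<eta>_def inner_axis' )
  then have "torus_char k \<eta> = -1"
    by (simp add: torus_char_def exp_minus mult.commute[of \<i>])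
  then have "(LINT \<xi>|torus_measure. torus_char k (\<xi> + \<eta>)) = - (LINT \<xi>|torus_measure. torus_char k \<xi>)"
    by (simp add: torus_char_shift)
  moreover have "(LINT \<xi>|torus_measure. torus_char k (\<xi> + \<eta>)) = (LINT \<xi>|torus_measure. torus_char k \<xi>)"
    using k by (intro torus_integral_shift torus_char_measurable torus_char_periodic)
  ultimately show ?thesis
    using False by simp
qed

lemma torus_char_inner:
  assumes "k \<in> int_lattice" "m \<in> int_lattice"
  shows "L2_inner torus_measure (torus_char k) (torus_char (m :: real ^ 'd))
    = (if k = m then complex_of_real ((2 * pi) ^ CARD('d)) else 0)"
  using integral_torus_char[OF int_lattice_diff[OF assms]]
  by (simp add: L2_inner_def torus_char_cnj torus_char_mult)

lemma trig_series_sumD: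
  assumes "trig_series_sum c F"
  shows "\<And>\<xi> k. k \<in> int_lattice \<Longrightarrow> F (\<xi> + (2 * pi) *\<^sub>R k) = F \<xi>"
    and "L2_has_sum torus_measure (\<lambda>k \<xi>. c k * torus_char k \<xi>) int_lattice F"
    and "F \<in> L2_space torus_measure" "F \<in> borel_measurable borel"
proof -
  show per: "\<And>\<xi> k. k \<in> int_lattice \<Longrightarrow> F (\<xi> + (2 * pi) *\<^sub>R k) = F \<xi>"
    and sum: "L2_has_sum torus_measure (\<lambda>k \<xi>. c k * torus_char k \<xi>) int_lattice F"
    using assms by (simp_all add: trig_series_sum_def torus_char_def)
  show L2: "F \<in> L2_space torus_measure"
    using sum by (simp add: L2_has_sum_def)
  show "F \<in> borel_measurable borel"
    by (rule borel_measurable_periodic[OF per L2_spaceD(1)[OF L2]])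
qed

lemma L2_space_torus_char_mult:
  assumes "F \<in> L2_space torus_measure"
  shows "(\<lambda>\<xi>. torus_char k \<xi> * F \<xi>) \<in> L2_space torus_measure"
  using L2_spaceD[OF assms] measurable_torus[OF torus_char_measurable]
  by (auto simp: L2_space_def norm_mult intro: borel_measurable_times)

lemma trig_series_coeff:
  assumes F: "trig_series_sum c (F :: real ^ 'd \<Rightarrow> complex)" and m: "m \<in> int_lattice"
  shows "L2_inner torus_measure F (torus_char m) = complex_of_real ((2 * pi) ^ CARD('d)) * c m"
proof -
  have "((\<lambda>k. L2_inner torus_measure (\<lambda>\<xi>. c k * torus_char k \<xi>) (torus_char m))
      has_sum L2_inner torus_measure F (torus_char m)) int_lattice"
    by (rule L2_has_sum_inner[OF trig_series_sumD(2)[OF F] torus_char_L2])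
  moreover have "((\<lambda>k. L2_inner torus_measure (\<lambda>\<xi>. c k * torus_char k \<xi>) (torus_char m))
      has_sum complex_of_real ((2 * pi) ^ CARD('d)) * c m) int_lattice"
  proof (rule has_sum_cong_neutral[THEN iffD1])
    show "((\<lambda>k. complex_of_real ((2 * pi) ^ CARD('d)) * c m) has_sum
        complex_of_real ((2 * pi) ^ CARD('d)) * c m) {m}"
      by (rule has_sum_finiteI) auto
  qed (use m in \<open>auto simp: L2_inner_scale_left torus_char_inner\<close>)
  ultimately show ?thesis
    by (rule has_sum_unique)
qed

text \<open>Parseval's identity twisted by a character: multiplication by
  \<open>torus_char n\<close> moves the coefficients of \<open>G\<close> by \<open>n\<close>. The
  twist is what makes translates of packets accessible, since a translation by \<open>m\<close>
  moves filter indices by \<open>A *v m\<close>.\<close>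

lemma trig_series_Parseval:
  assumes F: "trig_series_sum c (F :: real ^ 'd \<Rightarrow> complex)" and G: "trig_series_sum d G"
    and n: "n \<in> int_lattice"
  shows "((\<lambda>k. complex_of_real ((2 * pi) ^ CARD('d)) * (c k * cnj (d (k - n)))) has_sum
    L2_inner torus_measure F (\<lambda>\<xi>. torus_char n \<xi> * G \<xi>)) int_lattice"
proof -
  have "((\<lambda>k. L2_inner torus_measure (\<lambda>\<xi>. c k * torus_char k \<xi>) (\<lambda>\<xi>. torus_char n \<xi> * G \<xi>))
      has_sum L2_inner torus_measure F (\<lambda>\<xi>. torus_char n \<xi> * G \<xi>)) int_lattice"
    by (rule L2_has_sum_inner[OF trig_series_sumD(2)[OF F] L2_space_torus_char_mult[OF trig_series_sumD(3)[OF G]]])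
  moreover have "L2_inner torus_measure (\<lambda>\<xi>. c k * torus_char k \<xi>) (\<lambda>\<xi>. torus_char n \<xi> * G \<xi>)
      = complex_of_real ((2 * pi) ^ CARD('d)) * (c k * cnj (d (k - n)))" if k: "k \<in> int_lattice" for k
  proof -
    have "L2_inner torus_measure (torus_char k) (\<lambda>\<xi>. torus_char n \<xi> * G \<xi>)
        = L2_inner torus_measure (torus_char (k - n)) G"
      unfolding L2_inner_def
      by (simp add: torus_char_cnj mult.assoc[symmetric] torus_char_mult)
    also have "\<dots> = cnj (complex_of_real ((2 * pi) ^ CARD('d)) * d (k - n))"
      using trig_series_coeff[OF G int_lattice_diff[OF k n]] by (subst L2_inner_commute) simp
    finally show ?thesis
      by (simp add: L2_inner_scale_left)
  qed
  ultimately show ?thesis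
    by (simp cong: has_sum_cong)
qed

section \<open>Filters, dilations and translations\<close>

text \<open>The sum over \<open>j\<close> and \<open>k\<close> becomes the torus integral of a
  conjugated character times the entry (\<open>l\<close>, \<open>l'\<close>) of \<open>H r\<close>
  times the conjugate transpose of \<open>H s\<close>. Averaging over the shifts given by the digits
  preserves the integral and leaves the character alone, while the filter condition evaluates the
  averaged entry. What remains is the integral of a character, which vanishes unless
  \<open>m = 0\<close>.\<close>

lemma filter_orthonormality:
  fixes A :: "real ^ 'd ^ 'd" and h :: "nat \<Rightarrow> 'l::finite \<Rightarrow> 'l \<Rightarrow> real ^ 'd \<Rightarrow> complex"
  assumes det: "det A \<noteq> 0" and lat: "\<And>k. k \<in> int_lattice \<Longrightarrow> A *v k \<in> int_lattice"
    and a: "real a = \<bar>det A\<bar>" and K: "digit_set (transpose A) K"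
    and mf: "multiwavelet_filters A a K \<phi> h"
    and r: "r < a" and s: "s < a" and m: "m \<in> int_lattice"
  obtains b where "\<And>j. ((\<lambda>k. h r l j k * cnj (h s l' j (k - A *v m))) has_sum b j) int_lattice"
    and "(\<Sum>j\<in>UNIV. b j) = (if r = s \<and> l = l' \<and> m = 0 then 1 else 0)"
proof -
  obtain H :: "nat \<Rightarrow> real ^ 'd \<Rightarrow> complex ^ 'l ^ 'l" where
    trig: "\<And>r l j. r < a \<Longrightarrow> trig_series_sum
           (\<lambda>k. complex_of_real (1 / sqrt (real a)) * h r l j k) (\<lambda>\<xi>. H r \<xi> $ l $ j)"
    and unit: "\<And>r s. r < a \<Longrightarrow> s < a \<Longrightarrow> AE \<xi> in lborel.
           (\<Sum>\<mu>\<in>K. H r (\<xi> + (2 * pi) *\<^sub>R (matrix_inv (transpose A) *v \<mu>)) **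
              conj_transpose (H s (\<xi> + (2 * pi) *\<^sub>R (matrix_inv (transpose A) *v \<mu>))))
           = (if r = s then mat 1 else 0)"
    using mf unfolding multiwavelet_filters_def by blast
  define C where "C = complex_of_real ((2 * pi) ^ CARD('d))"
  have C: "C \<noteq> 0"
    by (simp add: C_def)
  have a_pos: "0 < real a"
    using a det by simp
  have n: "A *v m \<in> int_lattice"
    using lat m by simp
  have detT: "det (transpose A) \<noteq> 0"
    using det by (simp add: det_transpose)
  have K_fin: "finite K" and K_card: "real (card K) = real a"
    using digit_set_card[OF detT int_lattice_transpose[OF lat] K] a by (simp_all add: det_transpose)
  have K_lat: "K \<subseteq> int_lattice"
    using K by (simp add: digit_set_def)
  define I where "I j = L2_inner torus_measure (\<lambda>\<xi>. H r \<xi> $ l $ j) (\<lambda>\<xi>. torus_char (A *v m) \<xi> * H s \<xi> $ l' $ j)"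
    for j
  have slice: "((\<lambda>k. h r l j k * cnj (h s l' j (k - A *v m))) has_sum (of_nat a / C) * I j) int_lattice" for j
  proof -
    have sq: "complex_of_real (sqrt (real a)) * complex_of_real (sqrt (real a)) = of_nat a"
      using a_pos by (simp flip: of_real_mult)
    \<comment> \<open>The factor \<open>a / C\<close> removes the two normalisations
      \<open>1 / sqrt a\<close> of the filter series and the volume \<open>C\<close> of the
      torus.\<close>
    have "(of_nat a / C) * (C * ((complex_of_real (1 / sqrt (real a)) * x) *
        cnj (complex_of_real (1 / sqrt (real a)) * y))) = x * cnj y" for x y
      using C a_pos by (simp add: sq[symmetric])
    then show ?thesis
      using has_sum_cmult_right[OF trig_series_Parseval[OF trig[OF r, of l j] trig[OF s, of l' j] n], of "of_nat a / C"]
      by (simp only: C_def[symmetric] I_def)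
  qed
  define P where "P \<xi> = (\<Sum>j\<in>UNIV. H r \<xi> $ l $ j * cnj (torus_char (A *v m) \<xi> * H s \<xi> $ l' $ j))" for \<xi>
  have P_eq: "P \<xi> = cnj (torus_char (A *v m) \<xi>) * (H r \<xi> ** conj_transpose (H s \<xi>)) $ l $ l'" for \<xi>
    by (simp add: P_def matrix_matrix_mult_def conj_transpose_def sum_distrib_left mult_ac)
  have int_term: "integrable torus_measure (\<lambda>\<xi>. H r \<xi> $ l $ j * cnj (torus_char (A *v m) \<xi> * H s \<xi> $ l' $ j))" for j
    by (rule L2_inner_integrable[OF trig_series_sumD(3)[OF trig[OF r]]
          L2_space_torus_char_mult[OF trig_series_sumD(3)[OF trig[OF s]]]])
  have P_int: "integrable torus_measure P"
    unfolding P_def by (intro Bochner_Integration.integrable_sum int_term)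
  have I_sum: "(\<Sum>j\<in>UNIV. I j) = (LINT \<xi>|torus_measure. P \<xi>)"
    unfolding P_def I_def L2_inner_def
    by (rule Bochner_Integration.integral_sum[symmetric]) (rule int_term)
  have P_meas: "P \<in> borel_measurable borel"
  proof -
    have "(\<lambda>\<xi>. cnj (torus_char (A *v m) \<xi> * H s \<xi> $ l' $ j)) \<in> borel_measurable borel" for j
      by (rule measurable_compose[OF borel_measurable_times[OF torus_char_measurable trig_series_sumD(4)[OF trig[OF s]]]])
        (intro borel_measurable_continuous_onI continuous_on_cnj continuous_on_id)
    then show ?thesis
      unfolding P_def
      by (intro borel_measurable_sum borel_measurable_times trig_series_sumD(4)[OF trig[OF r]])
  qed
  have P_per: "P (\<xi> + (2 * pi) *\<^sub>R k) = P \<xi>" if "k \<in> int_lattice" for \<xi> k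
    unfolding P_def
    by (simp add: trig_series_sumD(1)[OF trig[OF r] that] trig_series_sumD(1)[OF trig[OF s] that]
        torus_char_periodic[OF n that])
  define \<eta> where "\<eta> \<mu> = (2 * pi) *\<^sub>R (matrix_inv (transpose A) *v \<mu>)" for \<mu>
  \<comment> \<open>The choice of \<open>transpose A\<close> in the shifts enters here: moving
    \<open>A\<close> across the inner product cancels the inverse and leaves \<open>2 * pi\<close>
    times the integer \<open>\<mu> \<bullet> m\<close>.\<close>
  have char_\<eta>: "torus_char (A *v m) (\<xi> + \<eta> \<mu>) = torus_char (A *v m) \<xi>" if "\<mu> \<in> K" for \<xi> \<mu>
  proof -
    have "\<eta> \<mu> \<bullet> (A *v m) = 2 * pi * ((matrix_inv (transpose A) *v \<mu>) \<bullet> (A *v m))"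
      by (simp add: \<eta>_def)
    also have "(matrix_inv (transpose A) *v \<mu>) \<bullet> (A *v m)
        = (transpose A *v (matrix_inv (transpose A) *v \<mu>)) \<bullet> m"
      by (simp add: dot_lmul_matrix[symmetric] transpose_matrix_vector)
    also have "\<dots> = \<mu> \<bullet> m"
      by (simp only: matrix_inv_cancel(3)[OF detT])
    finally have "\<eta> \<mu> \<bullet> (A *v m) = 2 * pi * (\<mu> \<bullet> m)" .
    moreover have "\<mu> \<bullet> m \<in> \<int>"
      by (rule int_lattice_inner[OF subsetD[OF K_lat that] m])
    then obtain z where "\<mu> \<bullet> m = of_int z"
      by (rule Ints_cases)
    ultimately have "torus_char (A *v m) (\<eta> \<mu>) = 1"
      by (intro torus_char_2pi_Ints[of _ _ z]) simp
    then show ?thesis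
      by (simp add: torus_char_shift)
  qed
  define \<delta> :: complex where "\<delta> = (if r = s \<and> l = l' then 1 else 0)"
  \<comment> \<open>Each of the \<open>a\<close> shifted integrals equals the unshifted one.\<close>
  have "of_nat a * (LINT \<xi>|torus_measure. P \<xi>) = (\<Sum>\<mu>\<in>K. LINT \<xi>|torus_measure. P (\<xi> + \<eta> \<mu>))"
  proof -
    have "of_nat (card K) = (of_nat a :: complex)"
      using K_card by (metis of_real_of_nat_eq)
    then show ?thesis
      by (simp add: torus_integral_shift[OF P_per P_meas])
  qed
  also have "\<dots> = (LINT \<xi>|torus_measure. (\<Sum>\<mu>\<in>K. P (\<xi> + \<eta> \<mu>)))"
    using P_int by (intro Bochner_Integration.integral_sum[symmetric]) (simp add: torus_integral_shift[OF P_per P_meas])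
  also have "\<dots> = (LINT \<xi>|torus_measure. torus_char (- (A *v m)) \<xi> * \<delta>)"
  proof (rule integral_cong_AE)
    have "(\<lambda>\<xi>. P (\<xi> + \<eta> \<mu>)) \<in> borel_measurable borel" for \<mu>
      by (rule measurable_compose[OF _ P_meas]) simp
    then show "(\<lambda>\<xi>. \<Sum>\<mu>\<in>K. P (\<xi> + \<eta> \<mu>)) \<in> borel_measurable torus_measure"
      by (intro measurable_torus borel_measurable_sum)
    show "(\<lambda>\<xi>. torus_char (- (A *v m)) \<xi> * \<delta>) \<in> borel_measurable torus_measure"
      by (intro measurable_torus borel_measurable_times torus_char_measurable borel_measurable_const)
    have "AE \<xi> in lborel. (\<Sum>\<mu>\<in>K. P (\<xi> + \<eta> \<mu>)) = torus_char (- (A *v m)) \<xi> * \<delta>"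
      using unit[OF r s]
    proof (rule AE_mp, intro AE_I2 impI)
      fix \<xi>
      assume u: "(\<Sum>\<mu>\<in>K. H r (\<xi> + (2 * pi) *\<^sub>R (matrix_inv (transpose A) *v \<mu>)) **
              conj_transpose (H s (\<xi> + (2 * pi) *\<^sub>R (matrix_inv (transpose A) *v \<mu>))))
           = (if r = s then mat 1 else 0)"
      have "(\<Sum>\<mu>\<in>K. P (\<xi> + \<eta> \<mu>)) = cnj (torus_char (A *v m) \<xi>) *
          (\<Sum>\<mu>\<in>K. H r (\<xi> + \<eta> \<mu>) ** conj_transpose (H s (\<xi> + \<eta> \<mu>))) $ l $ l'"
        by (simp add: P_eq char_\<eta> sum_distrib_left)
      also have "(\<Sum>\<mu>\<in>K. H r (\<xi> + \<eta> \<mu>) ** conj_transpose (H s (\<xi> + \<eta> \<mu>))) $ l $ l' = \<delta>"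
        unfolding \<eta>_def u by (simp add: \<delta>_def mat_def)
      finally show "(\<Sum>\<mu>\<in>K. P (\<xi> + \<eta> \<mu>)) = torus_char (- (A *v m)) \<xi> * \<delta>"
        by (simp add: torus_char_cnj)
    qed
    then show "AE \<xi> in torus_measure. (\<Sum>\<mu>\<in>K. P (\<xi> + \<eta> \<mu>)) = torus_char (- (A *v m)) \<xi> * \<delta>"
      unfolding torus_measure_def by (subst AE_restrict_space_iff) auto
  qed
  also have "\<dots> = (if A *v m = 0 then C else 0) * \<delta>"
    using integral_torus_char[OF int_lattice_minus[OF n]] by (simp add: C_def)
  also have "A *v m = 0 \<longleftrightarrow> m = 0"
    by (metis matrix_inv_cancel(4)[OF det] matrix_vector_mult_0_right)
  finally have "of_nat a * (\<Sum>j\<in>UNIV. I j) = (if m = 0 then C else 0) * \<delta>"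
    by (simp only: I_sum)
  moreover have "(\<Sum>j\<in>UNIV. (of_nat a / C) * I j) = of_nat a * (\<Sum>j\<in>UNIV. I j) / C"
    by (simp add: sum_distrib_left sum_divide_distrib)
  ultimately have "(\<Sum>j\<in>UNIV. (of_nat a / C) * I j) = (if r = s \<and> l = l' \<and> m = 0 then 1 else 0)"
    using C by (simp only: \<delta>_def) simp
  with slice show thesis
    by (rule that)
qed

section \<open>Dilations and translations as isometries\<close>

definition dilate :: "real ^ 'd ^ 'd \<Rightarrow> (real ^ 'd \<Rightarrow> complex) \<Rightarrow> real ^ 'd \<Rightarrow> complex" where
  "dilate A g = (\<lambda>x. complex_of_real (sqrt \<bar>det A\<bar>) * g (A *v x))"

definition translates :: "('l \<Rightarrow> real ^ 'd \<Rightarrow> complex) \<Rightarrow> 'l \<times> (real ^ 'd) \<Rightarrow> real ^ 'd \<Rightarrow> complex" where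
  "translates g = (\<lambda>(l, k) x. g l (x - k))"

lemma L2_space_translate:
  fixes g :: "real ^ 'd \<Rightarrow> complex"
  assumes g: "g \<in> L2_space lborel"
  shows "(\<lambda>x. g (x - k)) \<in> L2_space lborel"
proof -
  have gb: "g \<in> borel_measurable borel"
    using L2_spaceD(1)[OF g] by simp
  have "(\<lambda>x. g (x - k)) \<in> borel_measurable borel"
    by (rule measurable_compose[OF _ gb]) simp
  moreover have "(\<lambda>x. (norm (g x))\<^sup>2) \<in> borel_measurable borel"
    using gb by simp
  from lborel_integral_translate(2)[OF this, of k]
  have "integrable lborel (\<lambda>x. (norm (g (x - k)))\<^sup>2)"
    using L2_spaceD(2)[OF g] by simp
  ultimately show ?thesis
    by (simp add: L2_space_def)
qed

lemma L2_inner_translate: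
  fixes f g :: "real ^ 'd \<Rightarrow> complex"
  assumes "f \<in> L2_space lborel" "g \<in> L2_space lborel"
  shows "L2_inner lborel (\<lambda>x. f (x - k)) (\<lambda>x. g (x - k)) = L2_inner lborel f g"
  using borel_measurable_integrable[OF L2_inner_integrable[OF assms]]
  unfolding L2_inner_def by (intro lborel_integral_translate(1)) simp

lemma L2_inner_translate2:
  fixes f g :: "real ^ 'd \<Rightarrow> complex"
  assumes "f \<in> L2_space lborel" "g \<in> L2_space lborel"
  shows "L2_inner lborel (\<lambda>x. f (x - k)) (\<lambda>x. g (x - m)) = L2_inner lborel f (\<lambda>x. g (x - (m - k)))"
  using L2_inner_translate[OF assms(1) L2_space_translate[OF assms(2)], of k "m - k"]
  by (simp add: algebra_simps)

lemma dilate_L2: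
  assumes det: "det A \<noteq> 0" and g: "g \<in> L2_space lborel"
  shows "dilate A g \<in> L2_space lborel"
proof -
  have gb: "g \<in> borel_measurable borel"
    using L2_spaceD(1)[OF g] by simp
  have "(\<lambda>x. g (A *v x)) \<in> borel_measurable borel"
    by (rule measurable_compose[OF measurable_matrix_vector_mult gb])
  moreover have "(\<lambda>x. (norm (g x))\<^sup>2) \<in> borel_measurable borel"
    using gb by simp
  from lborel_integral_matrix(2)[OF det this]
  have "integrable lborel (\<lambda>x. (norm (g (A *v x)))\<^sup>2)"
    using L2_spaceD(2)[OF g] by simp
  ultimately have "(\<lambda>x. g (A *v x)) \<in> L2_space lborel"
    by (simp add: L2_space_def)
  then show ?thesis
    unfolding dilate_def by (rule L2_space_scale)
qed

lemma dilate_inner: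
  assumes det: "det A \<noteq> 0" and f: "f \<in> L2_space lborel" and g: "g \<in> L2_space lborel"
  shows "L2_inner lborel (dilate A f) (dilate A g) = L2_inner lborel f g"
proof -
  have "L2_inner lborel (dilate A f) (dilate A g)
      = complex_of_real \<bar>det A\<bar> * L2_inner lborel (\<lambda>x. f (A *v x)) (\<lambda>x. g (A *v x))"
    unfolding dilate_def L2_inner_scale_left L2_inner_scale_right
    by (simp add: mult.assoc[symmetric] flip: of_real_mult)
  also have "L2_inner lborel (\<lambda>x. f (A *v x)) (\<lambda>x. g (A *v x))
      = (1 / \<bar>det A\<bar>) *\<^sub>R L2_inner lborel f g"
    using borel_measurable_integrable[OF L2_inner_integrable[OF f g]]
    unfolding L2_inner_def by (intro lborel_integral_matrix(1)[OF det]) simp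
  finally show ?thesis
    using det by (simp add: scaleR_conv_of_real)
qed

lemma dilate_norm:
  assumes "det A \<noteq> 0" "f \<in> L2_space lborel"
  shows "L2_norm lborel (dilate A f) = L2_norm lborel f"
  using dilate_inner[OF assms assms(2)]
  by (metis L2_norm_nonneg L2_norm_power2_Re power2_eq_imp_eq)

lemma dilate_span:
  assumes det: "det A \<noteq> 0" and e: "\<And>i. i \<in> I \<Longrightarrow> e i \<in> L2_space lborel"
    and F: "F \<in> L2_span lborel e I"
  shows "dilate A F \<in> L2_span lborel (\<lambda>i. dilate A (e i)) I"
proof (rule L2_spanI[OF dilate_L2[OF det L2_spanD[OF F]]])
  fix \<epsilon> :: real assume "0 < \<epsilon>"
  then obtain X c where X: "finite X" "X \<subseteq> I" "L2_norm lborel (\<lambda>x. F x - (\<Sum>i\<in>X. c i * e i x)) < \<epsilon>"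
    by (rule L2_spanE[OF F])
  have "(\<lambda>x. dilate A F x - (\<Sum>i\<in>X. c i * dilate A (e i) x))
      = dilate A (\<lambda>x. F x - (\<Sum>i\<in>X. c i * e i x))"
    by (simp add: dilate_def right_diff_distrib sum_distrib_left mult_ac)
  moreover have "(\<lambda>x. F x - (\<Sum>i\<in>X. c i * e i x)) \<in> L2_space lborel"
    using e X(2) by (intro L2_space_diff L2_space_lincomb L2_spanD[OF F]) auto
  ultimately have "L2_norm lborel (\<lambda>x. dilate A F x - (\<Sum>i\<in>X. c i * dilate A (e i) x)) < \<epsilon>"
    using X(3) by (simp add: dilate_norm[OF det])
  then show "\<exists>X c. finite X \<and> X \<subseteq> I \<and> L2_norm lborel (\<lambda>x. dilate A F x - (\<Sum>i\<in>X. c i * dilate A (e i) x)) < \<epsilon>"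
    using X(1,2) by (intro exI[of _ X] exI[of _ c]) simp
qed

lemma translate_norm:
  fixes f :: "real ^ 'd \<Rightarrow> complex"
  assumes "f \<in> L2_space lborel"
  shows "L2_norm lborel (\<lambda>x. f (x - k)) = L2_norm lborel f"
  using L2_inner_translate[OF assms assms, of k]
  by (metis L2_norm_nonneg L2_norm_power2_Re power2_eq_imp_eq)

lemma translate_span:
  fixes F :: "real ^ 'd \<Rightarrow> complex"
  assumes e: "\<And>i. i \<in> I \<Longrightarrow> e i \<in> L2_space lborel" and F: "F \<in> L2_span lborel e I"
  shows "(\<lambda>x. F (x - k)) \<in> L2_span lborel (\<lambda>i x. e i (x - k)) I"
proof (rule L2_spanI[OF L2_space_translate[OF L2_spanD[OF F]]])
  fix \<epsilon> :: real assume "0 < \<epsilon>"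
  then obtain X c where X: "finite X" "X \<subseteq> I" "L2_norm lborel (\<lambda>x. F x - (\<Sum>i\<in>X. c i * e i x)) < \<epsilon>"
    by (rule L2_spanE[OF F])
  have "(\<lambda>x. F x - (\<Sum>i\<in>X. c i * e i x)) \<in> L2_space lborel"
    using e X(2) by (intro L2_space_diff L2_space_lincomb L2_spanD[OF F]) auto
  from translate_norm[OF this, of k]
  have "L2_norm lborel (\<lambda>x. F (x - k) - (\<Sum>i\<in>X. c i * e i (x - k))) < \<epsilon>"
    using X(3) by simp
  then show "\<exists>X c. finite X \<and> X \<subseteq> I \<and> L2_norm lborel (\<lambda>x. F (x - k) - (\<Sum>i\<in>X. c i * e i (x - k))) < \<epsilon>"
    using X(1,2) by (intro exI[of _ X] exI[of _ c]) simp
qed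

lemma orthonormal_coeff:
  assumes F: "L2_has_sum M (\<lambda>i x. c i * e i x) I F" and on: "orthonormal_family M e I" and i: "i \<in> I"
  shows "L2_inner M F (e i) = c i"
proof -
  have "((\<lambda>i'. L2_inner M (\<lambda>x. c i' * e i' x) (e i)) has_sum L2_inner M F (e i)) I"
    using on i by (intro L2_has_sum_inner[OF F]) (simp add: orthonormal_family_def)
  moreover have "((\<lambda>i'. L2_inner M (\<lambda>x. c i' * e i' x) (e i)) has_sum c i) I"
  proof (rule has_sum_cong_neutral[THEN iffD1])
    show "((\<lambda>_. c i) has_sum c i) {i}"
      by (rule has_sum_finiteI) auto
  qed (use on i in \<open>auto simp: L2_inner_scale_left orthonormal_family_def\<close>)
  ultimately show ?thesis
    by (rule has_sum_unique)
qed

section \<open>The splitting of a dilated space\<close>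

locale multiwavelet_packets =
  fixes A :: "real ^ 'd ^ 'd"
    and a :: nat
    and V :: "int \<Rightarrow> (real ^ 'd \<Rightarrow> complex) set"
    and \<phi> :: "'l::finite \<Rightarrow> real ^ 'd \<Rightarrow> complex"
    and K :: "(real ^ 'd) set"
    and h :: "nat \<Rightarrow> 'l \<Rightarrow> 'l \<Rightarrow> real ^ 'd \<Rightarrow> complex"
    and f :: "nat \<Rightarrow> 'l \<Rightarrow> real ^ 'd \<Rightarrow> complex"
  assumes dilation: "dilation_matrix A"
    and a_det: "real a = \<bar>det A\<bar>"
    and mra: "mra A V \<phi>"
    and digits: "digit_set (transpose A) K"
    and filters: "multiwavelet_filters A a K \<phi> h"
    and packets: "basic_multiwavelet_packets A a \<phi> h f"
begin

abbreviation idx :: "('l \<times> (real ^ 'd)) set" where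
  "idx \<equiv> UNIV \<times> int_lattice"

lemma det: "det A \<noteq> 0"
  by (rule dilation_matrix_det_nz[OF dilation])

lemma lat: "k \<in> int_lattice \<Longrightarrow> A *v k \<in> int_lattice"
  using dilation by (simp add: dilation_matrix_def)

lemma a_pos: "0 < a"
  using a_det det by (metis abs_le_zero_iff gr0I of_nat_0 order_refl)

lemma orthonormal_dilate:
  assumes "orthonormal_family lborel e I"
  shows "orthonormal_family lborel (\<lambda>i. dilate A (e i)) I"
  using assms by (simp add: orthonormal_family_def dilate_L2[OF det] dilate_inner[OF det])

text \<open>A translation by \<open>m\<close> after the dilation is a translation by
  \<open>A *v m\<close> before it. This is the source of all indices \<open>k - A *v m\<close>
  below.\<close>

lemma dilate_translates_shift:
  "(\<lambda>x. dilate A (translates g (j, k)) (x - m)) = dilate A (translates g (j, k + A *v m))"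
  by (simp add: dilate_def translates_def matrix_vector_mult_diff_distrib algebra_simps)

lemma refines_L2_has_sum:
  assumes "refines A a c g u"
  shows "L2_has_sum lborel (\<lambda>i x. c l (fst i) (snd i) * dilate A (translates g i) x) idx (u l)"
proof -
  have eq: "(\<lambda>(j, k) x. c l j k * complex_of_real (sqrt (real a)) * g j (A *v x - k))
      = (\<lambda>i x. c l (fst i) (snd i) * dilate A (translates g i) x)"
    by (auto simp: fun_eq_iff dilate_def translates_def a_det)
  have "L2_has_sum lborel (\<lambda>(j, k) x. c l j k * complex_of_real (sqrt (real a)) * g j (A *v x - k)) idx (u l)"
    using assms by (simp add: refines_def)
  then show ?thesis
    by (simp only: eq)
qed

lemma refines_L2:
  fixes u :: "'l \<Rightarrow> real ^ 'd \<Rightarrow> complex"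
  assumes "refines A a c g u"
  shows "u l \<in> L2_space lborel"
  using refines_L2_has_sum[OF assms, of l] by (simp add: L2_has_sum_def)

text \<open>For \<open>m = 0\<close> this is the refinement equation itself; other translates follow
  because integer translations map the dilated system into itself.\<close>

lemma refines_in_span:
  assumes g: "\<And>i. i \<in> idx \<Longrightarrow> translates g i \<in> L2_space lborel"
    and ref: "refines A a c g u" and i: "i \<in> idx"
  shows "translates u i \<in> L2_span lborel (\<lambda>i. dilate A (translates g i)) idx"
proof -
  obtain l m where lm: "i = (l, m)" "m \<in> int_lattice"
    using i by auto
  define e where "e = (\<lambda>i. dilate A (translates g i))"
  have e: "\<And>i. i \<in> idx \<Longrightarrow> e i \<in> L2_space lborel"
    using g by (simp add: e_def dilate_L2[OF det])
  have ul: "u l \<in> L2_span lborel e idx"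
    unfolding e_def by (rule L2_has_sum_in_span[OF refines_L2_has_sum[OF ref]])
  have "(\<lambda>x. u l (x - m)) \<in> L2_span lborel (\<lambda>i x. e i (x - m)) idx"
    by (rule translate_span[OF e ul])
  also have "L2_span lborel (\<lambda>i x. e i (x - m)) idx \<subseteq> L2_span lborel e idx"
  proof (rule L2_span_subset[OF e])
    fix i assume "i \<in> idx"
    then obtain j k where jk: "i = (j, k)" "k \<in> int_lattice"
      by auto
    then have "(j, k + A *v m) \<in> idx"
      using lm(2) lat by (simp add: int_lattice_add)
    then have "e (j, k + A *v m) \<in> L2_span lborel e idx"
      using e by (intro L2_span_base)
    then show "(\<lambda>x. e i (x - m)) \<in> L2_span lborel e idx"
      unfolding jk(1) e_def dilate_translates_shift .
  qed
  finally show ?thesis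
    by (simp add: e_def lm(1) translates_def)
qed

text \<open>The diagonal case \<open>m = 0\<close> of \<open>filter_orthonormality\<close>,
  rewritten in real numbers: each row of filter coefficients has norm 1.\<close>

lemma filter_norm:
  assumes s: "s < a"
  shows "(\<lambda>k. (norm (h s l j k))\<^sup>2) summable_on int_lattice"
    and "(\<Sum>j\<in>UNIV. \<Sum>\<^sub>\<infinity>k\<in>int_lattice. (norm (h s l j k))\<^sup>2) = 1"
proof -
  show summ: "(\<lambda>k. (norm (h s l j k))\<^sup>2) summable_on int_lattice" for j
    using filters s by (simp add: multiwavelet_filters_def)
  obtain b where b: "\<And>j. ((\<lambda>k. h s l j k * cnj (h s l j (k - A *v 0))) has_sum b j) int_lattice"
    and b_sum: "(\<Sum>j\<in>UNIV. b j) = (if s = s \<and> l = l \<and> (0 :: real ^ 'd) = 0 then 1 else 0)"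
    by (rule filter_orthonormality[OF det lat a_det digits filters s s, of 0 l l]) auto
  have "b j = complex_of_real (\<Sum>\<^sub>\<infinity>k\<in>int_lattice. (norm (h s l j k))\<^sup>2)" for j
  proof (rule has_sum_unique[OF b])
    show "((\<lambda>k. h s l j k * cnj (h s l j (k - A *v 0))) has_sum
        complex_of_real (\<Sum>\<^sub>\<infinity>k\<in>int_lattice. (norm (h s l j k))\<^sup>2)) int_lattice"
      using has_sum_of_real[OF has_sum_infsum[OF summ[of j]], where 'a = complex]
      by (simp add: complex_norm_square del: of_real_power)
  qed
  then have "complex_of_real (\<Sum>j\<in>UNIV. \<Sum>\<^sub>\<infinity>k\<in>int_lattice. (norm (h s l j k))\<^sup>2) = 1"
    using b_sum by simp
  then show "(\<Sum>j\<in>UNIV. \<Sum>\<^sub>\<infinity>k\<in>int_lattice. (norm (h s l j k))\<^sup>2) = 1"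
    by (metis of_real_eq_1_iff)
qed

text \<open>Division with remainder in the lattice. The sign is chosen to match the index
  \<open>k - A *v m\<close> of the filter coefficients, so a sum over the lattice splits into sums
  over \<open>m\<close> with \<open>k\<close> in a digit set.\<close>

lemma bij_digits:
  assumes D: "digit_set A D"
  shows "bij_betw (\<lambda>(k, m). k - A *v m) (D \<times> int_lattice) int_lattice"
proof -
  have D_lat: "D \<subseteq> int_lattice"
    and ex1: "\<And>x. x \<in> int_lattice \<Longrightarrow> \<exists>!\<mu>. \<mu> \<in> D \<and> x - \<mu> \<in> (*v) A ` int_lattice"
    using D by (auto simp: digit_set_def)
  have neg: "- (A *v m) = A *v (- m)" for m
    by (simp add: vec_eq_iff matrix_vector_mult_def sum_negf)
  show ?thesis
    unfolding bij_betw_def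
  proof (intro conjI)
    show "inj_on (\<lambda>(k, m). k - A *v m) (D \<times> int_lattice)"
    proof (rule inj_onI, clarify)
      fix k m k' m' assume k: "k \<in> D" "m \<in> int_lattice" and k': "k' \<in> D" "m' \<in> int_lattice"
        and eq: "k - A *v m = k' - A *v m'"
      have x: "k - A *v m \<in> int_lattice"
        using k D_lat lat by (auto intro: int_lattice_diff)
      have "k - A *v m - k = A *v (- m)"
        by (simp add: neg[symmetric])
      then have 1: "k - A *v m - k \<in> (*v) A ` int_lattice"
        using int_lattice_minus[OF k(2)] by (rule image_eqI)
      have "k - A *v m - k' = A *v (- m')"
        by (simp add: eq neg[symmetric])
      then have 2: "k - A *v m - k' \<in> (*v) A ` int_lattice"
        using int_lattice_minus[OF k'(2)] by (rule image_eqI)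
      have kk: "k = k'"
        using ex1[OF x] 1 2 k(1) k'(1) by blast
      with eq have "A *v m = A *v m'"
        by simp
      then have "m = m'"
        by (metis matrix_inv_cancel(4)[OF det])
      with kk show "k = k' \<and> m = m'"
        by simp
    qed
    show "(\<lambda>(k, m). k - A *v m) ` (D \<times> int_lattice) = int_lattice"
    proof
      show "(\<lambda>(k, m). k - A *v m) ` (D \<times> int_lattice) \<subseteq> int_lattice"
        using D_lat lat by (auto intro!: int_lattice_diff)
      show "int_lattice \<subseteq> (\<lambda>(k, m). k - A *v m) ` (D \<times> int_lattice)"
      proof
        fix x :: "real ^ 'd" assume "x \<in> int_lattice"
        then obtain \<mu> m where \<mu>: "\<mu> \<in> D" "m \<in> int_lattice" "x - \<mu> = A *v m"
          using ex1 by blast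
        then have "x = \<mu> - A *v (- m)"
          by (simp add: neg[symmetric] algebra_simps)
        then show "x \<in> (\<lambda>(k, m). k - A *v m) ` (D \<times> int_lattice)"
          using \<mu>(1) int_lattice_minus[OF \<mu>(2)] by (intro image_eqI[of _ _ "(\<mu>, - m)"]) auto
      qed
    qed
  qed
qed

text \<open>Used with \<open>g = f r\<close> and \<open>u s = f (s + a * r)\<close>. Only the system
  of \<open>g\<close> has to be orthonormal already, so the lemma can serve inside the induction
  that establishes orthonormality of the packets.\<close>

lemma split_orthonormal:
  assumes on: "orthonormal_family lborel (translates g) idx"
    and ref: "\<And>s. s < a \<Longrightarrow> refines A a (h s) g (u s)"
  shows "orthonormal_family lborel (\<lambda>(s, i). translates (u s) i) ({..<a} \<times> idx)" (is ?ON)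
    and "\<And>i. i \<in> idx \<Longrightarrow> dilate A (translates g i) \<in> L2_span lborel (\<lambda>(s, i). translates (u s) i) ({..<a} \<times> idx)"
proof -
  define e where "e = (\<lambda>i. dilate A (translates g i))"
  have e_on: "orthonormal_family lborel e idx"
    unfolding e_def by (rule orthonormal_dilate[OF on])
  have e_L2: "\<And>i. i \<in> idx \<Longrightarrow> e i \<in> L2_space lborel"
    by (rule orthonormal_family_L2[OF e_on])
  have u_L2: "u s l \<in> L2_space lborel" if "s < a" for s l
    by (rule refines_L2[OF ref[OF that]])
  have tu_L2: "translates (u s) (l, m) \<in> L2_space lborel" if "s < a" for s l m
    using L2_space_translate[OF u_L2[OF that]] by (simp add: translates_def)
  have hsum: "L2_has_sum lborel (\<lambda>i x. h s l (fst i) (snd i) * e i x) idx (u s l)" if "s < a" for s l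
    unfolding e_def by (rule refines_L2_has_sum[OF ref[OF that]])
  have coeff0: "L2_inner lborel (u s l) (e (j, k)) = h s l j k"
    if "s < a" "k \<in> int_lattice" for s l j k
    using orthonormal_coeff[OF hsum[OF that(1)] e_on, of "(j, k)"] that(2) by simp
  \<comment> \<open>Translating both arguments back by \<open>m\<close> reduces the coefficient to
    the untranslated one, at the cost of replacing \<open>k\<close> by
    \<open>k - A *v m\<close>.\<close>
  have coeff: "L2_inner lborel (translates (u s) (l, m)) (e (j, k)) = h s l j (k - A *v m)"
    if "s < a" "k \<in> int_lattice" "m \<in> int_lattice" for s l m j k
  proof -
    have k': "k - A *v m \<in> int_lattice"
      using that lat by (simp add: int_lattice_diff)
    have "e (j, k) = (\<lambda>x. e (j, k - A *v m) (x - m))"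
      by (simp add: e_def dilate_translates_shift)
    then have "L2_inner lborel (translates (u s) (l, m)) (e (j, k))
        = L2_inner lborel (\<lambda>x. u s l (x - m)) (\<lambda>x. e (j, k - A *v m) (x - m))"
      by (simp add: translates_def)
    also have "\<dots> = L2_inner lborel (u s l) (e (j, k - A *v m))"
      using k' by (intro L2_inner_translate u_L2 that(1) e_L2) auto
    also have "\<dots> = h s l j (k - A *v m)"
      by (rule coeff0[OF that(1) k'])
    finally show ?thesis .
  qed
  \<comment> \<open>The first argument is expanded in the system \<open>e\<close>; the resulting
    double series over \<open>j\<close> and \<open>k\<close> is the one evaluated by
    \<open>filter_orthonormality\<close>.\<close>
  have inner0: "L2_inner lborel (u s l) (translates (u s') (l', m)) = (if s = s' \<and> l = l' \<and> m = 0 then 1 else 0)"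
    if s: "s < a" "s' < a" and m: "m \<in> int_lattice" for s s' l l' m
  proof -
    obtain b where b: "\<And>j. ((\<lambda>k. h s l j k * cnj (h s' l' j (k - A *v m))) has_sum b j) int_lattice"
      and b_sum: "(\<Sum>j\<in>UNIV. b j) = (if s = s' \<and> l = l' \<and> m = 0 then 1 else 0)"
      by (rule filter_orthonormality[OF det lat a_det digits filters s m]) auto
    have "((\<lambda>i. L2_inner lborel (\<lambda>x. h s l (fst i) (snd i) * e i x) (translates (u s') (l', m)))
        has_sum L2_inner lborel (u s l) (translates (u s') (l', m))) idx"
      by (rule L2_has_sum_inner[OF hsum[OF s(1)] tu_L2[OF s(2)]])
    moreover have "((\<lambda>k. L2_inner lborel (\<lambda>x. h s l (fst (j, k)) (snd (j, k)) * e (j, k) x) (translates (u s') (l', m)))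
        has_sum b j) int_lattice" for j
    proof (rule has_sum_cong[THEN iffD1, OF _ b])
      fix k :: "real ^ 'd" assume k: "k \<in> int_lattice"
      show "h s l j k * cnj (h s' l' j (k - A *v m))
          = L2_inner lborel (\<lambda>x. h s l (fst (j, k)) (snd (j, k)) * e (j, k) x) (translates (u s') (l', m))"
        using coeff[OF s(2) k m, of l' j] L2_inner_commute[of lborel "e (j, k)" "translates (u s') (l', m)"]
        by (simp add: L2_inner_scale_left)
    qed
    ultimately have "(b has_sum L2_inner lborel (u s l) (translates (u s') (l', m))) UNIV"
      by (rule has_sum_Sigma')
    then have "L2_inner lborel (u s l) (translates (u s') (l', m)) = (\<Sum>j\<in>UNIV. b j)"
      by (rule has_sum_unique) simp
    then show ?thesis
      by (simp add: b_sum)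
  qed
  have inner: "L2_inner lborel (translates (u s) (l, m)) (translates (u s') (l', m'))
      = (if s = s' \<and> l = l' \<and> m = m' then 1 else 0)"
    if "s < a" "s' < a" "m \<in> int_lattice" "m' \<in> int_lattice" for s s' l l' m m'
  proof -
    have "L2_inner lborel (translates (u s) (l, m)) (translates (u s') (l', m'))
        = L2_inner lborel (u s l) (translates (u s') (l', m' - m))"
      using L2_inner_translate2[OF u_L2[OF that(1)] u_L2[OF that(2)]] by (simp add: translates_def)
    then show ?thesis
      using inner0[OF that(1,2) int_lattice_diff[OF that(4,3)]] by simp
  qed
  show ON: ?ON
    unfolding orthonormal_family_def by (auto simp: tu_L2 inner)
  define w where "w = (\<lambda>(s, i). translates (u s) i)"
  \<comment> \<open>The share of all translates of \<open>u s l\<close> in the Bessel sum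
    \<open>N j k\<close> of the vector \<open>e (j, k)\<close>.\<close>
  define n where "n s l j k = (\<Sum>\<^sub>\<infinity>m\<in>int_lattice. (norm (h s l j (k - A *v m)))\<^sup>2)" for s l j k
  define N where "N j k = (\<Sum>\<^sub>\<infinity>i\<in>{..<a} \<times> idx. (norm (L2_inner lborel (e (j, k)) (w i)))\<^sup>2)" for j k
  have w_on: "orthonormal_family lborel w ({..<a} \<times> idx)"
    using ON by (simp add: w_def)
  have e_norm: "(L2_norm lborel (e i))\<^sup>2 = 1" if "i \<in> idx" for i
    by (rule orthonormal_family_norm[OF e_on that])
  have N_le: "N j k \<le> 1" if "k \<in> int_lattice" for j k
    using Bessel[OF w_on e_L2, of "(j, k)"] e_norm[of "(j, k)"] that by (simp add: N_def)
  have N_eq: "N j k = (\<Sum>s<a. \<Sum>l\<in>UNIV. n s l j k)" if k: "k \<in> int_lattice" for j k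
  proof -
    define q where "q s i = (norm (L2_inner lborel (e (j, k)) (translates (u s) i)))\<^sup>2" for s i
    \<comment> \<open>Bessel's inequality supplies the summability that allows the sum to be taken
      iteratedly.\<close>
    have summ: "(\<lambda>(s, i). q s i) summable_on {..<a} \<times> idx"
      using Bessel_summable[OF w_on e_L2, of "(j, k)"] k
      by (simp add: w_def q_def case_prod_unfold)
    have q_h: "q s (l, m) = (norm (h s l j (k - A *v m)))\<^sup>2" if "s < a" "m \<in> int_lattice" for s l m
      unfolding q_def using coeff[OF that(1) k that(2)]
      by (subst L2_inner_commute) simp
    have "N j k = infsum (\<lambda>(s, i). q s i) ({..<a} \<times> idx)"
      by (simp add: N_def w_def q_def case_prod_unfold)
    also have "\<dots> = (\<Sum>s<a. infsum (q s) idx)"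
      using infsum_Sigma'_banach[OF summ] by simp
    also have "\<dots> = (\<Sum>s<a. \<Sum>l\<in>UNIV. n s l j k)"
    proof (rule sum.cong[OF refl])
      fix s assume "s \<in> {..<a}"
      then have s: "s < a" by simp
      have "(\<lambda>(l, m). q s (l, m)) summable_on idx"
        using summable_on_SigmaD1[OF summ, of s] s by (simp add: case_prod_unfold)
      from infsum_Sigma'_banach[OF this]
      have "infsum (q s) idx = (\<Sum>l\<in>UNIV. infsum (\<lambda>m. q s (l, m)) int_lattice)"
        by (simp add: case_prod_unfold)
      also have "\<dots> = (\<Sum>l\<in>UNIV. n s l j k)"
        unfolding n_def by (intro sum.cong infsum_cong refl q_h s)
      finally show "infsum (q s) idx = (\<Sum>l\<in>UNIV. n s l j k)" .
    qed
    finally show ?thesis .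
  qed
  \<comment> \<open>For \<open>k\<close> in \<open>D\<close> and \<open>m\<close> in the lattice,
    \<open>k - A *v m\<close> runs through every lattice point once, so the total is the norm of one
    filter row.\<close>
  have n_sum: "(\<Sum>j\<in>UNIV. \<Sum>k\<in>D. n s l j k) = 1"
    if D: "digit_set A D" and s: "s < a" for D s l
  proof -
    have fin: "finite D"
      by (rule digit_set_card(1)[OF det lat D])
    have "(\<Sum>k\<in>D. n s l j k) = (\<Sum>\<^sub>\<infinity>k\<in>int_lattice. (norm (h s l j k))\<^sup>2)" for j
    proof -
      define q where "q x = (norm (h s l j x))\<^sup>2" for x
      have "q summable_on int_lattice"
        unfolding q_def by (rule filter_norm(1)[OF s])
      then have "(\<lambda>x. q ((\<lambda>(k, m). k - A *v m) x)) summable_on D \<times> int_lattice"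
        by (simp only: summable_on_reindex_bij_betw[OF bij_digits[OF D]])
      then have summ: "(\<lambda>(k, m). q (k - A *v m)) summable_on D \<times> int_lattice"
        by (simp add: case_prod_unfold)
      have "(\<Sum>\<^sub>\<infinity>k\<in>int_lattice. q k) = (\<Sum>\<^sub>\<infinity>x\<in>D \<times> int_lattice. q ((\<lambda>(k, m). k - A *v m) x))"
        by (rule infsum_reindex_bij_betw[OF bij_digits[OF D], symmetric])
      also have "\<dots> = (\<Sum>\<^sub>\<infinity>(k, m)\<in>D \<times> int_lattice. q (k - A *v m))"
        by (simp add: case_prod_unfold)
      also have "\<dots> = (\<Sum>k\<in>D. \<Sum>\<^sub>\<infinity>m\<in>int_lattice. q (k - A *v m))"
        using infsum_Sigma'_banach[OF summ] fin by simp
      finally show ?thesis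
        by (simp add: n_def q_def)
    qed
    then show ?thesis
      using filter_norm(2)[OF s, of l] by simp
  qed
  fix i assume i: "i \<in> idx"
  obtain j k where jk: "i = (j, k)" "k \<in> int_lattice"
    using i by auto
  obtain D where D: "digit_set A D" "k \<in> D"
    by (rule exists_digit_set[OF det lat jk(2)])
  have D_fin: "finite D" and D_card: "card D = a"
    using digit_set_card[OF det lat D(1)] a_det by simp_all
  have D_lat: "D \<subseteq> int_lattice"
    using D(1) by (simp add: digit_set_def)
  have "(\<Sum>j\<in>UNIV. \<Sum>k\<in>D. N j k) = (\<Sum>j\<in>UNIV. \<Sum>k\<in>D. \<Sum>s<a. \<Sum>l\<in>UNIV. n s l j k)"
    using D_lat by (intro sum.cong refl N_eq) auto
  also have "\<dots> = (\<Sum>s<a. \<Sum>l\<in>UNIV. \<Sum>j\<in>UNIV. \<Sum>k\<in>D. n s l j k)"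
  proof -
    have "(\<Sum>j\<in>UNIV. \<Sum>k\<in>D. \<Sum>s<a. \<Sum>l\<in>UNIV. n s l j k)
        = (\<Sum>j\<in>UNIV. \<Sum>s<a. \<Sum>k\<in>D. \<Sum>l\<in>UNIV. n s l j k)"
      by (intro sum.cong refl sum.swap)
    also have "\<dots> = (\<Sum>s<a. \<Sum>j\<in>UNIV. \<Sum>k\<in>D. \<Sum>l\<in>UNIV. n s l j k)"
      by (rule sum.swap)
    also have "\<dots> = (\<Sum>s<a. \<Sum>j\<in>UNIV. \<Sum>l\<in>UNIV. \<Sum>k\<in>D. n s l j k)"
      by (intro sum.cong refl sum.swap)
    also have "\<dots> = (\<Sum>s<a. \<Sum>l\<in>UNIV. \<Sum>j\<in>UNIV. \<Sum>k\<in>D. n s l j k)"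
      by (intro sum.cong refl sum.swap)
    finally show ?thesis .
  qed
  also have "\<dots> = (\<Sum>s<a. \<Sum>l\<in>(UNIV :: 'l set). 1)"
    by (intro sum.cong refl n_sum D(1)) simp
  finally have total: "(\<Sum>j\<in>UNIV. \<Sum>k\<in>D. N j k) = real a * real CARD('l)"
    by simp
  \<comment> \<open>\<open>total\<close> is also the number of pairs, as \<open>D\<close> has
    \<open>a\<close> elements. Hence the nonnegative defects \<open>1 - N j k\<close> add up to 0
    and each of them vanishes.\<close>
  have "(\<Sum>(j, k)\<in>UNIV \<times> D. 1 - N j k) = 0"
    using total D_card by (simp add: sum.cartesian_product[symmetric] sum_subtractf)
  moreover have "\<And>p. p \<in> UNIV \<times> D \<Longrightarrow> 0 \<le> (case p of (j, k) \<Rightarrow> 1 - N j k)"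
    using N_le D_lat by auto
  ultimately have "\<forall>p\<in>UNIV \<times> D. (case p of (j, k) \<Rightarrow> 1 - N j k) = 0"
    using D_fin by (subst (asm) sum_nonneg_eq_0_iff) auto
  then have "N j k = 1"
    using D(2) by auto
  then have "e i \<in> L2_span lborel w ({..<a} \<times> idx)"
    using e_norm[OF i] by (intro Bessel_eq_imp_span[OF w_on e_L2[OF i]]) (simp add: N_def jk(1))
  then show "dilate A (translates g i) \<in> L2_span lborel (\<lambda>(s, i). translates (u s) i) ({..<a} \<times> idx)"
    by (simp add: e_def w_def)
qed

subsection \<open>Orthonormality and completeness of the packets\<close>

lemma V_L2: "g \<in> V j \<Longrightarrow> g \<in> L2_space lborel"
  using mra by (auto simp: mra_def closed_L2_subspace_def)

lemma V_scale: "g \<in> V j \<Longrightarrow> (\<lambda>x. c * g x) \<in> V j"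
  using mra by (auto simp: mra_def closed_L2_subspace_def)

lemma V_mono: "V j \<subseteq> V (j + 1)"
  using mra by (simp add: mra_def)

lemma V_Inter: "(\<Inter>j. V j) = {f \<in> L2_space lborel. AE x in lborel. f x = 0}"
  using mra unfolding mra_def by (elim conjE)

lemma V_dense:
  assumes "F \<in> L2_space lborel" "0 < \<epsilon>"
  shows "\<exists>j. \<exists>g\<in>V j. L2_norm lborel (\<lambda>x. F x - g x) < \<epsilon>"
proof -
  have "\<forall>f\<in>L2_space lborel. \<forall>\<epsilon>>0. \<exists>g\<in>(\<Union>j. V j). L2_norm lborel (\<lambda>x. f x - g x) < \<epsilon>"
    using mra unfolding mra_def by (elim conjE)
  from this[rule_format, OF assms] show ?thesis
    by auto
qed

lemma V_dilate_iff: "(\<lambda>x. g (A *v x)) \<in> V (j + 1) \<longleftrightarrow> g \<in> V j"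
  using mra by (auto simp: mra_def)

lemma V_dilateE:
  assumes "F \<in> V (j + 1)"
  obtains g c where "g \<in> V j" "F = (\<lambda>x. c * dilate A g x)"
proof
  define g where "g = (\<lambda>x. F (matrix_inv A *v x))"
  have F: "F = (\<lambda>x. g (A *v x))"
    by (simp add: g_def matrix_inv_cancel[OF det])
  then show "g \<in> V j"
    using assms V_dilate_iff[of g j] by simp
  show "F = (\<lambda>x. complex_of_real (1 / sqrt \<bar>det A\<bar>) * dilate A g x)"
    using det by (simp add: F dilate_def)
qed

lemma \<phi>_orthonormal: "orthonormal_family lborel (translates \<phi>) idx"
proof -
  have "orthonormal_basis lborel (translates \<phi>) idx (V 0)"
    using mra by (simp add: mra_def translates_def)
  then show ?thesis
    using V_L2 unfolding orthonormal_basis_def orthonormal_family_def by blast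
qed

lemma \<phi>_in_V0: "i \<in> idx \<Longrightarrow> translates \<phi> i \<in> V 0"
proof -
  have "orthonormal_basis lborel (translates \<phi>) idx (V 0)"
    using mra by (simp add: mra_def translates_def)
  then show "i \<in> idx \<Longrightarrow> translates \<phi> i \<in> V 0"
    unfolding orthonormal_basis_def by blast
qed

lemma V0_span: "V 0 \<subseteq> L2_span lborel (translates \<phi>) idx"
proof -
  have "orthonormal_basis lborel (translates \<phi>) idx (V 0)"
    using mra by (simp add: mra_def translates_def)
  then show ?thesis
    using V_L2 unfolding orthonormal_basis_def L2_span_def by blast
qed

lemma f_0: "f 0 = \<phi>"
  using packets by (simp add: basic_multiwavelet_packets_def)

lemma f_refines: "s < a \<Longrightarrow> refines A a (h s) (f r) (f (s + a * r))"
  using packets by (simp add: basic_multiwavelet_packets_def)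

lemma f_translates_L2: "translates (f n) i \<in> L2_space lborel"
proof -
  have "refines A a (h (n mod a)) (f (n div a)) (f n)"
    using f_refines[of "n mod a" "n div a"] a_pos by simp
  from refines_L2[OF this] show ?thesis
    by (cases i) (simp add: translates_def L2_space_translate)
qed

text \<open>If \<open>a = 1\<close>, the only child of \<open>\<phi>\<close> is
  \<open>\<phi>\<close> itself, and the splitting puts the dilate of \<open>V 0\<close> inside
  \<open>V 0\<close>. Then \<open>V 0\<close> is contained in every \<open>V j\<close>, so its
  members vanish almost everywhere, against the norm 1 of a scaling function. This avoids writing
  the determinant as a product of eigenvalues.\<close>

lemma a_ge_2: "2 \<le> a"
proof (rule ccontr)
  assume "\<not> 2 \<le> a"
  then have a1: "a = 1"
    using a_pos by simp
  have closed: "closed_L2_subspace lborel (V 0)"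
    using mra by (simp add: mra_def)
  have "L2_span lborel (\<lambda>(s, i). translates (f (s + a * 0)) i) ({..<a} \<times> idx) \<subseteq> V 0"
    by (rule L2_span_subset_closed_subspace[OF closed]) (use a1 f_0 \<phi>_in_V0 in auto)
  moreover have "dilate A (translates \<phi> i) \<in> L2_span lborel (\<lambda>(s, i). translates (f (s + a * 0)) i) ({..<a} \<times> idx)"
    if "i \<in> idx" for i
    using f_refines[of _ 0] f_0 that by (intro split_orthonormal(2) \<phi>_orthonormal) auto
  ultimately have dil: "dilate A (translates \<phi> i) \<in> V 0" if "i \<in> idx" for i
    using that by blast
  have base: "V (0 + 1) \<subseteq> V 0"
  proof
    fix F assume "F \<in> V (0 + 1)"
    then obtain g c where g: "g \<in> V 0" and F: "F = (\<lambda>x. c * dilate A g x)"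
      by (rule V_dilateE)
    have "g \<in> L2_span lborel (translates \<phi>) idx"
      using g V0_span by blast
    then have "dilate A g \<in> L2_span lborel (\<lambda>i. dilate A (translates \<phi> i)) idx"
      by (intro dilate_span[OF det] orthonormal_family_L2[OF \<phi>_orthonormal])
    also have "\<dots> \<subseteq> V 0"
      by (rule L2_span_subset_closed_subspace[OF closed dil])
    finally show "F \<in> V 0"
      unfolding F by (rule V_scale)
  qed
  \<comment> \<open>Dilating \<open>F\<close> lifts it one level, where the induction hypothesis
    applies; the scaling property brings the result back down.\<close>
  have down: "V (j + 1) \<subseteq> V j" if "j \<le> 0" for j
    using that
  proof (induction j rule: int_le_induct)
    case base
    show ?case by (rule \<open>V (0 + 1) \<subseteq> V 0\<close>)
  next
    case (step i)
    show ?case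
    proof
      fix F assume "F \<in> V (i - 1 + 1)"
      then have "(\<lambda>x. F (A *v x)) \<in> V (i + 1)"
        by (simp add: V_dilate_iff)
      then have "(\<lambda>x. F (A *v x)) \<in> V (i - 1 + 1)"
        using step.IH by auto
      then show "F \<in> V (i - 1)"
        by (simp only: V_dilate_iff)
    qed
  qed
  have "V 0 \<subseteq> V j" for j
  proof (cases "j \<le> 0")
    case True
    then show ?thesis
    proof (induction j rule: int_le_induct)
      case (step i)
      then show ?case
        using down[of "i - 1"] by auto
    qed simp
  next
    case False
    then have "0 \<le> j" by simp
    then show ?thesis
    proof (induction j rule: int_ge_induct)
      case (step i)
      then show ?case
        using V_mono[of i] by auto
    qed simp
  qed
  then have "V 0 \<subseteq> {f \<in> L2_space lborel. AE x in lborel. f x = 0}"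
    unfolding V_Inter[symmetric] by (rule INT_greatest)
  moreover have i: "(undefined, 0) \<in> idx"
    by simp
  ultimately have "AE x in lborel. translates \<phi> (undefined, 0) x = 0"
    using \<phi>_in_V0 by blast
  then have "L2_inner lborel (translates \<phi> (undefined, 0)) (translates \<phi> (undefined, 0)) = 0"
    unfolding L2_inner_def by (intro Bochner_Integration.integral_eq_zero_AE) auto
  then show False
    using orthonormal_family_inner[OF \<phi>_orthonormal i i] by simp
qed

text \<open>Induction on \<open>n + n'\<close>, passing to the parents \<open>n div a\<close> and
  \<open>n' div a\<close>. Equal parents: the packets are siblings, and
  \<open>split_orthonormal\<close> separates them. Different parents: the packets lie in the dilated
  spans of the parents, which are orthogonal by the induction hypothesis.\<close>

lemma f_orthonormal: "orthonormal_family lborel (\<lambda>(n, i). translates (f n) i) (UNIV \<times> idx)"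
proof -
  have "\<forall>i\<in>idx. \<forall>i'\<in>idx. L2_inner lborel (translates (f n) i) (translates (f n') i')
      = (if n = n' \<and> i = i' then 1 else 0)" for n n'
  proof (induction "n + n'" arbitrary: n n' rule: less_induct)
    case less
    show ?case
    proof (cases "n + n' = 0")
      case True
      then show ?thesis
        using orthonormal_family_inner[OF \<phi>_orthonormal] by (simp add: f_0)
    next
      case False
      define r where "r = n div a"
      define r' where "r' = n' div a"
      define s where "s = n mod a"
      define s' where "s' = n' mod a"
      have n: "n = s + a * r" "s < a" and n': "n' = s' + a * r'" "s' < a"
        using a_pos by (simp_all add: r_def s_def r'_def s'_def)
      have div_le: "k div a \<le> k" and div_less: "0 < k \<Longrightarrow> k div a < k" for k
        using a_ge_2 by (simp_all add: div_less_dividend)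
      \<comment> \<open>At least one of the two numbers is positive, and that one decreases strictly
        since \<open>a\<close> is at least 2.\<close>
      have lt: "r + r' < n + n'"
        using False div_le[of n] div_le[of n'] div_less[of n] div_less[of n']
        unfolding r_def r'_def by linarith
      show ?thesis
      proof (cases "r = r'")
        case True
        have on: "orthonormal_family lborel (translates (f r)) idx"
        proof (cases "r = 0")
          case True
          then show ?thesis
            by (simp add: f_0 \<phi>_orthonormal)
        next
          case False
          then show ?thesis
            using less.hyps[of r r] lt \<open>r = r'\<close> f_translates_L2 unfolding orthonormal_family_def by simp
        qed
        have ON: "orthonormal_family lborel (\<lambda>(s, i). translates (f (s + a * r)) i) ({..<a} \<times> idx)"
          using f_refines by (intro split_orthonormal(1)[OF on])
        have "s = s' \<longleftrightarrow> n = n'"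
          using n n' True by simp
        then show ?thesis
          using orthonormal_family_inner[OF ON, of "(s, _)" "(s', _)"] n n' True by simp
      next
        case False
        have "n \<noteq> n'"
          using False by (auto simp: r_def r'_def)
        moreover have "L2_inner lborel (translates (f n) i) (translates (f n') i') = 0"
          if i: "i \<in> idx" and i': "i' \<in> idx" for i i'
        proof (rule L2_span_orthogonal_span)
          show "translates (f n) i \<in> L2_span lborel (\<lambda>i. dilate A (translates (f r) i)) idx"
            unfolding n(1) by (rule refines_in_span[OF f_translates_L2 f_refines[OF n(2)] i])
          show "translates (f n') i' \<in> L2_span lborel (\<lambda>i. dilate A (translates (f r') i)) idx"
            unfolding n'(1) by (rule refines_in_span[OF f_translates_L2 f_refines[OF n'(2)] i'])
          show "L2_inner lborel (dilate A (translates (f r) i)) (dilate A (translates (f r') i')) = 0"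
            if "i \<in> idx" "i' \<in> idx" for i i'
            using less.hyps[OF lt, THEN bspec, THEN bspec, OF that] False
            by (simp add: dilate_inner[OF det f_translates_L2 f_translates_L2])
        qed (simp_all add: dilate_L2[OF det f_translates_L2])
        ultimately show ?thesis
          by simp
      qed
    qed
  qed
  then show ?thesis
    by (auto simp: orthonormal_family_def f_translates_L2)
qed

definition packet :: "nat \<times> ('l \<times> (real ^ 'd)) \<Rightarrow> real ^ 'd \<Rightarrow> complex" where
  "packet = (\<lambda>(n, i). translates (f n) i)"

lemma packet_L2: "packet p \<in> L2_space lborel"
  by (simp add: packet_def f_translates_L2 split: prod.split)

lemma packet_orthonormal: "orthonormal_family lborel packet (UNIV \<times> idx)"
  using f_orthonormal by (simp add: packet_def)

text \<open>The half of the splitting of a dilated packet space that rests on the counting argument;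
  the opposite half, \<open>packet_span_dilate\<close>, is immediate from the refinement
  equation.\<close>

lemma dilate_packet_span:
  assumes "i \<in> idx"
  shows "dilate A (packet (r, i)) \<in> L2_span lborel packet ({a * r..<a * (r + 1)} \<times> idx)"
proof -
  have on: "orthonormal_family lborel (translates (f r)) idx"
    unfolding orthonormal_family_def
    using orthonormal_family_inner[OF f_orthonormal, of "(r, _)" "(r, _)"] f_translates_L2 by auto
  have "dilate A (translates (f r) i) \<in> L2_span lborel (\<lambda>(s, i). translates (f (s + a * r)) i) ({..<a} \<times> idx)"
    using f_refines assms by (intro split_orthonormal(2)[OF on])
  also have "\<dots> \<subseteq> L2_span lborel packet ({a * r..<a * (r + 1)} \<times> idx)"
  proof (rule L2_span_subset[OF packet_L2])
    fix p assume "p \<in> {..<a} \<times> idx"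
    then obtain s i where p: "p = (s, i)" "s < a" "i \<in> idx"
      by auto
    then have "packet (s + a * r, i) \<in> L2_span lborel packet ({a * r..<a * (r + 1)} \<times> idx)"
      by (intro L2_span_base packet_L2) auto
    then show "(case p of (s, i) \<Rightarrow> translates (f (s + a * r)) i) \<in> L2_span lborel packet ({a * r..<a * (r + 1)} \<times> idx)"
      by (simp add: p(1) packet_def)
  qed
  finally show ?thesis
    by (simp add: packet_def)
qed

lemma packet_span_dilate:
  assumes "i \<in> idx"
  shows "packet (n, i) \<in> L2_span lborel (\<lambda>i. dilate A (packet (n div a, i))) idx"
  using refines_in_span[OF f_translates_L2 f_refines[of "n mod a" "n div a"] assms] a_pos
  by (simp add: packet_def)

text \<open>Dilation maps the span of all packets into itself, because each dilated packet lies in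
  the span of its children. Starting from \<open>V 0\<close> this reaches every \<open>V j\<close>
  with positive \<open>j\<close>; for negative \<open>j\<close> nesting is enough.\<close>

lemma packet_complete: "L2_space lborel \<subseteq> L2_span lborel packet (UNIV \<times> idx)"
proof
  have V0: "V 0 \<subseteq> L2_span lborel packet (UNIV \<times> idx)"
  proof -
    have "L2_span lborel (translates \<phi>) idx \<subseteq> L2_span lborel packet (UNIV \<times> idx)"
    proof (rule L2_span_subset[OF packet_L2])
      fix i assume "i \<in> idx"
      then have "packet (0, i) \<in> L2_span lborel packet (UNIV \<times> idx)"
        by (intro L2_span_base packet_L2) auto
      then show "translates \<phi> i \<in> L2_span lborel packet (UNIV \<times> idx)"
        by (simp add: packet_def f_0)
    qed
    with V0_span show ?thesis by blast
  qed
  have V: "V j \<subseteq> L2_span lborel packet (UNIV \<times> idx)" for j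
  proof (cases "j \<le> 0")
    case True
    then have "V j \<subseteq> V 0"
    proof (induction j rule: int_le_induct)
      case (step i)
      then show ?case
        using V_mono[of "i - 1"] by auto
    qed simp
    with V0 show ?thesis by blast
  next
    case False
    then have "0 \<le> j" by simp
    then show ?thesis
    proof (induction j rule: int_ge_induct)
      case base
      show ?case by (rule V0)
    next
      case (step i)
      show ?case
      proof
        fix F assume "F \<in> V (i + 1)"
        then obtain g c where g: "g \<in> V i" and F: "F = (\<lambda>x. c * dilate A g x)"
          by (rule V_dilateE)
        have "g \<in> L2_span lborel packet (UNIV \<times> idx)"
          using g step.IH by blast
        then have "dilate A g \<in> L2_span lborel (\<lambda>p. dilate A (packet p)) (UNIV \<times> idx)"
          by (intro dilate_span[OF det] packet_L2)
        also have "\<dots> \<subseteq> L2_span lborel packet (UNIV \<times> idx)"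
        proof (rule L2_span_subset[OF packet_L2])
          fix p :: "nat \<times> 'l \<times> (real ^ 'd)" assume "p \<in> UNIV \<times> idx"
          then obtain r i where p: "p = (r, i)" "i \<in> idx"
            by auto
          have "L2_span lborel packet ({a * r..<a * (r + 1)} \<times> idx) \<subseteq> L2_span lborel packet (UNIV \<times> idx)"
            by (rule L2_span_mono) auto
          with dilate_packet_span[OF p(2), of r] show "dilate A (packet p) \<in> L2_span lborel packet (UNIV \<times> idx)"
            unfolding p(1) by blast
        qed
        finally show "F \<in> L2_span lborel packet (UNIV \<times> idx)"
          unfolding F by (rule L2_span_scale)
      qed
    qed
  qed
  fix F :: "real ^ 'd \<Rightarrow> complex" assume F: "F \<in> L2_space lborel"
  show "F \<in> L2_span lborel packet (UNIV \<times> idx)"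
  proof (rule L2_span_closed[OF packet_L2 F])
    fix \<epsilon> :: real assume "0 < \<epsilon>"
    then obtain g j where g: "g \<in> V j" "L2_norm lborel (\<lambda>x. F x - g x) < \<epsilon>"
      using V_dense[OF F] by blast
    then have "g \<in> L2_span lborel packet (UNIV \<times> idx)"
      using V[of j] by blast
    with g(2) show "\<exists>G\<in>L2_span lborel packet (UNIV \<times> idx). L2_norm lborel (\<lambda>x. F x - G x) < \<epsilon>"
      by (rule bexI)
  qed
qed

text \<open>The scale is a natural number, so that statements can be proved by induction with one
  dilation per step; the restriction on \<open>S\<close> in the theorem ensures that these scales
  suffice.\<close>

definition scaled :: "nat \<Rightarrow> nat \<Rightarrow> 'l \<times> (real ^ 'd) \<Rightarrow> real ^ 'd \<Rightarrow> complex" where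
  "scaled p n i = scaled_packet A a f (fst i, snd i, n, int p)"

lemma scaled_0: "scaled 0 n i = packet (n, i)"
  using a_pos by (cases i) (simp add: scaled_def scaled_packet_def matrix_powi_def packet_def translates_def)

lemma scaled_Suc: "scaled (Suc p) n i = dilate A (scaled p n i)"
proof
  fix x
  define B where "B = (((**) A) ^^ p) (mat 1)"
  \<comment> \<open>\<open>matrix_powi\<close> multiplies by the new factor on the left, whereas
    \<open>dilate\<close> inserts it next to the argument; powers of \<open>A\<close> commute with
    \<open>A\<close>.\<close>
  have comm: "(((**) A) ^^ p) (mat 1) ** A = A ** (((**) A) ^^ p) (mat 1)" for p
    by (induction p) (simp_all add: matrix_mul_assoc[symmetric])
  have "matrix_powi A (int (Suc p)) *v x = B *v (A *v x)"
    unfolding matrix_powi_def B_def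
    by (simp only: nat_int of_nat_0_le_iff if_True funpow.simps o_apply matrix_vector_mul_assoc comm)
  moreover have "matrix_powi A (int p) = B"
    by (simp add: matrix_powi_def B_def)
  moreover have "real a powr (real_of_int (int (Suc p)) / 2) = sqrt \<bar>det A\<bar> * real a powr (real_of_int (int p) / 2)"
    using a_pos by (simp add: a_det[symmetric] powr_half_sqrt[symmetric] powr_add[symmetric] add_divide_distrib)
  ultimately show "scaled (Suc p) n i x = dilate A (scaled p n i) x"
    by (simp add: scaled_def scaled_packet_def dilate_def)
qed

lemma scaled_orthonormal: "orthonormal_family lborel (scaled p n) idx"
proof (induction p)
  case 0
  show ?case
    unfolding orthonormal_family_def scaled_0
    using orthonormal_family_inner[OF packet_orthonormal, of "(n, _)" "(n, _)"] packet_L2 by auto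
next
  case (Suc p)
  show ?case
    using orthonormal_dilate[OF Suc] by (simp add: orthonormal_family_def scaled_Suc)
qed

lemma scaled_L2: "i \<in> idx \<Longrightarrow> scaled p n i \<in> L2_space lborel"
  by (rule orthonormal_family_L2[OF scaled_orthonormal])

section \<open>Cells of the subdivision in base \<open>a\<close> and the spaces they
  describe\<close>

definition cell :: "nat \<Rightarrow> nat \<Rightarrow> nat set" where
  "cell p n = {a ^ p * n..<a ^ p * (n + 1)}"

text \<open>The inductive form of the cells: they pull back along the same map
  \<open>t div a\<close> that sends a packet to its parent, so one dilation step of spaces matches
  one step of cells.\<close>

lemma cell_Suc: "t \<in> cell (Suc p) n \<longleftrightarrow> t div a \<in> cell p n"
proof -
  have "a ^ Suc p * n \<le> t \<longleftrightarrow> a ^ p * n \<le> t div a"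
    using less_eq_div_iff_mult_less_eq[OF a_pos, of "a ^ p * n" t] by (simp add: mult_ac)
  moreover have "t < a ^ Suc p * (n + 1) \<longleftrightarrow> t div a < a ^ p * (n + 1)"
    using div_less_iff_less_mult[OF a_pos, of t "a ^ p * (n + 1)"] by (simp add: mult_ac del: add_Suc_right)
  ultimately show ?thesis
    by (simp add: cell_def)
qed

lemma packet_cell_eq: "packet_cell a (n, int p) = cell p n"
proof -
  have "real a powi int p * real n \<le> real t \<longleftrightarrow> a ^ p * n \<le> t" for t
    by (simp add: flip: of_nat_power of_nat_mult)
  \<comment> \<open>The closed bound with \<open>- 1\<close> amounts to a strict bound because both
    quantities are integers.\<close>
  moreover have "real t \<le> real a powi int p * (real n + 1) - 1 \<longleftrightarrow> t < a ^ p * (n + 1)" for t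
  proof -
    have "real t \<le> real a powi int p * (real n + 1) - 1 \<longleftrightarrow> real (t + 1) \<le> real (a ^ p * (n + 1))"
      by (simp add: algebra_simps)
    then show ?thesis
      by (simp only: of_nat_le_iff) linarith
  qed
  ultimately show ?thesis
    by (auto simp: packet_cell_def cell_def)
qed

text \<open>Both inclusions between the span of the scaled packets of (\<open>n\<close>,
  \<open>p\<close>) and that of the packets numbered by its cell. One more dilation replaces a
  packet by its children in the first inclusion and reaches a packet through its parent in the
  second.\<close>

lemma scaled_span:
  shows "i \<in> idx \<Longrightarrow> scaled p n i \<in> L2_span lborel packet (cell p n \<times> idx)"
    and "i \<in> idx \<Longrightarrow> t \<in> cell p n \<Longrightarrow> packet (t, i) \<in> L2_span lborel (scaled p n) idx"
proof (induction p arbitrary: i t)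
  case 0
  {
    case 1
    then show ?case
      unfolding scaled_0 by (intro L2_span_base packet_L2) (simp add: cell_def mem_Times_iff)
  next
    case 2
    then have "t = n"
      by (simp add: cell_def)
    then show ?case
      using L2_span_base[of i idx "scaled 0 n", OF 2(1) scaled_L2[OF 2(1)]] by (simp only: scaled_0[abs_def])
  }
next
  case (Suc p)
  {
    case 1
    have "dilate A (scaled p n i) \<in> L2_span lborel (\<lambda>q. dilate A (packet q)) (cell p n \<times> idx)"
      by (rule dilate_span[OF det packet_L2 Suc.IH(1)[OF 1]])
    also have "\<dots> \<subseteq> L2_span lborel packet (cell (Suc p) n \<times> idx)"
    proof (rule L2_span_subset[OF packet_L2])
      fix q :: "nat \<times> 'l \<times> (real ^ 'd)" assume "q \<in> cell p n \<times> idx"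
      then obtain r i where q: "q = (r, i)" "r \<in> cell p n" "i \<in> idx"
        by auto
      have "t div a = r" if "a * r \<le> t" "t < a * (r + 1)" for t
        using that a_pos by (intro div_nat_eqI) (simp_all add: mult.commute)
      then have "{a * r..<a * (r + 1)} \<subseteq> cell (Suc p) n"
        using q(2) by (auto simp: cell_Suc)
      then have "L2_span lborel packet ({a * r..<a * (r + 1)} \<times> idx) \<subseteq> L2_span lborel packet (cell (Suc p) n \<times> idx)"
        by (intro L2_span_mono) auto
      with dilate_packet_span[OF q(3), of r] show "dilate A (packet q) \<in> L2_span lborel packet (cell (Suc p) n \<times> idx)"
        unfolding q(1) by blast
    qed
    finally show ?case
      by (simp only: scaled_Suc)
  next
    case 2
    have "packet (t, i) \<in> L2_span lborel (\<lambda>i. dilate A (packet (t div a, i))) idx"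
      by (rule packet_span_dilate[OF 2(1)])
    also have "\<dots> \<subseteq> L2_span lborel (scaled (Suc p) n) idx"
    proof (rule L2_span_subset[OF scaled_L2])
      fix i assume i: "i \<in> idx"
      have packet_span: "packet (t div a, i) \<in> L2_span lborel (scaled p n) idx"
        using 2(2) by (intro Suc.IH(2)[OF i]) (simp add: cell_Suc)
      have "dilate A (packet (t div a, i)) \<in> L2_span lborel (\<lambda>i. dilate A (scaled p n i)) idx"
        by (rule dilate_span[OF det scaled_L2 packet_span])
      then show "dilate A (packet (t div a, i)) \<in> L2_span lborel (scaled (Suc p) n) idx"
        by (simp add: scaled_Suc[abs_def])
    qed
    finally show ?case .
  }
qed

text \<open>Disjoint cells give orthogonality since the scaled functions lie in spans of disjoint
  sets of packets, and covering gives completeness since every packet lies in one of the scaled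
  spans. Conversely, a packet whose number violates the partition property would be orthogonal to
  itself.\<close>

lemma orthonormal_basis_iff_partition:
  assumes S: "\<forall>(n, j)\<in>S. 0 \<le> j"
  shows "orthonormal_basis lborel (scaled_packet A a f) (UNIV \<times> int_lattice \<times> S) (L2_space lborel)
    \<longleftrightarrow> partition_of_nat (packet_cell a) S"
proof -
  define e where "e = scaled_packet A a f"
  define J where "J = (UNIV :: 'l set) \<times> (int_lattice :: (real ^ 'd) set) \<times> S"
  have e_scaled: "e (l, k, n, int p) = scaled p n (l, k)" for l k n p
    by (simp add: e_def scaled_def)
  have S_E: "\<exists>n p. q = (n, int p)" if "q \<in> S" for q
    using that S by (cases q) (auto dest: zero_le_imp_eq_int)
  have e_L2: "e q \<in> L2_space lborel" if "q \<in> J" for q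
    using that S_E scaled_L2 by (fastforce simp: J_def e_scaled)
  have scaled_sub: "L2_span lborel (scaled p n) idx \<subseteq> L2_span lborel e J" if "(n, int p) \<in> S" for n p
  proof (rule L2_span_subset[OF e_L2])
    fix i assume "i \<in> idx"
    then obtain l k where "i = (l, k)" "k \<in> int_lattice"
      by auto
    then show "scaled p n i \<in> L2_span lborel e J"
      using that e_L2[of "(l, k, n, int p)"] L2_span_base[of "(l, k, n, int p)" J e]
      by (simp add: e_scaled J_def)
  qed
  have packet_norm: "L2_inner lborel (packet (t, i)) (packet (t', i')) = (if t = t' \<and> i = i' then 1 else 0)"
    if "i \<in> idx" "i' \<in> idx" for t t' i i'
    using orthonormal_family_inner[OF packet_orthonormal, of "(t, i)" "(t', i')"] that by simp
  \<comment> \<open>Any index serves to exhibit one packet with a given number \<open>t\<close>; the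
    type of scaling indices is nonempty.\<close>
  have i0: "(undefined, 0) \<in> idx"
    by simp
  show ?thesis
    unfolding orthonormal_basis_L2_space_iff partition_of_nat_def e_def[symmetric] J_def[symmetric]
  proof (intro iffI conjI)
    assume part: "disjoint_family_on (packet_cell a) S \<and> (\<Union>q\<in>S. packet_cell a q) = UNIV"
    show "orthonormal_family lborel e J"
      unfolding orthonormal_family_def
    proof (intro conjI ballI)
      fix q q' assume q: "q \<in> J" and q': "q' \<in> J"
      obtain l k n p where lk: "q = (l, k, n, int p)" "k \<in> int_lattice" "(n, int p) \<in> S"
        using q S_E by (fastforce simp: J_def)
      obtain l' k' n' p' where lk': "q' = (l', k', n', int p')" "k' \<in> int_lattice" "(n', int p') \<in> S"
        using q' S_E by (fastforce simp: J_def)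
      show "L2_inner lborel (e q) (e q') = (if q = q' then 1 else 0)"
      proof (cases "(n, int p) = (n', int p')")
        case True
        then show ?thesis
          using lk lk' orthonormal_family_inner[OF scaled_orthonormal, of "(l, k)" "(l', k')" p n]
          by (simp add: e_scaled)
      next
        case False
        then have disj: "cell p n \<inter> cell p' n' = {}"
          using part lk(3) lk'(3) unfolding disjoint_family_on_def packet_cell_eq[symmetric] by blast
        have "L2_inner lborel (scaled p n (l, k)) (scaled p' n' (l', k')) = 0"
        proof (rule L2_span_orthogonal_span[OF packet_L2 packet_L2])
          show "scaled p n (l, k) \<in> L2_span lborel packet (cell p n \<times> idx)"
            using lk by (intro scaled_span(1)) simp
          show "scaled p' n' (l', k') \<in> L2_span lborel packet (cell p' n' \<times> idx)"
            using lk' by (intro scaled_span(1)) simp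
          show "L2_inner lborel (packet x) (packet y) = 0" if "x \<in> cell p n \<times> idx" "y \<in> cell p' n' \<times> idx" for x y
            using that disj packet_norm by (cases x; cases y) auto
        qed
        with False show ?thesis
          by (auto simp: lk(1) lk'(1) e_scaled)
      qed
    qed (rule e_L2)
    have "L2_span lborel packet (UNIV \<times> idx) \<subseteq> L2_span lborel e J"
    proof (rule L2_span_subset[OF e_L2])
      fix x :: "nat \<times> 'l \<times> (real ^ 'd)" assume "x \<in> UNIV \<times> idx"
      then obtain t i where x: "x = (t, i)" "i \<in> idx"
        by auto
      obtain n p where np: "(n, int p) \<in> S" "t \<in> packet_cell a (n, int p)"
        using part S_E by (metis UNIV_I UN_E)
      then have "packet (t, i) \<in> L2_span lborel (scaled p n) idx"
        by (intro scaled_span(2)[OF x(2)]) (simp add: packet_cell_eq)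
      then show "packet x \<in> L2_span lborel e J"
        using scaled_sub[OF np(1)] x(1) by blast
    qed
    with packet_complete show "L2_space lborel \<subseteq> L2_span lborel e J"
      by blast
  next
    assume onb: "orthonormal_family lborel e J \<and> L2_space lborel \<subseteq> L2_span lborel e J"
    show "disjoint_family_on (packet_cell a) S"
      unfolding disjoint_family_on_def
    proof (intro ballI impI)
      fix q q' assume q: "q \<in> S" and q': "q' \<in> S" and ne: "q \<noteq> q'"
      obtain n p n' p' where np: "q = (n, int p)" "q' = (n', int p')"
        using S_E q q' by meson
      show "packet_cell a q \<inter> packet_cell a q' = {}"
      proof (rule ccontr)
        assume "packet_cell a q \<inter> packet_cell a q' \<noteq> {}"
        then obtain t where t: "t \<in> cell p n" "t \<in> cell p' n'"
          by (auto simp: np packet_cell_eq)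
        \<comment> \<open>If \<open>t\<close> lies in two cells, its packet belongs to two spans
          which are orthogonal because the family indexed by \<open>J\<close> is
          orthonormal.\<close>
        have "L2_inner lborel (packet (t, (undefined, 0))) (packet (t, (undefined, 0))) = 0"
        proof (rule L2_span_orthogonal_span[OF scaled_L2 scaled_L2])
          show "packet (t, (undefined, 0)) \<in> L2_span lborel (scaled p n) idx"
            by (rule scaled_span(2)[OF i0 t(1)])
          show "packet (t, (undefined, 0)) \<in> L2_span lborel (scaled p' n') idx"
            by (rule scaled_span(2)[OF i0 t(2)])
          fix i i' assume i: "i \<in> idx" and i': "i' \<in> idx"
          obtain l k l' k' where "i = (l, k)" "i' = (l', k')"
            by fastforce
          then show "L2_inner lborel (scaled p n i) (scaled p' n' i') = 0"
            using orthonormal_family_inner[OF conjunct1[OF onb], of "(l, k, q)" "(l', k', q')"]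
              q q' ne i i' by (simp add: J_def np e_scaled)
        qed
        then show False
          using packet_norm[OF i0 i0, of t t] by simp
      qed
    qed
    show "(\<Union>q\<in>S. packet_cell a q) = UNIV"
    proof (rule ccontr)
      assume "(\<Union>q\<in>S. packet_cell a q) \<noteq> UNIV"
      then obtain t where t: "\<And>q. q \<in> S \<Longrightarrow> t \<notin> packet_cell a q"
        by blast
      \<comment> \<open>If \<open>t\<close> lies in no cell, its packet is orthogonal to every
        member of the family, yet completeness puts it in their span.\<close>
      have "L2_inner lborel (packet (t, (undefined, 0))) (packet (t, (undefined, 0))) = 0"
      proof (rule L2_span_orthogonal[OF e_L2 packet_L2])
        show "packet (t, (undefined, 0)) \<in> L2_span lborel e J"
          using onb packet_L2 by blast
        fix q assume "q \<in> J"
        then obtain l k n p where lk: "q = (l, k, n, int p)" "k \<in> int_lattice" "(n, int p) \<in> S"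
          using S_E by (fastforce simp: J_def)
        have "L2_inner lborel (scaled p n (l, k)) (packet (t, (undefined, 0))) = 0"
        proof (rule L2_span_orthogonal[OF packet_L2 packet_L2])
          show "scaled p n (l, k) \<in> L2_span lborel packet (cell p n \<times> idx)"
            using lk(2) by (intro scaled_span(1)) simp
          show "L2_inner lborel (packet x) (packet (t, (undefined, 0))) = 0" if "x \<in> cell p n \<times> idx" for x
            using that t[OF lk(3)] packet_norm[OF _ i0] by (cases x) (auto simp: packet_cell_eq)
        qed
        then show "L2_inner lborel (e q) (packet (t, (undefined, 0))) = 0"
          by (simp add: lk(1) e_scaled)
      qed
      then show False
        using packet_norm[OF i0 i0, of t t] by simp
    qed
  qed
qed

end

theorem theorem4p5:
  fixes A :: "real ^ 'd ^ 'd"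
    and a :: nat
    and V :: "int \<Rightarrow> (real ^ 'd \<Rightarrow> complex) set"
    and \<phi> :: "'l::finite \<Rightarrow> real ^ 'd \<Rightarrow> complex"
    and K :: "(real ^ 'd) set"
    and h :: "nat \<Rightarrow> 'l \<Rightarrow> 'l \<Rightarrow> real ^ 'd \<Rightarrow> complex"
    and f :: "nat \<Rightarrow> 'l \<Rightarrow> real ^ 'd \<Rightarrow> complex"
    and S :: "(nat \<times> int) set"
  assumes "dilation_matrix A"
    and "real a = \<bar>det A\<bar>"
    and "mra A V \<phi>"
    and "digit_set (transpose A) K"
    and "multiwavelet_filters A a K \<phi> h"
    and "basic_multiwavelet_packets A a \<phi> h f"
    and "\<forall>(n, j)\<in>S. 0 \<le> j"
  shows "orthonormal_basis lborel (scaled_packet A a f) (UNIV \<times> int_lattice \<times> S) (L2_space lborel)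
    \<longleftrightarrow> partition_of_nat (packet_cell a) S"
proof -
  interpret multiwavelet_packets A a V \<phi> K h f
    using assms by unfold_locales
  show ?thesis
    using assms(7) by (rule orthonormal_basis_iff_partition)
qed

end
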